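(* Let $\alpha\in[0,1)$, let $n,d$ be integers with $\mathscr{B}(n,d)\ne\varnothing$, and let $G$ be a graph with the maximal $\alpha$-spectral radius among all graphs in $\mathscr{B}(n,d)$. Then $G\cong B_3^*(n,d)$ or $G\cong B_5^*(n,d)$.
   Context: All graphs are finite, undirected and simple. For a graph $G$ with adjacency matrix $A(G)$ and diagonal degree matrix $D(G)$, $A_\alpha(G)=\alpha D(G)+(1-\alpha)A(G)$, and $\rho_\alpha(G)$ (the $\alpha$-spectral radius) is the spectral radius of $A_\alpha(G)$. A bicyclic graph is a connected graph whose number of edges equals its number of vertices plus one. $\mathscr{B}(n,d)$ is the set of all bicyclic graphs with $n$ vertices and diameter $d$. Let $\Theta$ be the bicyclic graph on the four vertices $w_1,w_2,w_3,w_4$ with edges $w_1w_2,w_2w_3,w_3w_4,w_4w_1,w_2w_4$ (so $w_1,w_3$ have degree $2$ and $w_2,w_4$ have degree $3$). For integers $s,a,b\ge0$: $\Theta_3(s;a,b)$ is the graph obtained from $\Theta$ by attaching $s$ pendant edges and a pendant path of length $a$ (i.e. with $a$ new vertices) at $w_2$, and a pendant path of length $b$ at $w_4$; $\Theta_5(s;a,b)$ is the graph obtained from $\Theta$ by attaching $s$ pendant edges at $w_2$, a pendant path of length $a$ at $w_1$ and a pendant path of length $b$ at $w_3$. $B_3^*(n,d)$ is the graph $\Theta_3(s;a,b)$ with $n$ vertices ($s+a+b+4=n$), $d=a+b+1$ and $0\le a-b\le1$ (it exists only when $s=n-d-3\ge 0$; otherwise the alternative $G\cong B_3^*(n,d)$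 is void). $B_5^*(n,d)$ is the graph $\Theta_5(s;a,b)$ with $n$ vertices ($s+a+b+4=n$), $d=a+b+2$ and $0\le a-b\le 1$. *)

theory Defs
  imports
    "Graph_Theory.Graph_Theory"
    "Jordan_Normal_Form.Spectral_Radius"
begin

text \<open>
  A finite simple undirected graph is a \<open>pair_graph\<close>: finitely many vertices and a symmetric,
  irreflexive arc relation. An undirected edge corresponds to two opposite arcs.
\<close>

definition uedges :: "'a pair_pre_digraph \<Rightarrow> 'a set set" where
  "uedges G = (\<lambda>(u, v). {u, v}) ` parcs G"

definition bicyclic :: "'a pair_pre_digraph \<Rightarrow> bool" where
  "bicyclic G \<longleftrightarrow> pair_graph G \<and> Digraph_Component.connected (with_proj G)
     \<and> card (uedges G) = card (pverts G) + 1"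

definition gdist :: "'a pair_pre_digraph \<Rightarrow> 'a \<Rightarrow> 'a \<Rightarrow> ereal" where
  "gdist G = wf_digraph.\<mu> (with_proj G) (\<lambda>_. 1)"

definition diameter :: "'a pair_pre_digraph \<Rightarrow> ereal" where
  "diameter G = (SUP u\<in>pverts G. SUP v\<in>pverts G. gdist G u v)"

definition bicyclic_graphs :: "nat \<Rightarrow> nat \<Rightarrow> 'a pair_pre_digraph set" where
  "bicyclic_graphs n d =
     {G. bicyclic G \<and> card (pverts G) = n \<and> diameter G = ereal (real d)}"

text \<open>Rows and columns are indexed by positions in an enumeration \<open>vs\<close> of the vertices.\<close>

definition adjacency_mat :: "'a list \<Rightarrow> 'a pair_pre_digraph \<Rightarrow> real mat" where
  "adjacency_mat vs G = mat (length vs) (length vs)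
     (\<lambda>(i, j). if (vs ! i, vs ! j) \<in> parcs G then 1 else 0)"

definition degree_mat :: "'a list \<Rightarrow> 'a pair_pre_digraph \<Rightarrow> real mat" where
  "degree_mat vs G = mat (length vs) (length vs)
     (\<lambda>(i, j). if i = j then real (out_degree (with_proj G) (vs ! i)) else 0)"

definition alpha_mat :: "real \<Rightarrow> 'a list \<Rightarrow> 'a pair_pre_digraph \<Rightarrow> real mat" where
  "alpha_mat \<alpha> vs G = \<alpha> \<cdot>\<^sub>m degree_mat vs G + (1 - \<alpha>) \<cdot>\<^sub>m adjacency_mat vs G"

definition alpha_spectral_radius :: "real \<Rightarrow> 'a pair_pre_digraph \<Rightarrow> real" where
  "alpha_spectral_radius \<alpha> G =
     (let vs = (SOME vs. distinct vs \<and> set vs = pverts G)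
      in spectral_radius (map_mat complex_of_real (alpha_mat \<alpha> vs G)))"

text \<open>The choice of the enumeration is immaterial.\<close>

lemma eigenvalue_alpha_mat_reorder:
  assumes vs: "distinct vs" and ws: "distinct ws" "set vs = set ws"
    and ev: "eigenvalue (map_mat complex_of_real (alpha_mat \<alpha> vs G)) k"
  shows "eigenvalue (map_mat complex_of_real (alpha_mat \<alpha> ws G)) k"
proof -
  define c where "c u v = complex_of_real
    (\<alpha> * (if u = v then real (out_degree (with_proj G) u) else 0)
     + (1 - \<alpha>) * (if (u, v) \<in> parcs G then 1 else 0))" for u v
  have entry: "map_mat complex_of_real (alpha_mat \<alpha> xs G) =
      mat (length xs) (length xs) (\<lambda>(i, j). c (xs ! i) (xs ! j))"
    if "distinct xs" for xs :: "'a list"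
    using that by (intro eq_matI)
      (auto simp: alpha_mat_def adjacency_mat_def degree_mat_def c_def nth_eq_iff_index_eq)
  have char: "eigenvalue (map_mat complex_of_real (alpha_mat \<alpha> xs G)) k \<longleftrightarrow>
      (\<exists>f. (\<exists>u\<in>set xs. f u \<noteq> 0) \<and> (\<forall>u\<in>set xs. (\<Sum>v\<in>set xs. c u v * f v) = k * f u))"
    (is "?L \<longleftrightarrow> ?R") if d: "distinct xs" for xs :: "'a list"
  proof -
    let ?n = "length xs"
    let ?M = "mat ?n ?n (\<lambda>(i, j). c (xs ! i) (xs ! j))"
    have bij: "bij_betw (\<lambda>i. xs ! i) {0..<?n} (set xs)"
      using d by (simp add: bij_betw_nth atLeast0LessThan)
    have mult: "(?M *\<^sub>v x) $ i = (\<Sum>j\<in>{0..<?n}. c (xs ! i) (xs ! j) * x $ j)"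
      if "i < ?n" "x \<in> carrier_vec ?n" for i and x :: "complex vec"
      using that by (simp add: scalar_prod_def)
    have sum: "(\<Sum>j\<in>{0..<?n}. g (xs ! j)) = (\<Sum>v\<in>set xs. g v)" for g :: "'a \<Rightarrow> complex"
      by (rule sum.reindex_bij_betw[OF bij])
    show ?thesis
    proof
      assume ?L
      then obtain x where x: "x \<in> carrier_vec ?n" "x \<noteq> 0\<^sub>v ?n" "?M *\<^sub>v x = k \<cdot>\<^sub>v x"
        by (auto simp: entry[OF d] eigenvalue_def eigenvector_def)
      define f where "f v = x $ (the_inv_into {0..<?n} (\<lambda>i. xs ! i) v)" for v
      have f: "f (xs ! i) = x $ i" if "i < ?n" for i
        using that bij by (simp add: f_def bij_betw_def the_inv_into_f_f)
      have "(\<Sum>v\<in>set xs. c (xs ! i) v * f v) = k * f (xs ! i)" if i: "i < ?n" for i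
      proof -
        have "(\<Sum>v\<in>set xs. c (xs ! i) v * f v) = (?M *\<^sub>v x) $ i"
          unfolding mult[OF i x(1)] sum[symmetric] by (rule sum.cong) (auto simp: f)
        also have "\<dots> = k * f (xs ! i)" using x i by (simp add: f)
        finally show ?thesis .
      qed
      moreover have "\<exists>i<?n. x $ i \<noteq> 0" using x(1,2) by auto
      ultimately show ?R by (intro exI[of _ f]) (force simp: in_set_conv_nth f)
    next
      assume ?R
      then obtain f where f: "\<exists>u\<in>set xs. f u \<noteq> 0"
        "\<And>u. u \<in> set xs \<Longrightarrow> (\<Sum>v\<in>set xs. c u v * f v) = k * f u" by blast
      define x where "x = vec ?n (\<lambda>i. f (xs ! i))"
      have xc: "x \<in> carrier_vec ?n" by (simp add: x_def)
      have "?M *\<^sub>v x = k \<cdot>\<^sub>v x"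
      proof (rule eq_vecI)
        fix i assume "i < dim_vec (k \<cdot>\<^sub>v x)"
        then have i: "i < ?n" by (simp add: x_def)
        have "(?M *\<^sub>v x) $ i = (\<Sum>v\<in>set xs. c (xs ! i) v * f v)"
          unfolding mult[OF i xc] sum[symmetric] by (rule sum.cong) (auto simp: x_def)
        then show "(?M *\<^sub>v x) $ i = (k \<cdot>\<^sub>v x) $ i" using i f(2) by (simp add: x_def)
      qed (simp add: x_def)
      moreover obtain i where "i < ?n" "f (xs ! i) \<noteq> 0"
        using f(1) by (auto simp: in_set_conv_nth)
      then have "x \<noteq> 0\<^sub>v ?n" by (metis index_vec index_zero_vec(1) x_def)
      ultimately show ?L using xc
        by (auto simp: entry[OF d] eigenvalue_def eigenvector_def)
    qed
  qed
  show ?thesis using ev by (simp add: char[OF vs] char[OF ws(1)] ws(2))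
qed

lemma alpha_spectral_radius_enum:
  assumes vs: "distinct vs" "set vs = pverts G"
  shows "alpha_spectral_radius \<alpha> G = spectral_radius (map_mat complex_of_real (alpha_mat \<alpha> vs G))"
proof -
  define ws where "ws = (SOME vs. distinct vs \<and> set vs = pverts G)"
  have ws: "distinct ws \<and> set ws = pverts G"
    unfolding ws_def by (rule someI[of _ vs]) (use vs in simp)
  have "spectrum (map_mat complex_of_real (alpha_mat \<alpha> ws G)) =
      spectrum (map_mat complex_of_real (alpha_mat \<alpha> vs G))"
    using vs ws eigenvalue_alpha_mat_reorder[of ws vs] eigenvalue_alpha_mat_reorder[of vs ws]
    by (auto simp: spectrum_def)
  then show ?thesis
    by (simp add: alpha_spectral_radius_def ws_def[symmetric] spectral_radius_def)
qed

text \<open>The vertices $w_1, w_2, w_3, w_4$ are \<open>0, 1, 2, 3\<close>.\<close>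

definition Theta :: "nat pair_pre_digraph" where
  "Theta = \<lparr> pverts = {0, 1, 2, 3},
     parcs = {(0, 1), (1, 0), (1, 2), (2, 1), (2, 3), (3, 2), (3, 0), (0, 3), (1, 3), (3, 1)} \<rparr>"

definition fresh :: "nat pair_pre_digraph \<Rightarrow> nat" where
  "fresh G = Suc (Max (pverts G))"

definition attach_pendant :: "nat \<Rightarrow> nat pair_pre_digraph \<Rightarrow> nat pair_pre_digraph" where
  "attach_pendant v G = \<lparr> pverts = insert (fresh G) (pverts G),
     parcs = parcs G \<union> {(v, fresh G), (fresh G, v)} \<rparr>"

fun attach_pendants :: "nat \<Rightarrow> nat \<Rightarrow> nat pair_pre_digraph \<Rightarrow> nat pair_pre_digraph" where
  "attach_pendants v 0 G = G"
| "attach_pendants v (Suc s) G = attach_pendants v s (attach_pendant v G)"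

fun attach_path :: "nat \<Rightarrow> nat \<Rightarrow> nat pair_pre_digraph \<Rightarrow> nat pair_pre_digraph" where
  "attach_path v 0 G = G"
| "attach_path v (Suc l) G = attach_path (fresh G) l (attach_pendant v G)"

definition Theta3 :: "nat \<Rightarrow> nat \<Rightarrow> nat \<Rightarrow> nat pair_pre_digraph" where
  "Theta3 s a b = attach_path 3 b (attach_path 1 a (attach_pendants 1 s Theta))"

definition Theta5 :: "nat \<Rightarrow> nat \<Rightarrow> nat \<Rightarrow> nat pair_pre_digraph" where
  "Theta5 s a b = attach_path 2 b (attach_path 0 a (attach_pendants 1 s Theta))"

text \<open>
  As sets, because the graphs need not exist; each set has at most one element, since the
  constraints determine \<open>s\<close>, \<open>a\<close> and \<open>b\<close>.
\<close>

definition B3_star :: "nat \<Rightarrow> nat \<Rightarrow> nat pair_pre_digraph set" where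
  "B3_star n d = {Theta3 s a b | s a b.
     s + a + b + 4 = n \<and> d = a + b + 1 \<and> b \<le> a \<and> a - b \<le> 1}"

definition B5_star :: "nat \<Rightarrow> nat \<Rightarrow> nat pair_pre_digraph set" where
  "B5_star n d = {Theta5 s a b | s a b.
     s + a + b + 4 = n \<and> d = a + b + 2 \<and> b \<le> a \<and> a - b \<le> 1}"

definition graph_iso :: "'a pair_pre_digraph \<Rightarrow> 'b pair_pre_digraph \<Rightarrow> bool" where
  "graph_iso G H \<longleftrightarrow> digraph_iso (with_proj G) (with_proj H)"

end

theory Submission
  imports "HOL-Analysis.Analysis" Defs
begin

text \<open>
  Why the theorem holds. Let \<open>x\<close> be the positive eigenvector of the maximal graph \<open>G\<close>, scaled to norm
  one. For every graph \<open>H\<close> with the same vertices, the quadratic form at \<open>x\<close> is a sum of weights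
  \<open>\<alpha> (x u)\<^sup>2 + \<alpha> (x v)\<^sup>2 + 2 (1 - \<alpha>) (x u) (x v)\<close> over the edges \<open>uv\<close> of \<open>H\<close>, it is a lower bound
  for the spectral radius of \<open>H\<close>, and for \<open>G\<close> it equals the spectral radius. So \<open>G\<close> has the largest
  weight among all bicyclic graphs of the given diameter on these vertices, and a competitor of
  equal weight has \<open>x\<close> as eigenvector for the same eigenvalue; in particular, corresponding rows of
  the two matrices have the same product with \<open>x\<close> (\<open>perron_extremal\<close>, collected in the locale
  \<open>extremal\<close>). What remains is a combinatorial problem: how should given values be placed on a
  bicyclic graph of diameter \<open>d\<close> so that the total weight is largest?

  Let \<open>m\<close> be a vertex with the largest value, and take a diametral path. The edges of the path weigh
  at most as much as in the zigzag ordering, where the values decrease alternately on both sides of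
  the largest one (\<open>path_weight_le_zigzag\<close>). In a spanning tree that contains the path and as many
  edges at \<open>m\<close> as possible, each edge outside the path weighs at most as much as a pendant edge at
  \<open>m\<close>. The two remaining edges avoid \<open>m\<close>, and they can be traded for two edges that form a star
  inside the neighbourhood of \<open>m\<close>, either around a pendant vertex or around a path neighbour of \<open>m\<close>
  (\<open>theta_improvement\<close>). This yields a competitor at least as heavy as \<open>G\<close>, and equality of the row
  sums, first at \<open>m\<close> and then at the ends of the two remaining edges, shows that \<open>G\<close> itself has this
  form (\<open>centre_on_geodesic\<close>, \<open>extremal_is_theta\<close>). These are the graphs \<open>\<Theta>\<^sub>5(s; a, b)\<close> and
  \<open>\<Theta>\<^sub>3(s; a, b)\<close>.

  Finally the two arms are balanced. Exchanging tails of the arms never helps in a maximal graph, so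
  a shorter arm is pointwise lighter than a suitably shifted longer arm (\<open>arms_compare\<close>). If the
  lengths differed by too much, then shifting the centre along the path, or moving the star to the
  other path neighbour, would increase the weight or change a row sum (\<open>theta5_balanced\<close>,
  \<open>theta3_balanced\<close>).
\<close>

section \<open>Edges of a path\<close>

fun path_edges :: "'a list \<Rightarrow> 'a set set" where
  "path_edges (a # b # xs) = insert {a, b} (path_edges (b # xs))"
| "path_edges _ = {}"

lemma path_edges_Cons: "xs \<noteq> [] \<Longrightarrow> path_edges (a # xs) = insert {a, hd xs} (path_edges xs)"
  by (cases xs) auto

lemma path_edges_append:
  "path_edges (xs @ a # ys) = path_edges (xs @ [a]) \<union> path_edges (a # ys)"
  by (induction xs rule: path_edges.induct) (auto simp: path_edges_Cons)

lemma path_edges_rev: "path_edges (rev xs) = path_edges xs"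
proof (induction xs rule: path_edges.induct)
  case (1 a b xs)
  have "path_edges (rev (a # b # xs)) = path_edges (rev xs @ b # [a])" by simp
  also have "\<dots> = path_edges (rev (b # xs)) \<union> path_edges [b, a]"
    by (subst path_edges_append) simp
  finally show ?case using 1 by (auto simp: insert_commute)
qed auto

lemma path_edges_subset: "e \<in> path_edges xs \<Longrightarrow> e \<subseteq> set xs"
  by (induction xs rule: path_edges.induct) auto

lemma finite_path_edges: "finite (path_edges xs)"
  by (induction xs rule: path_edges.induct) auto

lemma path_edges_card: "distinct xs \<Longrightarrow> e \<in> path_edges xs \<Longrightarrow> card e = 2"
  by (induction xs rule: path_edges.induct) auto

lemma path_edges_nth:
  "path_edges xs = {{xs ! i, xs ! Suc i} | i. Suc i < length xs}"
proof (induction xs rule: path_edges.induct)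
  case (1 a b xs)
  have "{{(a # b # xs) ! i, (a # b # xs) ! Suc i} | i. Suc i < length (a # b # xs)}
     = insert {a, b} {{(b # xs) ! i, (b # xs) ! Suc i} | i. Suc i < length (b # xs)}"
    (is "?A = insert _ ?B")
  proof (intro equalityI subsetI)
    fix e assume "e \<in> ?A"
    then obtain i where "e = {(a # b # xs) ! i, (a # b # xs) ! Suc i}" "Suc i < length (a # b # xs)" by blast
    then show "e \<in> insert {a, b} ?B" by (cases i) auto
  next
    fix e assume "e \<in> insert {a, b} ?B"
    then consider "e = {a, b}" | i where "e = {(b # xs) ! i, (b # xs) ! Suc i}" "Suc i < length (b # xs)" by blast
    then show "e \<in> ?A"
    proof cases
      case 1 then show ?thesis by (intro CollectI exI[of _ 0]) auto
    next
      case 2 then show ?thesis by (intro CollectI exI[of _ "Suc i"]) auto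
    qed
  qed
  then show ?case using 1 by simp
qed auto

lemma path_edges_card_eq: "distinct xs \<Longrightarrow> card (path_edges xs) = length xs - 1"
proof (induction xs rule: path_edges.induct)
  case (1 a b xs)
  have "{a, b} \<notin> path_edges (b # xs)" using 1(2) path_edges_subset[of "{a, b}" "b # xs"] by auto
  then show ?case using 1 by (simp add: finite_path_edges)
qed auto

lemma path_edges_split:
  "path_edges (rev L @ m # R) = path_edges (m # L) \<union> path_edges (m # R)"
  using path_edges_append[of "rev L" m R] path_edges_rev[of "m # L"] by simp

section \<open>Weights of edges and paths\<close>

text \<open>
  For a vector \<open>x\<close>, the quadratic form of \<open>A\<^sub>\<alpha>\<close> at \<open>x\<close> is a sum over
  the edges; \<open>wt u v\<close> is the share of the edge \<open>uv\<close>, and \<open>edge_weight\<close> is the same for an edge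
  given as a two-element set. All comparisons of graphs below are comparisons of such sums for one fixed \<open>x\<close>.
\<close>
locale vertex_weight =
  fixes \<alpha> :: real and x :: "'a \<Rightarrow> real"
  assumes \<alpha>0: "0 \<le> \<alpha>" and \<alpha>1: "\<alpha> < 1" and x0: "\<And>u. 0 \<le> x u"
begin

definition wt :: "'a \<Rightarrow> 'a \<Rightarrow> real" where
  "wt u v = \<alpha> * ((x u)^2 + (x v)^2) + 2 * (1 - \<alpha>) * x u * x v"

definition edge_weight :: "'a set \<Rightarrow> real" where
  "edge_weight e = \<alpha> * (\<Sum>u\<in>e. (x u)^2) + 2 * (1 - \<alpha>) * (\<Prod>u\<in>e. x u)"

definition weight :: "'a set set \<Rightarrow> real" where
  "weight D = (\<Sum>e\<in>D. edge_weight e)"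

fun path_weight :: "'a list \<Rightarrow> real" where
  "path_weight (a # b # xs) = wt a b + path_weight (b # xs)"
| "path_weight _ = 0"

lemma edge_weight_pair: "u \<noteq> v \<Longrightarrow> edge_weight {u, v} = wt u v"
  by (simp add: edge_weight_def wt_def algebra_simps)

lemma wt_commute: "wt u v = wt v u"
  by (simp add: wt_def algebra_simps)

lemma wt_mono: "x a \<le> x a' \<Longrightarrow> x b \<le> x b' \<Longrightarrow> wt a b \<le> wt a' b'"
  unfolding wt_def using \<alpha>0 \<alpha>1 x0[of a] x0[of b]
  by (intro add_mono mult_left_mono mult_mono power_mono) auto

lemma wt_mono1: "x a \<le> x a' \<Longrightarrow> wt a b \<le> wt a' b"
  and wt_mono2: "x b \<le> x b' \<Longrightarrow> wt a b \<le> wt a b'"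
  using wt_mono by auto

lemma wt_strict: 
  assumes "x a < x a'" "0 < x b" shows "wt a b < wt a' b"
proof -
  have "\<alpha> * ((x a)^2 + (x b)^2) \<le> \<alpha> * ((x a')^2 + (x b)^2)"
    using \<alpha>0 x0[of a] assms by (intro mult_left_mono add_mono power_mono) auto
  moreover have "2 * (1 - \<alpha>) * x a * x b < 2 * (1 - \<alpha>) * x a' * x b"
    using \<alpha>1 assms by simp
  ultimately show ?thesis unfolding wt_def by linarith
qed

text \<open>
  Exchanging the far ends of two edges leaves all degrees alone, so that the squares cancel and the
  sign of the change is that of a product of two differences.
\<close>
lemma wt_exchange:
  "wt a d + wt c b - (wt a b + wt c d) = 2 * (1 - \<alpha>) * ((x a - x c) * (x d - x b))"
  unfolding wt_def by (simp add: algebra_simps power2_eq_square)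

lemma weight_path:
  "distinct xs \<Longrightarrow> weight (path_edges xs) = path_weight xs"
proof (induction xs rule: path_edges.induct)
  case (1 a b xs)
  have "{a, b} \<notin> path_edges (b # xs)" using 1(2) path_edges_subset[of "{a, b}" "b # xs"] by auto
  then show ?case using 1 by (simp add: weight_def finite_path_edges edge_weight_pair)
qed (auto simp: weight_def)

lemma path_weight_Cons: "xs \<noteq> [] \<Longrightarrow> path_weight (a # xs) = wt a (hd xs) + path_weight xs"
  by (cases xs) auto

lemma path_weight_append: "path_weight (xs @ a # ys) = path_weight (xs @ [a]) + path_weight (a # ys)"
  by (induction xs rule: path_weight.induct) (simp_all add: path_weight_Cons)

lemma path_weight_rev: "path_weight (rev xs) = path_weight xs"
proof (induction xs rule: path_weight.induct)
  case (1 a b xs)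
  have "path_weight (rev (a # b # xs)) = path_weight (rev xs @ b # [a])" by simp
  also have "\<dots> = path_weight (rev (b # xs)) + path_weight [b, a]"
    by (subst path_weight_append) simp
  finally show ?case using 1 by (simp add: wt_commute)
qed auto

lemma path_weight_split: "path_weight (rev L @ m # R) = path_weight (m # L) + path_weight (m # R)"
  using path_weight_append[of "rev L" m R] path_weight_rev[of "m # L"] by simp

section \<open>The zigzag arrangement of a path\<close>

text \<open>
  The weight of two chains that start at \<open>a\<close> and \<open>b\<close> when the vertices of a list are dealt out to
  them in turn. With \<open>a = b\<close> and a decreasing list this is a path whose values decrease
  alternately on the two sides of its largest vertex.
\<close>
fun zigzag :: "'a \<Rightarrow> 'a \<Rightarrow> 'a list \<Rightarrow> real" where
  "zigzag a b [] = 0"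
| "zigzag a b (q # qs) = wt a q + zigzag b q qs"

lemma zigzag_mono: "x a \<le> x a' \<Longrightarrow> x b \<le> x b' \<Longrightarrow> zigzag a b qs \<le> zigzag a' b' qs"
  by (induction qs arbitrary: a b a' b') (auto intro!: add_mono wt_mono)

lemma zigzag_remove_max:
  "zigzag p p (q # r # qs) = zigzag q q (r # qs) + (wt p q + wt p r - wt q r)"
  by (simp add: wt_def)

text \<open>
  Among all orderings of given values along a path, the zigzag ordering is heaviest. Induction:
  delete the largest vertex \<open>p\<close> from the path and join its neighbours \<open>u\<close>, \<open>v\<close>. The weight lost is
  \<open>2 \<alpha> p\<^sup>2 + 2 (1 - \<alpha>) (p\<^sup>2 - (p - u) (p - v))\<close>, which increases with \<open>u\<close> and \<open>v\<close>; hence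
  it is at most what is lost when the neighbours are the second and third largest values, as they
  are in the zigzag. If \<open>p\<close> is an end of the path, less is lost.
\<close>
lemma path_weight_le_zigzag:
  "mset xs = mset (p # qs) \<Longrightarrow> sorted_wrt (\<lambda>u v. x v \<le> x u) (p # qs) \<Longrightarrow> path_weight xs \<le> zigzag p p qs"
proof (induction qs arbitrary: p xs)
  case Nil
  then show ?case by simp
next
  case (Cons q qs)
  have "p \<in> set xs" using Cons.prems(1) by (metis list.set_intros(1) set_mset_mset)
  then obtain us vs where xs: "xs = us @ p # vs" by (meson split_list)
  have ms: "mset (us @ vs) = mset (q # qs)" using Cons.prems(1) xs by simp
  have srt: "sorted_wrt (\<lambda>u v. x v \<le> x u) (q # qs)" using Cons.prems(2) by simp
  have IH: "path_weight (us @ vs) \<le> zigzag q q qs" by (rule Cons.IH[OF ms srt])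
  have le_q: "x u \<le> x q" if "u \<in> set us \<union> set vs" for u
  proof -
    have "u \<in> set (q # qs)" using ms that by (metis set_append set_mset_mset)
    then show ?thesis using srt by auto
  qed
  have qp: "x q \<le> x p" using Cons.prems(2) by simp
  show ?case
  proof (cases qs)
    case Nil
    then have "size (mset (us @ vs)) = 1" using ms by simp
    then have "us @ vs = [q]" using ms Nil by (metis mset_single_iff)
    then consider "us = []" "vs = [q]" | "us = [q]" "vs = []"
      by (metis append_eq_Cons_conv append_is_Nil_conv)
    then show ?thesis using Nil xs by cases (auto simp: wt_commute)
  next
    case (Cons r qs')
    have rq: "x r \<le> x q" using srt Cons by simp
    have zz: "zigzag p p (q # qs) = zigzag q q qs + (wt p q + wt p r - wt q r)"
      using Cons zigzag_remove_max by simp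
    have rp: "wt q r \<le> wt p r" using qp by (rule wt_mono1)
    consider "us = []" "vs = []" | v vs' where "us = []" "vs = v # vs'"
      | u us' where "us = us' @ [u]" "vs = []" | u us' v vs' where "us = us' @ [u]" "vs = v # vs'"
      by (metis list.exhaust rev_exhaust)
    then show ?thesis
    proof cases
      case 1
      then show ?thesis using ms by simp
    next
      case 2
      have "path_weight xs = wt p v + path_weight (us @ vs)" using 2 xs by simp
      moreover have "wt p v \<le> wt p q" using 2 le_q by (intro wt_mono2) auto
      ultimately show ?thesis using IH zz rp by linarith
    next
      case 3
      have "path_weight xs = path_weight (us' @ u # [p])" using xs 3 by simp
      also have "\<dots> = path_weight (us @ vs) + wt u p" using 3 by (subst path_weight_append) simp
      finally have "path_weight xs = path_weight (us @ vs) + wt p u" by (simp add: wt_commute)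
      moreover have "wt p u \<le> wt p q" using 3 le_q by (intro wt_mono2) auto
      ultimately show ?thesis using IH zz rp by linarith
    next
      case 4
      have a: "path_weight xs = path_weight (us' @ [u]) + (wt u p + wt p v + path_weight (v # vs'))"
        using xs 4 path_weight_append[of us' u "p # v # vs'"] by simp
      have b: "path_weight (us @ vs) = path_weight (us' @ [u]) + (wt u v + path_weight (v # vs'))"
        using 4 path_weight_append[of us' u "v # vs'"] by simp
      have "mset (u # v # us' @ vs') = mset (q # r # qs')" using ms 4 Cons by simp
      then have "(x u \<le> x q \<and> x v \<le> x r) \<or> (x u \<le> x r \<and> x v \<le> x q)"
      proof -
        assume m: "mset (u # v # us' @ vs') = mset (q # r # qs')"
        have small: "x w \<le> x r" if "w \<in># mset (r # qs')" for w using that srt Cons by auto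
        have *: "u = q \<or> u \<in># mset (r # qs')" "v = q \<or> v \<in># mset (r # qs')"
          using m by (metis list.set_intros set_ConsD set_mset_mset)+
        show ?thesis
        proof (cases "u = q")
          case True
          then have "mset (v # us' @ vs') = mset (r # qs')" using m by simp
          then have "v \<in># mset (r # qs')" by (metis list.set_intros(1) set_mset_mset)
          then show ?thesis using True small by auto
        next
          case False
          then show ?thesis using * small rq by fastforce
        qed
      qed
      moreover have "wt u p + wt p v - wt u v \<le> wt p q + wt p r - wt q r" 
        if "x u \<le> x a" "x v \<le> x b" "x a \<le> x p" "x b \<le> x p" "wt a p + wt p b - wt a b = wt p q + wt p r - wt q r" for a b
      proof -
        have "wt u p + wt p v - wt u v = 2 * \<alpha> * (x p)^2 + 2 * (1 - \<alpha>) * ((x p)^2 - (x p - x u) * (x p - x v))" for u v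
          unfolding wt_def by (simp add: algebra_simps power2_eq_square)
        moreover have "(x p - x a) * (x p - x b) \<le> (x p - x u) * (x p - x v)"
          using that by (intro mult_mono) auto
        then have "2 * (1 - \<alpha>) * ((x p)^2 - (x p - x u) * (x p - x v)) \<le> 2 * (1 - \<alpha>) * ((x p)^2 - (x p - x a) * (x p - x b))"
          using \<alpha>1 by (intro mult_left_mono) auto
        ultimately show ?thesis using that(5) by simp
      qed
      from this[of q r] this[of r q] qp rq have
        "x u \<le> x q \<and> x v \<le> x r \<Longrightarrow> wt u p + wt p v - wt u v \<le> wt p q + wt p r - wt q r"
        "x u \<le> x r \<and> x v \<le> x q \<Longrightarrow> wt u p + wt p v - wt u v \<le> wt p q + wt p r - wt q r"
        by (auto simp: wt_commute)
      ultimately show ?thesis using a b IH zz by linarith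
    qed
  qed
qed

end

text \<open>
  Applied to a list and to its tail, this deals the list out to two hands.
\<close>
fun evens :: "'a list \<Rightarrow> 'a list" where
  "evens [] = []"
| "evens [a] = [a]"
| "evens (a # b # xs) = a # evens xs"

lemma evens_Cons: "evens (a # xs) = a # evens (tl xs)"
  by (cases xs) auto

lemma length_evens_odds: "length (evens xs) + length (evens (tl xs)) = length xs"
  by (induction xs rule: evens.induct) (auto simp: evens_Cons)

lemma set_evens_odds: "set (evens xs) \<union> set (evens (tl xs)) = set xs"
  by (induction xs rule: evens.induct) (auto simp: evens_Cons)

lemma distinct_evens_odds: "distinct xs \<Longrightarrow> distinct (evens xs @ evens (tl xs))"
proof (induction xs rule: evens.induct)
  case (3 a b xs)
  then show ?case using set_evens_odds[of xs] by (auto simp: evens_Cons)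
qed auto

lemma (in vertex_weight) zigzag_evens:
  "path_weight (a # evens qs) + path_weight (b # evens (tl qs)) = zigzag a b qs"
proof (induction qs arbitrary: a b)
  case (Cons q qs)
  show ?case using Cons[of b q] by (simp add: evens_Cons)
qed auto

section \<open>Bicyclic graphs as edge sets\<close>

definition simple_graph :: "'a set \<Rightarrow> 'a set set \<Rightarrow> bool" where
  "simple_graph V D \<longleftrightarrow> finite V \<and> (\<forall>e\<in>D. e \<subseteq> V \<and> card e = 2)"

text \<open>
  \<open>near D k u v\<close>: there is a walk of length at most \<open>k\<close> from \<open>u\<close> to \<open>v\<close>.
\<close>
fun near :: "'a set set \<Rightarrow> nat \<Rightarrow> 'a \<Rightarrow> 'a \<Rightarrow> bool" where
  "near D 0 u v \<longleftrightarrow> u = v"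
| "near D (Suc k) u v \<longleftrightarrow> near D k u v \<or> (\<exists>w. {u, w} \<in> D \<and> near D k w v)"

text \<open>
  Connectedness is contained in the bound on the distances.
\<close>
definition bicyclic_diam :: "'a set \<Rightarrow> 'a set set \<Rightarrow> nat \<Rightarrow> bool" where
  "bicyclic_diam V D d \<longleftrightarrow> simple_graph V D \<and> card D = card V + 1 \<and>
     (\<forall>u\<in>V. \<forall>v\<in>V. near D d u v) \<and> (\<exists>u\<in>V. \<exists>v\<in>V. \<forall>k<d. \<not> near D k u v)"

lemma simple_graph_edge:
  assumes "simple_graph V D" "e \<in> D"
  obtains u v where "e = {u, v}" "u \<noteq> v" "u \<in> V" "v \<in> V"
  using assms unfolding simple_graph_def by (metis card_2_iff insert_subset)

lemma simple_graph_pair: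
  "simple_graph V D \<Longrightarrow> {u, v} \<in> D \<Longrightarrow> u \<noteq> v \<and> u \<in> V \<and> v \<in> V"
  by (metis doubleton_eq_iff simple_graph_edge)

lemma finite_simple_graph: "simple_graph V D \<Longrightarrow> finite D"
  unfolding simple_graph_def by (meson Sup_le_iff finite_UnionD finite_subset)

lemma near_refl: "near D k u u"
  by (induction k) auto

lemma near_mono: "near D k u v \<Longrightarrow> k \<le> l \<Longrightarrow> near D l u v"
  by (rule lift_Suc_mono_le[of "\<lambda>k. near D k u v", THEN le_boolD, rule_format]) auto

lemma near_edge: "{u, v} \<in> D \<Longrightarrow> near D (Suc 0) u v"
  by auto

lemma near_trans: "near D j u v \<Longrightarrow> near D k v w \<Longrightarrow> near D (j + k) u w"
proof (induction j arbitrary: u)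
  case 0
  then show ?case by simp
next
  case (Suc j)
  then show ?case by auto
qed

lemma near_sym: "near D k u v \<Longrightarrow> near D k v u"
proof (induction k arbitrary: u)
  case (Suc k)
  then consider "near D k u v" | w where "{u, w} \<in> D" "near D k w v" by auto
  then show ?case
  proof cases
    case 2
    then have "near D (k + Suc 0) v u"
      using Suc.IH[of w] near_edge[of w u D] by (intro near_trans[of D k v w]) (auto simp: insert_commute)
    then show ?thesis by simp
  qed (use Suc in auto)
qed auto

text \<open>
  Lower bounds for distances will always come from a potential that changes by at most one
  along each edge.
\<close>
lemma near_Lipschitz:
  fixes h :: "'a \<Rightarrow> int"
  assumes "\<And>u w. {u, w} \<in> D \<Longrightarrow> \<bar>h u - h w\<bar> \<le> 1"
  shows "near D k u v \<Longrightarrow> \<bar>h u - h v\<bar> \<le> int k"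
proof (induction k arbitrary: u)
  case (Suc k)
  then consider "near D k u v" | w where "{u, w} \<in> D" "near D k w v" by auto
  then show ?case
  proof cases
    case 1
    then show ?thesis using Suc by fastforce
  next
    case 2
    then show ?thesis using Suc.IH[of w] assms[of u w] by auto
  qed
qed auto

lemma near_nth_path:
  assumes "path_edges P \<subseteq> D" "i \<le> j" "j < length P"
  shows "near D (j - i) (P ! i) (P ! j)"
  using assms(2,3)
proof (induction j rule: dec_induct)
  case base
  then show ?case by simp
next
  case (step j)
  have "{P ! j, P ! Suc j} \<in> D" using assms(1) step by (auto simp: path_edges_nth)
  then have "near D ((j - i) + Suc 0) (P ! i) (P ! Suc j)"
    using step by (intro near_trans[of D _ _ "P ! j"] near_edge) auto
  then show ?case using step by (simp add: Suc_diff_le)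
qed

section \<open>Caterpillars with two further edges\<close>

text \<open>
  The path \<open>rev L @ m # R\<close> with the vertices of \<open>S\<close> hung on \<open>m\<close>: both arms are listed from \<open>m\<close>
  outwards, so that \<open>hd L\<close> and \<open>hd R\<close> are the neighbours of \<open>m\<close> on the path.
\<close>
definition caterpillar :: "'a \<Rightarrow> 'a list \<Rightarrow> 'a list \<Rightarrow> 'a set \<Rightarrow> 'a set set" where
  "caterpillar m L R S = path_edges (rev L @ m # R) \<union> (\<lambda>y. {m, y}) ` S"

definition cat_parts :: "'a set \<Rightarrow> 'a \<Rightarrow> 'a list \<Rightarrow> 'a list \<Rightarrow> 'a set \<Rightarrow> bool" where
  "cat_parts V m L R S \<longleftrightarrow> finite S \<and> distinct (m # L @ R) \<and> S \<inter> set (m # L @ R) = {} \<and>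
     V = set (m # L @ R) \<union> S \<and> L \<noteq> [] \<and> R \<noteq> []"

text \<open>
  The two additional edges form a star inside the neighbourhood of \<open>m\<close>. If its centre is a pendant
  vertex and its leaves are the two path neighbours, the result is a \<open>\<Theta>\<^sub>5\<close>; if its centre is a path
  neighbour and its leaves are two pendant vertices, the result is a \<open>\<Theta>\<^sub>3\<close>. In both cases \<open>m\<close> becomes
  \<open>w\<^sub>2\<close>, and the centre of the star becomes \<open>w\<^sub>4\<close>.
\<close>
definition theta5_edges :: "'a list \<Rightarrow> 'a list \<Rightarrow> 'a set \<Rightarrow> 'a set set \<Rightarrow> bool" where
  "theta5_edges L R S X \<longleftrightarrow> (\<exists>c\<in>S. X = {{c, hd L}, {c, hd R}})"

definition theta3_edges :: "'a list \<Rightarrow> 'a set \<Rightarrow> 'a set set \<Rightarrow> bool" where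
  "theta3_edges L S X \<longleftrightarrow> (\<exists>y\<in>S. \<exists>y'\<in>S. y \<noteq> y' \<and> X = {{hd L, y}, {hd L, y'}})"

definition theta_edges :: "'a list \<Rightarrow> 'a list \<Rightarrow> 'a set \<Rightarrow> 'a set set \<Rightarrow> bool" where
  "theta_edges L R S X \<longleftrightarrow> theta5_edges L R S X \<or> theta3_edges L S X \<or> theta3_edges R S X"

lemma cat_parts_sym: "cat_parts V m L R S \<Longrightarrow> cat_parts V m R L S"
  unfolding cat_parts_def by auto

lemma caterpillar_sym: "caterpillar m R L S = caterpillar m L R S"
  unfolding caterpillar_def path_edges_split by auto

lemma theta5_sym: "theta5_edges L R S X \<Longrightarrow> theta5_edges R L S X"
  unfolding theta5_edges_def by auto

lemma theta_edges_sym: "theta_edges L R S X \<Longrightarrow> theta_edges R L S X"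
  unfolding theta_edges_def using theta5_sym by blast

lemma path_neighbours:
  assumes "distinct (m # L @ R)" "L \<noteq> []" "R \<noteq> []"
  shows "{m, w} \<in> path_edges (rev L @ m # R) \<longleftrightarrow> w = hd L \<or> w = hd R"
proof -
  have "{m, w} \<in> path_edges (m # L) \<longleftrightarrow> w = hd L" if "distinct (m # L)" "L \<noteq> []" for L
  proof -
    obtain a L' where L: "L = a # L'" using \<open>L \<noteq> []\<close> by (cases L) auto
    have "{m, w} \<notin> path_edges L" using that path_edges_subset[of "{m, w}" L] by auto
    then show ?thesis using L that by (auto simp: doubleton_eq_iff)
  qed
  then show ?thesis using assms by (auto simp: path_edges_split)
qed

lemma caterpillar_neighbours:
  assumes "cat_parts V m L R S"
  shows "{m, w} \<in> caterpillar m L R S \<longleftrightarrow> w = hd L \<or> w = hd R \<or> w \<in> S"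
  using assms path_neighbours[of m L R w] unfolding cat_parts_def caterpillar_def
  by (auto simp: doubleton_eq_iff image_iff)

lemma simple_caterpillar:
  assumes "cat_parts V m L R S"
  shows "simple_graph V (caterpillar m L R S)"
proof -
  have d: "distinct (rev L @ m # R)" using assms by (auto simp: cat_parts_def)
  have "e \<subseteq> V \<and> card e = 2" if "e \<in> caterpillar m L R S" for e
  proof -
    from that consider "e \<in> path_edges (rev L @ m # R)" | y where "y \<in> S" "e = {m, y}"
      unfolding caterpillar_def by auto
    then show ?thesis
    proof cases
      case 1
      then show ?thesis using path_edges_card[OF d] path_edges_subset[OF 1] assms by (auto simp: cat_parts_def)
    next
      case 2
      then have "m \<noteq> y" using assms by (auto simp: cat_parts_def)
      then show ?thesis using 2 assms by (auto simp: cat_parts_def)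
    qed
  qed
  then show ?thesis using assms by (auto simp: simple_graph_def cat_parts_def)
qed

lemma card_caterpillar:
  assumes "cat_parts V m L R S"
  shows "card (caterpillar m L R S) = card V - 1"
proof -
  have d: "distinct (rev L @ m # R)" and fS: "finite S" and dj: "S \<inter> set (m # L @ R) = {}"
    and V: "V = set (m # L @ R) \<union> S"
    using assms by (auto simp: cat_parts_def)
  have "path_edges (rev L @ m # R) \<inter> (\<lambda>y. {m, y}) ` S = {}"
    using dj path_edges_subset[of _ "rev L @ m # R"] by fastforce
  moreover have "card ((\<lambda>y. {m, y}) ` S) = card S"
    using dj by (intro card_image) (auto simp: inj_on_def doubleton_eq_iff)
  ultimately have "card (caterpillar m L R S) = length L + length R + card S"
    unfolding caterpillar_def using fS path_edges_card_eq[OF d]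
    by (subst card_Un_disjoint) (auto simp: finite_path_edges)
  moreover have "card V = card (set (m # L @ R)) + card S"
    unfolding V using fS dj by (intro card_Un_disjoint) auto
  moreover have "card (set (m # L @ R)) = length (m # L @ R)"
    using d by (intro distinct_card) auto
  ultimately show ?thesis by simp
qed

lemma theta_edges_props:
  assumes "cat_parts V m L R S" "theta_edges L R S X"
  shows "card X = 2" "X \<inter> caterpillar m L R S = {}" "finite X" "simple_graph V X" "\<And>w. {m, w} \<notin> X"
proof -
  have L: "hd L \<in> set L" "hd R \<in> set R" using assms by (auto simp: cat_parts_def)
  obtain a b y y' where X: "X = {{a, y}, {b, y'}}" "a \<in> {hd L, hd R}" "b \<in> {hd L, hd R}" "y \<in> S" "y' \<in> S"
    "a \<noteq> b \<or> y \<noteq> y'"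
  proof -
    have "set L \<inter> set R = {}" using assms(1) by (auto simp: cat_parts_def)
    then have "hd L \<noteq> hd R" using L by (metis disjoint_iff)
    from assms(2) consider c where "c \<in> S" "X = {{hd L, c}, {hd R, c}}"
      | a y y' where "a \<in> {hd L, hd R}" "y \<in> S" "y' \<in> S" "y \<noteq> y'" "X = {{a, y}, {a, y'}}"
      unfolding theta_edges_def theta5_edges_def theta3_edges_def
      by (fastforce simp: insert_commute)
    then show ?thesis
    proof cases
      case 1
      then show ?thesis using that[of "hd L" c "hd R" c] \<open>hd L \<noteq> hd R\<close> by simp
    next
      case 2
      then show ?thesis using that[of a y a y'] by simp
    qed
  qed
  have ab: "a \<in> set L \<union> set R" "b \<in> set L \<union> set R" using X(2,3) L by auto
  have sub: "set L \<union> set R \<subseteq> V - {m}" "S \<subseteq> V - {m}" "S \<inter> (set L \<union> set R) = {}" "finite V" "m \<notin> S" "m \<notin> set L \<union> set R"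
    using assms(1) by (auto simp: cat_parts_def)
  have n: "y \<noteq> m" "y' \<noteq> m" "a \<noteq> m" "b \<noteq> m" "y \<noteq> a" "y' \<noteq> b" "a \<noteq> y'" "b \<noteq> y"
    "{a, b, y, y'} \<subseteq> V"
    using X(4,5) ab sub by blast+
  have "{a, y} \<noteq> {b, y'}" using X(6) n by (simp add: doubleton_eq_iff)
  then show "card X = 2" using X(1) by simp
  show "finite X" using X(1) by simp
  show "simple_graph V X" using n sub(4) unfolding X(1) simple_graph_def by simp
  show mX: "\<And>w. {m, w} \<notin> X" using n unfolding X(1) by (simp add: doubleton_eq_iff)
  have "e \<notin> caterpillar m L R S" if e: "e \<in> X" for e
  proof -
    obtain z where z: "z \<in> S" "z \<in> e" using e X(1,4,5) by auto
    then have "e \<notin> path_edges (rev L @ m # R)"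
      using path_edges_subset[of e "rev L @ m # R"] sub(3,5) by auto
    moreover have "e \<notin> (\<lambda>y. {m, y}) ` S" using e mX by auto
    ultimately show ?thesis by (simp add: caterpillar_def)
  qed
  then show "X \<inter> caterpillar m L R S = {}" by auto
qed

declare near.simps(2) [simp del]

text \<open>
  The arms stay a shortest path: position along the path, with all of \<open>S\<close> at the position of \<open>m\<close>, is
  a potential that changes by at most one along every edge. Both arms are nonempty, so that a
  vertex of \<open>S\<close>, being adjacent to \<open>m\<close>, is not too far from any other vertex.
\<close>
lemma bicyclic_diam_caterpillar:
  assumes cp: "cat_parts V m L R S" and X: "theta_edges L R S X"
  shows "bicyclic_diam V (caterpillar m L R S \<union> X) (length L + length R)"
proof -
  let ?D = "caterpillar m L R S \<union> X"
  define P where "P = rev L @ m # R"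
  define p q where "p = length L" and "q = length R"
  have pq: "1 \<le> p" "1 \<le> q" using cp by (auto simp: p_def q_def cat_parts_def Suc_le_eq)
  have dP: "distinct P" and lP: "length P = p + q + 1"
    and V: "V = set P \<union> S" and dj: "S \<inter> set P = {}"
    using cp by (auto simp: cat_parts_def P_def p_def q_def)
  have Pm: "P ! p = m" by (simp add: P_def p_def nth_append)
  have PL: "P ! (p - 1) = hd L" using cp by (auto simp: P_def p_def nth_append rev_nth cat_parts_def hd_conv_nth)
  have PR: "P ! Suc p = hd R" using cp by (auto simp: P_def p_def nth_append cat_parts_def hd_conv_nth)
  have sg: "simple_graph V ?D"
    using simple_caterpillar[OF cp] theta_edges_props[OF cp X] by (auto simp: simple_graph_def)
  have "V \<noteq> {}" "finite V" using cp by (auto simp: cat_parts_def)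
  then have "card V \<ge> 1" by (simp add: Suc_le_eq card_gt_0_iff)
  then have cD: "card ?D = card V + 1"
    using theta_edges_props[OF cp X] card_caterpillar[OF cp] finite_simple_graph[OF simple_caterpillar[OF cp]]
    by (subst card_Un_disjoint) auto
  have sub: "path_edges P \<subseteq> ?D" by (auto simp: caterpillar_def P_def)
  have wP: "near ?D (p + q) (P ! i) (P ! j)" if ij: "i < length P" "j < length P" for i j
  proof (cases "i \<le> j")
    case True
    then show ?thesis using near_mono[OF near_nth_path[OF sub True]] ij lP by auto
  next
    case False
    then have "j \<le> i" by simp
    then show ?thesis using near_mono[OF near_sym[OF near_nth_path[OF sub \<open>j \<le> i\<close>]]] ij lP by auto
  qed
  have ym: "near ?D 1 y m" if "y \<in> S" for y
    using near_edge[of y m ?D] that by (auto simp: caterpillar_def insert_commute)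
  have wy: "near ?D (p + q) y (P ! j)" if "y \<in> S" and j: "j < length P" for y j
  proof -
    have "near ?D (max p q) m (P ! j)"
    proof (cases "p \<le> j")
      case True
      have a: "near ?D (j - p) m (P ! j)" using near_nth_path[OF sub True j] unfolding Pm .
      have "j - p \<le> max p q" using j lP by linarith
      then show ?thesis by (rule near_mono[OF a])
    next
      case False
      have "p < length P" using lP by simp
      then have a: "near ?D (p - j) (P ! j) m" using near_nth_path[OF sub, of j p] False unfolding Pm by simp
      have "p - j \<le> max p q" by linarith
      then show ?thesis by (rule near_mono[OF near_sym[OF a]])
    qed
    then have "near ?D (1 + max p q) y (P ! j)" by (rule near_trans[OF ym[OF \<open>y \<in> S\<close>]])
    then show ?thesis by (rule near_mono) (use pq in auto)
  qed
  have up: "near ?D (p + q) u v" if uv: "u \<in> V" "v \<in> V" for u v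
  proof -
    consider i j where "u = P ! i" "v = P ! j" "i < length P" "j < length P"
      | i where "u = P ! i" "i < length P" "v \<in> S" | j where "v = P ! j" "j < length P" "u \<in> S" | "u \<in> S" "v \<in> S"
      using uv V by (auto simp: in_set_conv_nth)
    then show ?thesis
    proof cases
      case 1
      then show ?thesis using wP by simp
    next
      case 2
      then show ?thesis using near_sym[OF wy] by simp
    next
      case 3
      then show ?thesis using wy by simp
    next
      case 4
      then have "near ?D (1 + 1) u v" using near_trans[OF ym[OF 4(1)] near_sym[OF ym[OF 4(2)]]] by simp
      then show ?thesis by (rule near_mono) (use pq in auto)
    qed
  qed
  \<comment> \<open>Position along the path; the vertices of \<open>S\<close> share the position of \<open>m\<close>.\<close>
  define h where "h u = (if u \<in> set P then int (the_inv_into {..<length P} (nth P) u) else int p)" for u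
  have inj: "inj_on (nth P) {..<length P}" using dP by (auto simp: inj_on_def nth_eq_iff_index_eq)
  have h: "h (P ! j) = int j" if "j < length P" for j
    using that the_inv_into_f_f[OF inj, of j] by (auto simp: h_def)
  have hS: "h y = int p" if "y \<in> S" for y using that dj by (auto simp: h_def)
  have hm: "h m = int p" "h (hd L) = int p - 1" "h (hd R) = int p + 1"
    using h[of p] h[of "p - 1"] h[of "Suc p"] Pm PL PR lP pq by auto
  have lip: "\<bar>h u - h w\<bar> \<le> 1" if e: "{u, w} \<in> ?D" for u w
  proof -
    consider "{u, w} \<in> path_edges P" | y where "{u, w} = {m, y}" "y \<in> S"
      | y where "y \<in> S" "{u, w} = {hd L, y} \<or> {u, w} = {hd R, y}"
      using e X unfolding caterpillar_def P_def theta_edges_def theta5_edges_def theta3_edges_def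
      by (auto simp: insert_commute)
    then show ?thesis
    proof cases
      case 1
      then obtain i where "{u, w} = {P ! i, P ! Suc i}" "Suc i < length P" by (auto simp: path_edges_nth)
      then show ?thesis using h[of i] h[of "Suc i"] by (auto simp: doubleton_eq_iff)
    qed (auto simp: doubleton_eq_iff hS hm)
  qed
  have low: "\<not> near ?D k (P ! 0) (P ! (p + q))" if "k < p + q" for k
    using near_Lipschitz[of ?D h k "P ! 0" "P ! (p + q)"] lip h[of 0] h[of "p + q"] lP that by auto
  have "P ! 0 \<in> V" "P ! (p + q) \<in> V" using V lP by auto
  then show ?thesis unfolding bicyclic_diam_def using sg cD up low unfolding p_def q_def by blast
qed

section \<open>Weights and row sums of these graphs\<close>

context vertex_weight
begin

lemma weight_Un: "finite A \<Longrightarrow> finite B \<Longrightarrow> A \<inter> B = {} \<Longrightarrow> weight (A \<union> B) = weight A + weight B"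
  unfolding weight_def by (rule sum.union_disjoint)

lemma weight_two: "e1 \<noteq> e2 \<Longrightarrow> weight {e1, e2} = edge_weight e1 + edge_weight e2"
  by (simp add: weight_def)

lemma weight_caterpillar:
  assumes "cat_parts V m L R S"
  shows "weight (caterpillar m L R S) = path_weight (m # L) + path_weight (m # R) + (\<Sum>y\<in>S. wt m y)"
proof -
  have d: "distinct (rev L @ m # R)" and fS: "finite S" and dj: "S \<inter> set (m # L @ R) = {}"
    using assms by (auto simp: cat_parts_def)
  have "path_edges (rev L @ m # R) \<inter> (\<lambda>y. {m, y}) ` S = {}"
    using dj path_edges_subset[of _ "rev L @ m # R"] by fastforce
  then have "weight (caterpillar m L R S) = weight (path_edges (rev L @ m # R)) + weight ((\<lambda>y. {m, y}) ` S)"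
    unfolding caterpillar_def using fS by (intro weight_Un) (auto simp: finite_path_edges)
  moreover have "weight ((\<lambda>y. {m, y}) ` S) = (\<Sum>y\<in>S. edge_weight {m, y})"
    unfolding weight_def using dj by (subst sum.reindex) (auto simp: inj_on_def doubleton_eq_iff)
  moreover have "\<dots> = (\<Sum>y\<in>S. wt m y)" using dj by (intro sum.cong refl edge_weight_pair) auto
  ultimately show ?thesis using weight_path[OF d] path_weight_split by simp
qed

text \<open>
  \<open>row_sum D u\<close> is the entry at \<open>u\<close> of \<open>A\<^sub>\<alpha> x\<close>, with the degree term spread over the
  neighbours of \<open>u\<close>. All its terms are positive when \<open>x\<close> is.
\<close>
definition row_term :: "'a \<Rightarrow> 'a \<Rightarrow> real" where "row_term u w = \<alpha> * x u + (1 - \<alpha>) * x w"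

definition row_sum :: "'a set set \<Rightarrow> 'a \<Rightarrow> real" where
  "row_sum D u = (\<Sum>w | {u, w} \<in> D. row_term u w)"

end

lemma finite_argmax:
  fixes f :: "'b \<Rightarrow> real"
  assumes "finite A" "A \<noteq> {}"
  obtains a where "a \<in> A" "\<And>b. b \<in> A \<Longrightarrow> f b \<le> f a"
proof -
  have "Max (f ` A) \<in> f ` A" using assms by (intro Max_in) auto
  then obtain a where "a \<in> A" "f a = Max (f ` A)" by auto
  then show ?thesis using that[of a] assms by auto
qed

lemma finite_neighbours: "finite D \<Longrightarrow> finite {w. {v, w} \<in> D}"
  by (rule finite_imageD[of "\<lambda>w. {v, w}", OF finite_subset[of _ D]])
    (auto simp: inj_on_def doubleton_eq_iff)

lemma theta_edges_star:
  assumes "cat_parts V m L R S" "theta_edges L R S X"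
  obtains c a b where "X = {{c, a}, {c, b}}" "c \<noteq> a" "c \<noteq> b" "a \<noteq> b" "{a, b, c} \<subseteq> V - {m}"
proof -
  have L: "hd L \<in> set L" "hd R \<in> set R" using assms by (auto simp: cat_parts_def)
  have sub: "set L \<union> set R \<subseteq> V - {m}" "S \<subseteq> V - {m}" "S \<inter> (set L \<union> set R) = {}" "set L \<inter> set R = {}"
    using assms(1) by (auto simp: cat_parts_def)
  have ne: "hd L \<noteq> hd R" using L sub(4) by (metis disjoint_iff)
  from assms(2) consider c where "c \<in> S" "X = {{c, hd L}, {c, hd R}}"
    | a y y' where "a \<in> {hd L, hd R}" "y \<in> S" "y' \<in> S" "y \<noteq> y'" "X = {{a, y}, {a, y'}}"
    unfolding theta_edges_def theta5_edges_def theta3_edges_def by fastforce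
  then show ?thesis
  proof cases
    case 1
    then show ?thesis using that[of c "hd L" "hd R"] L sub ne by blast
  next
    case 2
    then show ?thesis using that[of a y y'] L sub by blast
  qed
qed

locale positive_weight = vertex_weight \<alpha> x for \<alpha> and x :: "'a \<Rightarrow> real" +
  fixes V :: "'a set"
  assumes pos: "u \<in> V \<Longrightarrow> 0 < x u"
begin

lemma row_term_pos: "u \<in> V \<Longrightarrow> w \<in> V \<Longrightarrow> 0 < row_term u w"
  unfolding row_term_def using pos[of u] pos[of w] \<alpha>0 \<alpha>1 by (intro add_nonneg_pos) auto

lemma row_sum_Un:
  assumes "finite A" "finite B" "A \<inter> B = {}"
  shows "row_sum (A \<union> B) v = row_sum A v + row_sum B v"
proof -
  have "{w. {v, w} \<in> A \<union> B} = {w. {v, w} \<in> A} \<union> {w. {v, w} \<in> B}" by auto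
  then show ?thesis unfolding row_sum_def using assms
    by (simp add: finite_neighbours sum.union_disjoint[of "{w. {v, w} \<in> A}" "{w. {v, w} \<in> B}"] disjoint_iff)
qed

lemma row_sum_less:
  assumes "simple_graph V D" "{w. {v, w} \<in> D'} \<subset> {w. {v, w} \<in> D}"
  shows "row_sum D' v < row_sum D v"
proof -
  obtain w where w: "{v, w} \<in> D" "{v, w} \<notin> D'" using assms(2) by auto
  show ?thesis
    unfolding row_sum_def
  proof (rule sum_strict_mono2[where b = w])
    show "finite {w. {v, w} \<in> D}" using finite_simple_graph[OF assms(1)] by (rule finite_neighbours)
    show "{w. {v, w} \<in> D'} \<subseteq> {w. {v, w} \<in> D}" using assms(2) by auto
    show "w \<in> {w. {v, w} \<in> D} - {w. {v, w} \<in> D'}" using w by auto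
    show "0 < row_term v w" using simple_graph_pair[OF assms(1) w(1)] by (intro row_term_pos) auto
    show "0 \<le> row_term v y" if "y \<in> {w. {v, w} \<in> D}" for y
      using that simple_graph_pair[OF assms(1), of v y] row_term_pos[of v y] by auto
  qed
qed

text \<open>
  Equal row sums with positive terms force equal sets of non-isolated vertices. So the other
  two edges lie within the three vertices of the star; if they formed a star around a different
  centre, the centre \<open>c\<close> would lose a neighbour.
\<close>
lemma two_star_eq:
  assumes X: "X = {{c, a}, {c, b}}" and ne: "c \<noteq> a" "c \<noteq> b" "a \<noteq> b" and V: "{a, b, c} \<subseteq> V"
    and Y: "Y = {e1, e2}" "e1 \<noteq> e2" "simple_graph V Y"
    and rows: "\<And>v. v \<in> V \<Longrightarrow> row_sum X v = row_sum Y v"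
  shows "X = Y"
proof -
  have sX: "simple_graph V X" using ne V Y(3) unfolding X simple_graph_def by auto
  have emp: "(\<exists>w. {v, w} \<in> X) \<longleftrightarrow> (\<exists>w. {v, w} \<in> Y)" if "v \<in> V" for v
  proof -
    have "row_sum D v = 0 \<Longrightarrow> {v, w} \<notin> D" if "simple_graph V D" for D w
      using row_sum_less[OF that, of v "{}"] by (auto simp: row_sum_def)
    moreover have "(\<forall>w. {v, w} \<notin> D) \<Longrightarrow> row_sum D v = 0" for D by (simp add: row_sum_def)
    ultimately show ?thesis using rows[OF that] sX Y(3) by metis
  qed
  have sub: "e \<subseteq> {a, b, c}" if eY: "e \<in> Y" for e
  proof
    fix v assume "v \<in> e"
    obtain p q where pq: "e = {p, q}" "p \<in> V" "q \<in> V" using simple_graph_edge[OF Y(3) eY] by metis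
    then obtain w where "{v, w} \<in> Y" "v \<in> V" using \<open>v \<in> e\<close> eY by (auto simp: insert_commute)
    then obtain w' where "{v, w'} \<in> X" using emp by blast
    then show "v \<in> {a, b, c}" unfolding X by (auto simp: doubleton_eq_iff)
  qed
  have two: "e = {c, a} \<or> e = {c, b} \<or> e = {a, b}" if "e \<in> Y" for e
  proof -
    obtain p q where "e = {p, q}" "p \<noteq> q" using simple_graph_edge[OF Y(3) \<open>e \<in> Y\<close>] by metis
    then show ?thesis using sub[OF that] by auto
  qed
  show ?thesis
  proof (cases "{a, b} \<in> Y")
    case False
    then have "e1 = {c, a} \<or> e1 = {c, b}" "e2 = {c, a} \<or> e2 = {c, b}" using two Y(1) by auto
    then show ?thesis using Y(1,2) X by auto
  next
    case True
    then have "Y = {{a, b}, {c, a}} \<or> Y = {{a, b}, {c, b}}" using two[of e1] two[of e2] Y(1,2) by auto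
    then have "row_sum Y b < row_sum X b \<or> row_sum Y a < row_sum X a \<or> row_sum Y c < row_sum X c"
    proof
      assume "Y = {{a, b}, {c, a}}"
      then have "{w. {c, w} \<in> Y} = {a}" "{w. {c, w} \<in> X} = {a, b}" using ne X by (auto simp: doubleton_eq_iff)
      then show ?thesis using row_sum_less[OF sX, of c Y] ne by auto
    next
      assume "Y = {{a, b}, {c, b}}"
      then have "{w. {c, w} \<in> Y} = {b}" "{w. {c, w} \<in> X} = {a, b}" using ne X by (auto simp: doubleton_eq_iff)
      then show ?thesis using row_sum_less[OF sX, of c Y] ne by auto
    qed
    then show ?thesis using rows V by auto
  qed
qed

section \<open>Moving heavy vertices next to the centre\<close>

text \<open>
  Exchange a pendant vertex \<open>y\<close> with a lighter path neighbour of \<open>m\<close>. Both stay adjacent to \<open>m\<close>, so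
  only the edge that continues the path matters, and it gets heavier. If the path ends there, the
  edge set does not change at all.
\<close>
lemma swap_head:
  assumes cp: "cat_parts V m L R S" and y: "y \<in> S" "x (hd R) < x y"
  defines "R' \<equiv> y # tl R" and "S' \<equiv> insert (hd R) (S - {y})"
  shows "cat_parts V m L R' S'"
    and "weight (caterpillar m L R S) < weight (caterpillar m L R' S') \<or> caterpillar m L R' S' = caterpillar m L R S"
proof -
  obtain r R1 where R: "R = r # R1" using cp by (cases R) (auto simp: cat_parts_def)
  show cp': "cat_parts V m L R' S'"
    using cp y unfolding R'_def S'_def R cat_parts_def by auto
  have fS: "finite S" "r \<notin> S" using cp R by (auto simp: cat_parts_def)
  have sum: "(\<Sum>z\<in>S. wt m z) + wt m r = (\<Sum>z\<in>S'. wt m z) + wt m y"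
    unfolding S'_def R using fS y by (simp add: sum.remove[of S y])
  show "weight (caterpillar m L R S) < weight (caterpillar m L R' S') \<or> caterpillar m L R' S' = caterpillar m L R S"
  proof (cases R1)
    case Nil
    then have "caterpillar m L R' S' = caterpillar m L R S"
      unfolding caterpillar_def path_edges_split R'_def S'_def R using y by auto
    then show ?thesis ..
  next
    case (Cons t R2)
    have "0 < x t" using cp R Cons by (intro pos) (auto simp: cat_parts_def)
    then have "wt r t < wt y t" using y R by (intro wt_strict) auto
    then have "path_weight (m # R) + wt m y < path_weight (m # R') + wt m r"
      unfolding R'_def R Cons by simp
    then show ?thesis using sum weight_caterpillar[OF cp] weight_caterpillar[OF cp'] by linarith
  qed
qed

text \<open>
  Repeat the exchange until, apart from a given vertex \<open>c\<close>, no pendant vertex is heavier than a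
  path neighbour of \<open>m\<close>. Termination is replaced by choosing, among all results of such exchanges,
  one with the heaviest path neighbours.
\<close>
lemma saturate_heads:
  assumes cp: "cat_parts V m L R S" and c: "c \<in> S" "\<And>y. y \<in> S \<Longrightarrow> x y \<le> x c"
  obtains L' R' S' where "cat_parts V m L' R' S'" "c \<in> S'"
    "length L' + length R' = length L + length R" "tl L' = tl L" "tl R' = tl R"
    "S' \<union> {hd L', hd R'} = S \<union> {hd L, hd R}"
    "x (hd L) \<le> x (hd L')" "x (hd R) \<le> x (hd R')"
    "\<And>y. y \<in> S' - {c} \<Longrightarrow> x y \<le> x (hd L') \<and> x y \<le> x (hd R')"
    "weight (caterpillar m L R S) < weight (caterpillar m L' R' S') \<or> caterpillar m L' R' S' = caterpillar m L R S"
proof -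
  define ok where "ok a b S' \<longleftrightarrow> cat_parts V m (a # tl L) (b # tl R) S' \<and> c \<in> S' \<and>
     S' \<union> {a, b} = S \<union> {hd L, hd R} \<and> x (hd L) \<le> x a \<and> x (hd R) \<le> x b \<and>
     (weight (caterpillar m L R S) < weight (caterpillar m (a # tl L) (b # tl R) S') \<or>
      caterpillar m (a # tl L) (b # tl R) S' = caterpillar m L R S)" for a b S'
  define A where "A = {(a, b). \<exists>S'. ok a b S'}"
  have LR: "L \<noteq> []" "R \<noteq> []" "finite V" using cp by (auto simp: cat_parts_def)
  have "A \<subseteq> V \<times> V" unfolding A_def ok_def cat_parts_def by auto
  then have "finite A" using LR(3) by (meson finite_SigmaI finite_subset)
  moreover have "ok (hd L) (hd R) S" unfolding ok_def using cp c LR by auto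
  then have "A \<noteq> {}" unfolding A_def by auto
  ultimately obtain p where p: "p \<in> A" "\<And>q. q \<in> A \<Longrightarrow> x (fst q) + x (snd q) \<le> x (fst p) + x (snd p)"
    by (rule finite_argmax[of A "\<lambda>q. x (fst q) + x (snd q)"]) blast
  obtain a b S' where ab: "p = (a, b)" and ok: "ok a b S'" using p(1) by (auto simp: A_def)
  have cp': "cat_parts V m (a # tl L) (b # tl R) S'" using ok by (simp add: ok_def)
  have max: "x a' + x b' \<le> x a + x b" if "ok a' b' S''" for a' b' S''
    using p(2)[of "(a', b')"] that ab by (auto simp: A_def)
  have "x y \<le> x a \<and> x y \<le> x b" if y: "y \<in> S' - {c}" for y
  proof (rule ccontr)
    assume "\<not> (x y \<le> x a \<and> x y \<le> x b)"
    then consider "x b < x y" | "x a < x y" by linarith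
    then show False
    proof cases
      case 1
      have "ok a y (insert b (S' - {y}))"
        using swap_head[OF cp', of y] 1 y ok unfolding ok_def by auto
      then show False using max 1 by force
    next
      case 2
      have "ok y b (insert a (S' - {y}))"
        using swap_head[OF cat_parts_sym[OF cp'], of y] 2 y ok cat_parts_sym
        unfolding ok_def caterpillar_sym[of m "b # tl R"] by auto
      then show False using max 2 by force
    qed
  qed
  then show ?thesis using that[of "a # tl L" "b # tl R" S'] ok LR unfolding ok_def by auto
qed

text \<open>
  Let the path neighbours of \<open>m\<close> be at least as heavy as the rest of the arms. Then two edges that
  avoid \<open>m\<close> and do not lie inside the path can be traded for a star of one of the admissible
  kinds; if some pendant vertex is heaviest apart from \<open>m\<close>, they may even lie inside the path.
  After saturation let \<open>a\<close> and \<open>b\<close> be the heavier and the lighter path neighbour and \<open>c\<close> the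
  heaviest pendant vertex. Each of the two edges weighs at most \<open>ca\<close>, and at most \<open>cb\<close> unless it
  ends in \<open>a\<close>.
  So the star with centre \<open>c\<close> and leaves \<open>a\<close>, \<open>b\<close> is good enough unless both edges end in \<open>a\<close>. In
  that case it is still good enough if \<open>a\<close> is not heavier than \<open>c\<close>, and otherwise the two edges
  already form a star around the path neighbour \<open>a\<close>.

  The last conclusion separates a strict gain from the case in which the caterpillar is unchanged;
  it is what later turns equality of weights into equality of graphs.
\<close>
lemma theta_improvement:
  assumes cp: "cat_parts V m L R S"
    and rest: "\<And>v. v \<in> set (tl L) \<union> set (tl R) \<Longrightarrow> x v \<le> x (hd L) \<and> x v \<le> x (hd R)"
    and ne: "e1 \<noteq> e2"
    and e: "\<And>e. e \<in> {e1, e2} \<Longrightarrow> e \<subseteq> V - {m} \<and> card e = 2 \<and>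
              (e \<inter> S \<noteq> {} \<or> (\<exists>c\<in>S. \<forall>v\<in>V - {m}. x v \<le> x c))"
  obtains L' R' S' X where "cat_parts V m L' R' S'" "theta_edges L' R' S' X"
    "length L' + length R' = length L + length R"
    "S' \<union> {hd L', hd R'} = S \<union> {hd L, hd R}"
    "weight (caterpillar m L R S) + edge_weight e1 + edge_weight e2 \<le> weight (caterpillar m L' R' S' \<union> X)"
    "weight (caterpillar m L R S) + edge_weight e1 + edge_weight e2 < weight (caterpillar m L' R' S' \<union> X) \<or>
     caterpillar m L' R' S' = caterpillar m L R S"
proof (cases "\<exists>a\<in>{hd L, hd R}. \<exists>y\<in>S. \<exists>y'\<in>S. y \<noteq> y' \<and> e1 = {a, y} \<and> e2 = {a, y'}")
  case True
  have X: "theta_edges L R S {e1, e2}" using True unfolding theta_edges_def theta3_edges_def by auto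
  have "weight (caterpillar m L R S \<union> {e1, e2}) = weight (caterpillar m L R S) + edge_weight e1 + edge_weight e2"
    using theta_edges_props[OF cp X] weight_two[OF ne] finite_simple_graph[OF simple_caterpillar[OF cp]]
    by (subst weight_Un) auto
  then show ?thesis using that[OF cp X] by auto
next
  case False
  have "finite S" using cp by (auto simp: cat_parts_def)
  moreover have "S \<noteq> {}" using e[of e1] by auto
  ultimately obtain c where c: "c \<in> S" "\<And>y. y \<in> S \<Longrightarrow> x y \<le> x c"
    by (rule finite_argmax[of S x]) blast
  obtain L' R' S' where cp': "cat_parts V m L' R' S'" and cS': "c \<in> S'"
    and len: "length L' + length R' = length L + length R" and tls: "tl L' = tl L" "tl R' = tl R"
    and N: "S' \<union> {hd L', hd R'} = S \<union> {hd L, hd R}"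
    and hds: "x (hd L) \<le> x (hd L')" "x (hd R) \<le> x (hd R')"
    and sat: "\<And>y. y \<in> S' - {c} \<Longrightarrow> x y \<le> x (hd L') \<and> x y \<le> x (hd R')"
    and w: "weight (caterpillar m L R S) < weight (caterpillar m L' R' S') \<or> caterpillar m L' R' S' = caterpillar m L R S"
    using saturate_heads[OF cp c] by metis
  define X where "X = {{c, hd L'}, {c, hd R'}}"
  have X: "theta_edges L' R' S' X" unfolding theta_edges_def theta5_edges_def X_def using cS' by auto
  have V: "V = insert m (S' \<union> set L' \<union> set R')" and c_out: "c \<notin> set L' \<union> set R'" "c \<noteq> m"
    and hd: "hd L' \<in> set L'" "hd R' \<in> set R'" and LRd: "set L' \<inter> set R' = {}"
    using cp' cS' by (auto simp: cat_parts_def)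
  have setL: "set L' = insert (hd L') (set (tl L))" "set R' = insert (hd R') (set (tl R))"
    using cp' tls by (auto simp: cat_parts_def) (metis list.collapse set_ConsD list.set_intros)+
  have hne: "hd L' \<noteq> hd R'" using hd LRd by (metis disjoint_iff)
  obtain a b where ab: "{a, b} = {hd L', hd R'}" "x b \<le> x a" "a \<noteq> b"
  proof (cases "x (hd R') \<le> x (hd L')")
    case True
    then show ?thesis using that[of "hd L'" "hd R'"] hne by simp
  next
    case False
    then show ?thesis using that[of "hd R'" "hd L'"] hne by (simp add: insert_commute)
  qed
  have tl_le: "x v \<le> x a \<and> x v \<le> x b" if "v \<in> set (tl L) \<union> set (tl R)" for v
    using rest[OF that] hds ab(1) by (fastforce simp: doubleton_eq_iff)
  have S_le: "x v \<le> x a \<and> x v \<le> x b" if "v \<in> S' - {c}" for v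
    using sat[OF that] ab(1) by (fastforce simp: doubleton_eq_iff)
  have b_le: "x v \<le> x b" if "v \<in> V - {m, c, a}" for v
    using that V setL ab(1) tl_le S_le by (auto simp: doubleton_eq_iff)
  have a_le: "x v \<le> x a" if "v \<in> V - {m, c}" for v
    using that b_le[of v] ab(2) by force
  \<comment> \<open>The end that is bounded by \<open>c\<close> may be \<open>c\<close> itself; the other end never is.\<close>
  have repr: "\<exists>u v. e = {u, v} \<and> u \<in> V - {m} \<and> v \<in> V - {m, c} \<and> u \<noteq> v \<and> x u \<le> x c \<and>
      (u \<in> S \<or> (\<forall>v\<in>V - {m}. x v \<le> x c) \<or> v \<in> S)" if ein: "e \<in> {e1, e2}" for e
  proof -
    obtain p q where pq: "e = {p, q}" "p \<noteq> q" using e[OF ein] by (auto simp: card_2_iff)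
    have pqV: "p \<in> V - {m}" "q \<in> V - {m}" using e[OF ein] pq by auto
    have max: "x v \<le> x c" if "\<exists>c\<in>S. \<forall>v\<in>V - {m}. x v \<le> x c" "v \<in> V - {m}" for v
      using that c(2) by (meson order_trans)
    from e[OF ein] consider "p \<in> S" | "q \<in> S" | "\<exists>c\<in>S. \<forall>v\<in>V - {m}. x v \<le> x c" using pq by auto
    then show ?thesis
    proof cases
      case 1
      then show ?thesis using pq pqV c by (cases "q = c") (auto simp: insert_commute)
    next
      case 2
      then show ?thesis using pq pqV c by (cases "p = c") (auto simp: insert_commute)
    next
      case 3
      then show ?thesis using pq pqV max by (cases "q = c") (auto simp: insert_commute)
    qed
  qed
  obtain u1 v1 where 1: "e1 = {u1, v1}" "u1 \<in> V - {m}" "v1 \<in> V - {m, c}" "u1 \<noteq> v1" "x u1 \<le> x c"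
    "u1 \<in> S \<or> (\<forall>v\<in>V - {m}. x v \<le> x c) \<or> v1 \<in> S" using repr[of e1] by auto
  obtain u2 v2 where 2: "e2 = {u2, v2}" "u2 \<in> V - {m}" "v2 \<in> V - {m, c}" "u2 \<noteq> v2" "x u2 \<le> x c"
    "u2 \<in> S \<or> (\<forall>v\<in>V - {m}. x v \<le> x c) \<or> v2 \<in> S" using repr[of e2] by auto
  have E: "edge_weight e1 = wt u1 v1" "edge_weight e2 = wt u2 v2" using 1 2 edge_weight_pair by auto
  have ea: "edge_weight e1 \<le> wt c a" "edge_weight e2 \<le> wt c a"
    unfolding E using 1 2 a_le by (auto intro!: wt_mono)
  have eb: "v1 \<noteq> a \<Longrightarrow> edge_weight e1 \<le> wt c b" "v2 \<noteq> a \<Longrightarrow> edge_weight e2 \<le> wt c b"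
    unfolding E using 1 2 b_le by (auto intro!: wt_mono)
  have key: "edge_weight e1 + edge_weight e2 \<le> wt c a + wt c b"
  proof (cases "v1 = a \<and> v2 = a")
    case False
    then show ?thesis using ea eb by force
  next
    case True
    then have u12: "u1 \<noteq> u2" using 1 2 ne by auto
    show ?thesis
    proof (cases "x a \<le> x c")
      case True
      have "wt u a \<le> wt c b" if "u \<in> V - {m, c, a}" for u
        using wt_mono[of u b a c] b_le[OF that] True by (simp add: wt_commute)
      moreover have "u1 \<in> V - {m, c, a} \<or> u2 \<in> V - {m, c, a}" using u12 1 2 \<open>v1 = a \<and> v2 = a\<close> by auto
      ultimately show ?thesis using ea E \<open>v1 = a \<and> v2 = a\<close> by fastforce
    next
      case False
      then have "a \<notin> S" using c(2) by auto
      moreover have "a \<in> S \<union> {hd L, hd R}" using N ab(1) by auto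
      moreover have "a \<in> V - {m}" using 1 \<open>v1 = a \<and> v2 = a\<close> by auto
      ultimately have "u1 \<in> S" "u2 \<in> S" "a \<in> {hd L, hd R}" using 1(6) 2(6) False \<open>v1 = a \<and> v2 = a\<close> by auto
      then show ?thesis using \<open>\<not> (\<exists>a\<in>{hd L, hd R}. _ a)\<close> 1(1) 2(1) u12 \<open>v1 = a \<and> v2 = a\<close>
        by (auto simp: insert_commute)
    qed
  qed
  have cab: "c \<noteq> hd L'" "c \<noteq> hd R'" using c_out hd by auto
  have "weight X = wt c (hd L') + wt c (hd R')"
    unfolding X_def using cab hne by (subst weight_two) (auto simp: doubleton_eq_iff edge_weight_pair)
  also have "\<dots> = wt c a + wt c b" using ab(1) by (auto simp: doubleton_eq_iff)
  finally have "weight (caterpillar m L' R' S' \<union> X) = weight (caterpillar m L' R' S') + (wt c a + wt c b)"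
    using theta_edges_props[OF cp' X] finite_simple_graph[OF simple_caterpillar[OF cp']]
    by (subst weight_Un) auto
  then show ?thesis using that[OF cp' X len N] w key by fastforce
qed

end

section \<open>Diametral paths and spanning trees containing them\<close>

text \<open>
  A potential that equals the position along \<open>P\<close> certifies that \<open>P\<close> is a shortest path. Unlike
  distances, such a certificate is easily transferred when a vertex of the path is replaced.
\<close>
definition geodesic :: "'a set set \<Rightarrow> 'a list \<Rightarrow> bool" where
  "geodesic D P \<longleftrightarrow> path_edges P \<subseteq> D \<and>
     (\<exists>h :: 'a \<Rightarrow> int. (\<forall>u w. {u, w} \<in> D \<longrightarrow> \<bar>h u - h w\<bar> \<le> 1) \<and> (\<forall>j<length P. h (P ! j) = int j))"

lemma geodesic_distinct: "geodesic D P \<Longrightarrow> distinct P"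
  unfolding geodesic_def distinct_conv_nth by (metis of_nat_eq_iff)

lemma geodesic_chord:
  assumes "geodesic D P" "i < length P" "j < length P" "{P ! i, P ! j} \<in> D"
  shows "\<bar>int i - int j\<bar> \<le> 1"
  using assms unfolding geodesic_def by metis

lemma near_path:
  "near D k u v \<Longrightarrow> \<exists>P. P \<noteq> [] \<and> path_edges P \<subseteq> D \<and> length P \<le> k + 1 \<and> hd P = u \<and> last P = v"
proof (induction k arbitrary: u)
  case 0
  then show ?case by (intro exI[of _ "[u]"]) auto
next
  case (Suc k)
  then consider "near D k u v" | w where "{u, w} \<in> D" "near D k w v" by (auto simp: near.simps)
  then show ?case
  proof cases
    case 1
    then show ?thesis using Suc.IH by fastforce
  next
    case 2
    then obtain P where "P \<noteq> [] \<and> path_edges P \<subseteq> D \<and> length P \<le> k + 1 \<and> hd P = w \<and> last P = v"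
      using Suc.IH by blast
    then show ?thesis using 2 by (intro exI[of _ "u # P"]) (auto simp: path_edges_Cons)
  qed
qed

lemma geodesic_exists:
  assumes "bicyclic_diam V D d"
  obtains P where "geodesic D P" "length P = d + 1" "set P \<subseteq> V"
proof -
  have sg: "simple_graph V D" and up: "\<And>u v. u \<in> V \<Longrightarrow> v \<in> V \<Longrightarrow> near D d u v"
    using assms by (auto simp: bicyclic_diam_def)
  obtain u v where uv: "u \<in> V" "v \<in> V" "\<And>k. k < d \<Longrightarrow> \<not> near D k u v"
    using assms by (auto simp: bicyclic_diam_def)
  obtain P where P: "P \<noteq> []" "path_edges P \<subseteq> D" "length P \<le> d + 1" "hd P = u" "last P = v"
    using near_path[OF up[OF uv(1,2)]] by blast
  have ends: "P ! 0 = u" "P ! (length P - 1) = v" using P by (auto simp: hd_conv_nth last_conv_nth)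
  have "near D (length P - 1) u v" using near_nth_path[OF P(2), of 0 "length P - 1"] P ends by simp
  then have "d \<le> length P - 1" using uv(3) by (meson not_less)
  then have len: "length P = d + 1" using P(1,3) by (cases P) auto
  define h where "h w = int (LEAST k. near D k u w)" for w
  have near_h: "near D (LEAST k. near D k u w) u w" if "w \<in> V" for w
    using up[OF uv(1) that] by (rule LeastI)
  have h_le: "h w \<le> int k" if "near D k u w" for w k
    using Least_le[of "\<lambda>k. near D k u w" k] that by (simp add: h_def)
  have step: "h b \<le> h a + 1" if "{a, b} \<in> D" for a b
  proof -
    have "a \<in> V" using simple_graph_pair[OF sg that] by simp
    then show ?thesis using h_le[OF near_trans[OF near_h near_edge[OF that]]] by (simp add: h_def)
  qed
  have lip: "\<bar>h a - h b\<bar> \<le> 1" if "{a, b} \<in> D" for a b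
    using step[OF that] step[of b a] that by (simp add: insert_commute abs_le_iff)
  have hP: "h (P ! j) = int j" if j: "j < length P" for j
  proof (rule antisym)
    show "h (P ! j) \<le> int j" using h_le[of j "P ! j"] near_nth_path[OF P(2), of 0 j] j ends by simp
    show "int j \<le> h (P ! j)"
    proof (rule ccontr)
      assume "\<not> int j \<le> h (P ! j)"
      then have *: "(LEAST k. near D k u (P ! j)) < j" by (simp add: h_def)
      have "near D j u (P ! j)" using near_nth_path[OF P(2), of 0 j] j ends by simp
      then have "near D (LEAST k. near D k u (P ! j)) u (P ! j)" by (rule LeastI)
      moreover have "near D (length P - 1 - j) (P ! j) v"
        using near_nth_path[OF P(2), of j "length P - 1"] j ends by simp
      ultimately have "near D ((LEAST k. near D k u (P ! j)) + (length P - 1 - j)) u v" by (rule near_trans)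
      then show False using uv(3) * len j by simp
    qed
  qed
  have "set P \<subseteq> V"
  proof
    fix w assume "w \<in> set P"
    then obtain j where j: "j < length P" "w = P ! j" by (auto simp: in_set_conv_nth)
    show "w \<in> V"
    proof (cases j)
      case 0
      then show ?thesis using j ends uv by simp
    next
      case (Suc k)
      then have "{P ! k, P ! j} \<in> D" using P(2) j by (auto simp: path_edges_nth)
      then show ?thesis using simple_graph_pair[OF sg] j by blast
    qed
  qed
  then show ?thesis using that[of P] len P(2) lip hP by (auto simp: geodesic_def)
qed

text \<open>
  The graph is the path \<open>P\<close>, one edge from each \<open>u \<in> U\<close> to its parent, and two further edges. Here
  \<open>P ! i\<close> is a vertex of \<open>P\<close> nearest to \<open>m\<close>, and the path and the parent edges together form a spanning
  tree. It contains all edges at \<open>m\<close> except, when \<open>m\<close> is off the path, those to other vertices of \<open>P\<close>.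
\<close>
definition spanning_split ::
    "'a set \<Rightarrow> 'a set set \<Rightarrow> 'a list \<Rightarrow> 'a \<Rightarrow> nat \<Rightarrow> ('a \<Rightarrow> 'a) \<Rightarrow> 'a set \<Rightarrow> 'a set \<Rightarrow> 'a set \<Rightarrow> bool" where
  "spanning_split V D P m i par U e1 e2 \<longleftrightarrow>
     U = V - set P \<union> {P ! i} - {m} \<and> i < length P \<and> (m \<in> set P \<longrightarrow> P ! i = m) \<and>
     D = path_edges P \<union> (\<lambda>u. {u, par u}) ` U \<union> {e1, e2} \<and> e1 \<noteq> e2 \<and>
     {e1, e2} \<inter> (path_edges P \<union> (\<lambda>u. {u, par u}) ` U) = {} \<and>
     path_edges P \<inter> (\<lambda>u. {u, par u}) ` U = {} \<and> inj_on (\<lambda>u. {u, par u}) U \<and>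
     (\<forall>u\<in>U. {m, u} \<in> D \<longrightarrow> par u = m) \<and>
     (\<forall>j<length P. {m, P ! j} \<in> D \<longrightarrow> m \<notin> set P \<longrightarrow> {m, P ! i} \<in> D) \<and>
     (\<forall>e\<in>{e1, e2}. \<not> e \<subseteq> set P) \<and>
     (\<forall>e\<in>{e1, e2}. m \<in> e \<longrightarrow> m \<notin> set P \<and> (\<exists>j<length P. j \<noteq> i \<and> e = {m, P ! j}))"

lemma spanning_splitD:
  assumes "spanning_split V D P m i par U e1 e2"
  shows "U = V - set P \<union> {P ! i} - {m}" "i < length P" "m \<in> set P \<Longrightarrow> P ! i = m"
    "D = path_edges P \<union> (\<lambda>u. {u, par u}) ` U \<union> {e1, e2}" "e1 \<noteq> e2"
    "{e1, e2} \<inter> (path_edges P \<union> (\<lambda>u. {u, par u}) ` U) = {}"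
    "path_edges P \<inter> (\<lambda>u. {u, par u}) ` U = {}" "inj_on (\<lambda>u. {u, par u}) U"
    "\<And>u. u \<in> U \<Longrightarrow> {m, u} \<in> D \<Longrightarrow> par u = m"
    "\<And>j. j < length P \<Longrightarrow> {m, P ! j} \<in> D \<Longrightarrow> m \<notin> set P \<Longrightarrow> {m, P ! i} \<in> D"
    "\<And>e. e \<in> {e1, e2} \<Longrightarrow> \<not> e \<subseteq> set P"
    "\<And>e. e \<in> {e1, e2} \<Longrightarrow> m \<in> e \<Longrightarrow> m \<notin> set P \<and> (\<exists>j<length P. j \<noteq> i \<and> e = {m, P ! j})"
proof -
  note c = assms[unfolded spanning_split_def]
  show "U = V - set P \<union> {P ! i} - {m}" "i < length P"
    "D = path_edges P \<union> (\<lambda>u. {u, par u}) ` U \<union> {e1, e2}" "e1 \<noteq> e2"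
    "{e1, e2} \<inter> (path_edges P \<union> (\<lambda>u. {u, par u}) ` U) = {}"
    "path_edges P \<inter> (\<lambda>u. {u, par u}) ` U = {}" "inj_on (\<lambda>u. {u, par u}) U"
    by (insert c, (elim conjE, assumption)+)
  have q: "m \<in> set P \<longrightarrow> P ! i = m" "\<forall>u\<in>U. {m, u} \<in> D \<longrightarrow> par u = m"
    "\<forall>j<length P. {m, P ! j} \<in> D \<longrightarrow> m \<notin> set P \<longrightarrow> {m, P ! i} \<in> D"
    "\<forall>e\<in>{e1, e2}. \<not> e \<subseteq> set P"
    "\<forall>e\<in>{e1, e2}. m \<in> e \<longrightarrow> m \<notin> set P \<and> (\<exists>j<length P. j \<noteq> i \<and> e = {m, P ! j})"
    by (insert c, (elim conjE, assumption)+)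
  show "m \<in> set P \<Longrightarrow> P ! i = m" using q(1) by (rule mp)
  show "\<And>u. u \<in> U \<Longrightarrow> {m, u} \<in> D \<Longrightarrow> par u = m" using q(2) by blast
  show "\<And>j. j < length P \<Longrightarrow> {m, P ! j} \<in> D \<Longrightarrow> m \<notin> set P \<Longrightarrow> {m, P ! i} \<in> D" using q(3) by blast
  show "\<And>e. e \<in> {e1, e2} \<Longrightarrow> \<not> e \<subseteq> set P" using q(4) by (rule bspec)
  show "\<And>e. e \<in> {e1, e2} \<Longrightarrow> m \<in> e \<Longrightarrow> m \<notin> set P \<and> (\<exists>j<length P. j \<noteq> i \<and> e = {m, P ! j})"
    using q(5) by blast
qed

text \<open>
  Take as parent of \<open>u\<close> a neighbour closer to \<open>m\<close>. Then no edge is used twice: an edge that is the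
  parent edge of both its ends would decrease the distance to \<open>m\<close> both ways, and an edge of \<open>P\<close> is
  not a parent edge because \<open>P ! i\<close> is nearest to \<open>m\<close>. Counting leaves two edges.
\<close>
lemma spanning_split_exists:
  assumes bic: "bicyclic_diam V D d" and geo: "geodesic D P" and len: "length P = d + 1"
    and PV: "set P \<subseteq> V" and m: "m \<in> V"
  obtains i par U e1 e2 where "spanning_split V D P m i par U e1 e2"
proof -
  have sg: "simple_graph V D" and up: "\<And>u v. u \<in> V \<Longrightarrow> v \<in> V \<Longrightarrow> near D d u v"
    and cD: "card D = card V + 1" and fV: "finite V"
    using bic by (auto simp: bicyclic_diam_def simple_graph_def)
  have dP: "distinct P" using geo by (rule geodesic_distinct)
  have PD: "path_edges P \<subseteq> D" using geo by (simp add: geodesic_def)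
  define \<delta> where "\<delta> u = (LEAST k. near D k m u)" for u
  have near_\<delta>: "near D (\<delta> u) m u" if "u \<in> V" for u
    unfolding \<delta>_def using up[OF m that] by (rule LeastI)
  have \<delta>_le: "near D k m u \<Longrightarrow> \<delta> u \<le> k" for k u
    unfolding \<delta>_def by (rule Least_le)
  have \<delta>0: "\<delta> u = 0 \<longleftrightarrow> u = m" if "u \<in> V" for u
    using near_\<delta>[OF that] \<delta>_le[of 0 u] by auto
  have parent: "\<exists>w. {u, w} \<in> D \<and> \<delta> w < \<delta> u" if u: "u \<in> V" "u \<noteq> m" for u
  proof -
    obtain k where k: "\<delta> u = Suc k" using \<delta>0[OF u(1)] u(2) by (cases "\<delta> u") auto
    have "near D (Suc k) u m" using near_sym[OF near_\<delta>[OF u(1)]] k by simp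
    moreover have "\<not> near D k u m" using \<delta>_le[OF near_sym] k by fastforce
    ultimately obtain w where w: "{u, w} \<in> D" "near D k w m" by (auto simp: near.simps)
    then show ?thesis using \<delta>_le[OF near_sym[OF w(2)]] k by auto
  qed
  define par where "par u = (SOME w. {u, w} \<in> D \<and> \<delta> w < \<delta> u)" for u
  have par: "{u, par u} \<in> D" "\<delta> (par u) < \<delta> u" if "u \<in> V" "u \<noteq> m" for u
    using someI_ex[OF parent[OF that]] unfolding par_def by auto
  have "\<exists>i\<in>{..<length P}. \<forall>j\<in>{..<length P}. real (\<delta> (P ! i)) \<le> real (\<delta> (P ! j))"
    using finite_argmax[of "{..<length P}" "\<lambda>j. - real (\<delta> (P ! j))"] len by (metis finite_lessThan lessThan_empty_iff neg_le_iff_le add_is_0 one_neq_zero)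
  then obtain i where i: "i < length P" and imin: "\<And>j. j < length P \<Longrightarrow> \<delta> (P ! i) \<le> \<delta> (P ! j)" by auto
  define U where "U = V - set P \<union> {P ! i} - {m}"
  have UV: "u \<in> V" "u \<noteq> m" if "u \<in> U" for u using that i PV by (auto simp: U_def)
  have im: "P ! i = m" if mP: "m \<in> set P"
  proof -
    obtain j where "j < length P" "P ! j = m" using mP by (auto simp: in_set_conv_nth)
    then have "\<delta> (P ! i) = 0" using imin[of j] \<delta>0[OF m] by simp
    moreover have "P ! i \<in> V" using i PV by auto
    ultimately show ?thesis using \<delta>0 by blast
  qed
  have parm: "par u = m" if "u \<in> U" "{m, u} \<in> D" for u
  proof -
    have "\<delta> u \<le> Suc 0" using \<delta>_le[OF near_edge[OF that(2)]] .
    then have "\<delta> (par u) = 0" using par(2)[OF UV[OF that(1)]] by simp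
    moreover have "par u \<in> V" using par(1)[OF UV[OF that(1)]] simple_graph_pair[OF sg] by blast
    ultimately show ?thesis using \<delta>0 by simp
  qed
  let ?T = "(\<lambda>u. {u, par u}) ` U"
  have inj: "inj_on (\<lambda>u. {u, par u}) U"
  proof (rule inj_onI)
    fix u w assume "u \<in> U" "w \<in> U" "{u, par u} = {w, par w}"
    then show "u = w" using par(2)[OF UV, of u] par(2)[OF UV, of w] by (auto simp: doubleton_eq_iff)
  qed
  have dj: "path_edges P \<inter> ?T = {}"
  proof -
    have False if "u \<in> U" "{u, par u} \<in> path_edges P" for u
    proof -
      have "u \<in> set P" "par u \<in> set P" using path_edges_subset[OF that(2)] by auto
      then have "u = P ! i" "\<exists>j<length P. par u = P ! j" using that(1) by (auto simp: U_def in_set_conv_nth)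
      then show False using par(2)[OF UV[OF that(1)]] imin by fastforce
    qed
    then show ?thesis by auto
  qed
  have TD: "?T \<subseteq> D" using par(1)[OF UV] by auto
  have "card U = card V - (d + 1)"
  proof -
    have cP: "card (V - set P) = card V - (d + 1)" using PV dP len fV by (simp add: card_Diff_subset distinct_card)
    show ?thesis
    proof (cases "m \<in> set P")
      case True
      then have "U = V - set P" using im by (auto simp: U_def)
      then show ?thesis using cP by simp
    next
      case False
      then have "U = insert (P ! i) (V - set P - {m})" "P ! i \<notin> V - set P - {m}" using i m by (auto simp: U_def)
      then have "card U = Suc (card (V - set P - {m}))" using fV by simp
      also have "\<dots> = card (V - set P)" using m False fV by (intro card_Suc_Diff1) auto
      finally show ?thesis using cP by simp
    qed
  qed
  moreover have "card V \<ge> d + 1" using card_mono[OF fV PV] dP len by (simp add: distinct_card)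
  moreover have "card (path_edges P \<union> ?T) = card (path_edges P) + card ?T"
    using dj fV by (intro card_Un_disjoint) (auto simp: finite_path_edges U_def)
  moreover have "card ?T = card U" using inj by (rule card_image)
  ultimately have "card (path_edges P \<union> ?T) = card V - 1" using path_edges_card_eq[OF dP] len by simp
  moreover have "card (D - (path_edges P \<union> ?T)) = card D - card (path_edges P \<union> ?T)"
    using PD TD fV by (intro card_Diff_subset) (auto simp: finite_path_edges U_def)
  ultimately have "card (D - (path_edges P \<union> ?T)) = 2" using cD \<open>card V \<ge> d + 1\<close> by simp
  then obtain e1 e2 where e: "D - (path_edges P \<union> ?T) = {e1, e2}" "e1 \<noteq> e2" by (auto simp: card_2_iff)
  have eP: "\<not> f \<subseteq> set P" if "f \<in> {e1, e2}" for f
  proof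
    assume "f \<subseteq> set P"
    have fD: "f \<in> D" "f \<notin> path_edges P" using that e(1) by auto
    obtain a b where "f = {a, b}" "a \<noteq> b" using simple_graph_edge[OF sg fD(1)] by metis
    then obtain j k where jk: "f = {P ! j, P ! k}" "j < length P" "k < length P" "j \<noteq> k"
      using \<open>f \<subseteq> set P\<close> by (auto simp: in_set_conv_nth)
    then have "\<bar>int j - int k\<bar> \<le> 1" using geodesic_chord[OF geo] fD by auto
    then have "k = Suc j \<or> j = Suc k" using jk(4) by linarith
    then have "f \<in> path_edges P" using jk by (auto simp: path_edges_nth insert_commute)
    then show False using fD by simp
  qed
  have em: "m \<notin> set P \<and> (\<exists>j<length P. j \<noteq> i \<and> f = {m, P ! j})" if fe: "f \<in> {e1, e2}" and mf: "m \<in> f" for f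
  proof -
    have fD: "f \<in> D" "f \<notin> ?T" using fe e(1) by auto
    obtain w where w: "f = {m, w}" "w \<noteq> m" "w \<in> V" using simple_graph_edge[OF sg fD(1)] mf by (metis doubleton_eq_iff insertE singletonD)
    have "w \<notin> U"
    proof
      assume "w \<in> U"
      then have "f = {w, par w}" using parm[of w] w fD by auto
      then show False using fD(2) \<open>w \<in> U\<close> by auto
    qed
    then have "w \<in> set P" "w \<noteq> P ! i" using w by (auto simp: U_def)
    then show ?thesis using w eP[OF fe] by (auto simp: in_set_conv_nth)
  qed
  have close: "{m, P ! i} \<in> D" if "j < length P" "{m, P ! j} \<in> D" "m \<notin> set P" for j
  proof -
    have "\<delta> (P ! i) \<le> Suc 0" using imin[OF that(1)] \<delta>_le[OF near_edge[OF that(2)]] by simp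
    moreover have "P ! i \<noteq> m" "P ! i \<in> V" using that(3) i PV by auto
    moreover from this have "\<delta> (par (P ! i)) < \<delta> (P ! i)" "{P ! i, par (P ! i)} \<in> D" using par by auto
    ultimately have "\<delta> (par (P ! i)) = 0" "par (P ! i) \<in> V" using simple_graph_pair[OF sg] by auto
    then have "par (P ! i) = m" using \<delta>0 by simp
    then show ?thesis using \<open>{P ! i, par (P ! i)} \<in> D\<close> by (simp add: insert_commute)
  qed
  have D_eq: "D = path_edges P \<union> ?T \<union> {e1, e2}" unfolding e(1)[symmetric] using PD TD by blast
  have e_new: "{e1, e2} \<inter> (path_edges P \<union> ?T) = {}" unfolding e(1)[symmetric] by blast
  have "spanning_split V D P m i par U e1 e2"
    unfolding spanning_split_def
  proof (intro conjI)
    show "m \<in> set P \<longrightarrow> P ! i = m" using im by blast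
    show "\<forall>u\<in>U. {m, u} \<in> D \<longrightarrow> par u = m" using parm by blast
    show "\<forall>j<length P. {m, P ! j} \<in> D \<longrightarrow> m \<notin> set P \<longrightarrow> {m, P ! i} \<in> D" using close by blast
    show "\<forall>e\<in>{e1, e2}. \<not> e \<subseteq> set P" using eP by blast
    show "\<forall>e\<in>{e1, e2}. m \<in> e \<longrightarrow> m \<notin> set P \<and> (\<exists>j<length P. j \<noteq> i \<and> e = {m, P ! j})" using em by blast
    show "U = V - set P \<union> {P ! i} - {m}" by (rule U_def)
    show "i < length P" by (rule i)
    show "D = path_edges P \<union> ?T \<union> {e1, e2}" by (rule D_eq)
    show "e1 \<noteq> e2" by (rule e(2))
    show "{e1, e2} \<inter> (path_edges P \<union> ?T) = {}" by (rule e_new)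
    show "path_edges P \<inter> ?T = {}" by (rule dj)
    show "inj_on (\<lambda>u. {u, par u}) U" by (rule inj)
  qed
  then show ?thesis by (rule that)
qed

section \<open>A maximal graph is a caterpillar with two further edges\<close>

lemma sorted_enumeration:
  fixes x :: "'a \<Rightarrow> real"
  assumes "finite A"
  obtains qs where "distinct qs" "set qs = A" "sorted_wrt (\<lambda>u v. x v \<le> x u) qs"
proof -
  obtain xs where xs: "set xs = A" "distinct xs" using finite_distinct_list[OF assms] by auto
  have "sorted (map (\<lambda>u. - x u) (sort_key (\<lambda>u. - x u) xs))" by simp
  then show ?thesis using that[of "sort_key (\<lambda>u. - x u) xs"] xs by (simp add: sorted_wrt_map)
qed

lemma length_ge_3: "3 \<le> length ps \<Longrightarrow> \<exists>a b c qs. ps = a # b # c # qs"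
  by (auto simp: numeral_3_eq_3 Suc_le_length_iff)

lemma mset_distinct_eq: "distinct xs \<Longrightarrow> distinct ys \<Longrightarrow> set xs = set ys \<Longrightarrow> mset xs = mset ys"
  by (simp add: set_eq_iff_mset_eq_distinct)

context positive_weight
begin

lemma top_two:
  assumes "sorted_wrt (\<lambda>u v. x v \<le> x u) (p # q # qs)" "a \<noteq> b" "a \<in> set (p # q # qs)" "b \<in> set (p # q # qs)"
  shows "x a + x b \<le> x p + x q"
proof -
  have le: "x v \<le> x q" if "v \<in> set (q # qs)" for v using that assms(1) by auto
  have pq: "x q \<le> x p" using assms(1) by simp
  have "a \<in> set (q # qs) \<or> b \<in> set (q # qs)" using assms by auto
  moreover have "x a \<le> x p" "x b \<le> x p" using assms by auto
  ultimately show ?thesis using le by force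
qed

lemma row_term_top_two:
  assumes "sorted_wrt (\<lambda>u v. x v \<le> x u) (p # q # qs)" "A \<subseteq> set (p # q # qs)" "A \<subseteq> {l, r}"
    "set (p # q # qs) \<subseteq> V" "m \<in> V"
  shows "(\<Sum>w\<in>A. row_term m w) \<le> row_term m p + row_term m q"
    and "\<not> (l \<noteq> r \<and> A = {l, r}) \<Longrightarrow> (\<Sum>w\<in>A. row_term m w) < row_term m p + row_term m q"
proof -
  have pos': "0 < row_term m p" "0 < row_term m q" using assms(4,5) by (auto intro!: row_term_pos)
  have mono: "row_term m a + row_term m b \<le> row_term m p + row_term m q" if "a \<noteq> b" "{a, b} \<subseteq> set (p # q # qs)" for a b
  proof -
    have "x a + x b \<le> x p + x q" using top_two[OF assms(1) that(1)] that(2) by auto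
    then have "(1 - \<alpha>) * (x a + x b) \<le> (1 - \<alpha>) * (x p + x q)" using \<alpha>1 by (intro mult_left_mono) auto
    then show ?thesis unfolding row_term_def by (simp add: algebra_simps)
  qed
  have single: "row_term m a < row_term m p + row_term m q" if "a \<in> set (p # q # qs)" for a
  proof -
    have "x a \<le> x p" using assms(1) that by auto
    then have "row_term m a \<le> row_term m p" unfolding row_term_def using \<alpha>1 by (simp add: mult_left_mono)
    then show ?thesis using pos' by linarith
  qed
  show s: "(\<Sum>w\<in>A. row_term m w) < row_term m p + row_term m q" if n: "\<not> (l \<noteq> r \<and> A = {l, r})"
  proof -
    have "A = {} \<or> A = {l} \<or> A = {r} \<or> A = {l, r}" using assms(3) by blast
    then consider "A = {}" | a where "A = {a}" using n by (cases "l = r") auto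
    then show ?thesis using single pos' assms(2) by cases auto
  qed
  show "(\<Sum>w\<in>A. row_term m w) \<le> row_term m p + row_term m q"
  proof (cases "l \<noteq> r \<and> A = {l, r}")
    case True
    then show ?thesis using mono[of l r] assms(2) by auto
  next
    case False
    then show ?thesis using s by simp
  qed
qed

lemma row_term_top_two_eq:
  assumes "row_term m l + row_term m r = row_term m p + row_term m q"
  shows "x l + x r = x p + x q"
proof -
  have "(1 - \<alpha>) * (x l + x r) = (1 - \<alpha>) * (x p + x q)" using assms unfolding row_term_def by (simp add: algebra_simps)
  then show ?thesis using \<alpha>1 by simp
qed

text \<open>
  The zigzag bound is attained: dealing out the sorted vertices to the two arms makes the second
  and third largest values the path neighbours of \<open>m\<close>.
\<close>
lemma zigzag_caterpillar:
  assumes "distinct (m # p # q # qs)" "finite S" "S \<inter> set (m # p # q # qs) = {}" "V = set (m # p # q # qs) \<union> S"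
  defines "L \<equiv> evens (p # q # qs)" and "R \<equiv> evens (q # qs)"
  shows "cat_parts V m L R S" "hd L = p" "hd R = q" "length L + length R = length qs + 2"
    "set (tl L) \<union> set (tl R) \<subseteq> set qs"
    "weight (caterpillar m L R S) = zigzag m m (p # q # qs) + (\<Sum>y\<in>S. wt m y)"
proof -
  have LR: "L = p # evens qs" "R = q # evens (tl qs)" unfolding L_def R_def by (simp_all add: evens_Cons)
  then show "hd L = p" "hd R = q" by simp_all
  have "set L \<union> set R = set (p # q # qs)" using set_evens_odds[of "p # q # qs"] unfolding L_def R_def by simp
  then have sLR: "set (m # L @ R) = set (m # p # q # qs)" by simp
  have dLR: "distinct (L @ R)" using distinct_evens_odds[of "p # q # qs"] assms(1) unfolding L_def R_def by simp
  have "m \<notin> set (L @ R)" using \<open>set L \<union> set R = _\<close> assms(1) by simp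
  then show cp: "cat_parts V m L R S" unfolding cat_parts_def sLR using assms(2-4) dLR LR by simp
  show "length L + length R = length qs + 2" using length_evens_odds[of "p # q # qs"] unfolding L_def R_def by simp
  show "set (tl L) \<union> set (tl R) \<subseteq> set qs" unfolding LR using set_evens_odds[of qs] by simp
  have "path_weight (m # L) + path_weight (m # R) = zigzag m m (p # q # qs)"
    using zigzag_evens[of m "p # q # qs" m] unfolding L_def R_def by simp
  then show "weight (caterpillar m L R S) = zigzag m m (p # q # qs) + (\<Sum>y\<in>S. wt m y)"
    using weight_caterpillar[OF cp] by simp
qed

lemma row_sum_centre:
  assumes "cat_parts V m L R S" "theta_edges L R S X"
  shows "row_sum (caterpillar m L R S \<union> X) m = (\<Sum>w\<in>S \<union> {hd L, hd R}. row_term m w)"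
proof -
  have "{w. {m, w} \<in> caterpillar m L R S \<union> X} = S \<union> {hd L, hd R}"
    using caterpillar_neighbours[OF assms(1)] theta_edges_props(5)[OF assms] by auto
  then show ?thesis by (simp add: row_sum_def)
qed

lemma row_sum_centre_split:
  assumes cp: "cat_parts V m L R S" and X: "theta_edges L R S X"
  shows "row_sum (caterpillar m L R S \<union> X) m = (\<Sum>w\<in>S. row_term m w) + (row_term m (hd L) + row_term m (hd R))"
proof -
  obtain l L1 r R1 where LR: "L = l # L1" "R = r # R1"
    using cp unfolding cat_parts_def by (metis list.exhaust)
  have "l \<noteq> r" "S \<inter> {l, r} = {}" "finite S" using cp unfolding cat_parts_def LR by auto
  then have "(\<Sum>w\<in>S \<union> {l, r}. row_term m w) = (\<Sum>w\<in>S. row_term m w) + (row_term m l + row_term m r)"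
    by (simp add: sum.union_disjoint del: Un_insert_right)
  then show ?thesis using row_sum_centre[OF cp X] unfolding LR by simp
qed

end

text \<open>
  All that is used of the spectral radius: \<open>x\<close> is positive, no competing edge set on the same
  vertices is heavier than \<open>D\<close>, and every competitor of the same weight has the same row sums
  (since \<open>x\<close> is then an eigenvector for the same eigenvalue of both graphs). A competitor of weight
  at least that of \<open>D\<close> in which some vertex has strictly smaller or larger row sum is thus impossible.
\<close>
locale extremal = positive_weight \<alpha> x V for \<alpha> and x :: "'a \<Rightarrow> real" and V +
  fixes D :: "'a set set" and d :: nat
  assumes bic: "bicyclic_diam V D d"
    and max: "bicyclic_diam V H d \<Longrightarrow> weight H \<le> weight D"
    and tight: "bicyclic_diam V H d \<Longrightarrow> weight H = weight D \<Longrightarrow> u \<in> V \<Longrightarrow> row_sum H u = row_sum D u"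
    and d2: "2 \<le> d"
begin

lemma sg: "simple_graph V D" and fV: "finite V" and fD: "finite D"
  using bic finite_simple_graph by (auto simp: bicyclic_diam_def simple_graph_def)

lemma weight_spanning:
  assumes D: "D = path_edges P \<union> (\<lambda>u. {u, par u}) ` U \<union> {e1, e2}" and "e1 \<noteq> e2"
    "{e1, e2} \<inter> (path_edges P \<union> (\<lambda>u. {u, par u}) ` U) = {}"
    "path_edges P \<inter> (\<lambda>u. {u, par u}) ` U = {}" "inj_on (\<lambda>u. {u, par u}) U"
    and par: "\<And>u. u \<in> U \<Longrightarrow> {u, par u} \<in> D" and "distinct P" "finite U"
  shows "weight D = path_weight P + (\<Sum>u\<in>U. wt u (par u)) + edge_weight e1 + edge_weight e2"
proof -
  have "weight D = weight (path_edges P \<union> (\<lambda>u. {u, par u}) ` U) + weight {e1, e2}"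
    unfolding D using assms(3,8) by (intro weight_Un) (auto simp: finite_path_edges)
  also have "weight (path_edges P \<union> (\<lambda>u. {u, par u}) ` U) = weight (path_edges P) + weight ((\<lambda>u. {u, par u}) ` U)"
    using assms(4,8) by (intro weight_Un) (auto simp: finite_path_edges)
  also have "weight ((\<lambda>u. {u, par u}) ` U) = (\<Sum>u\<in>U. edge_weight {u, par u})"
    unfolding weight_def using assms(5) by (simp add: sum.reindex)
  also have "\<dots> = (\<Sum>u\<in>U. wt u (par u))"
    using simple_graph_pair[OF sg par] by (intro sum.cong edge_weight_pair) auto
  finally show ?thesis using assms(2,7) by (simp add: weight_path weight_two)
qed

lemma row_sum_D: "row_sum D m = (\<Sum>w\<in>{w\<in>V - A. {m, w} \<in> D}. row_term m w) + (\<Sum>w\<in>{w\<in>A. {m, w} \<in> D}. row_term m w)"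
  if "A \<subseteq> V"
proof -
  have "{w. {m, w} \<in> D} = {w\<in>V - A. {m, w} \<in> D} \<union> {w\<in>A. {m, w} \<in> D}"
    using simple_graph_pair[OF sg] that by blast
  moreover have "finite A" using fV that by (rule finite_subset[rotated])
  then have "(\<Sum>w\<in>{w\<in>V - A. {m, w} \<in> D} \<union> {w\<in>A. {m, w} \<in> D}. row_term m w) =
      (\<Sum>w\<in>{w\<in>V - A. {m, w} \<in> D}. row_term m w) + (\<Sum>w\<in>{w\<in>A. {m, w} \<in> D}. row_term m w)"
    using fV \<open>finite A\<close> by (intro sum.union_disjoint) auto
  ultimately show ?thesis unfolding row_sum_def by (simp only:)
qed

context
  fixes m assumes m: "m \<in> V" and m_max: "\<And>u. u \<in> V \<Longrightarrow> x u \<le> x m"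
begin

lemma parent_weights_le:
  assumes "\<And>u. u \<in> B \<Longrightarrow> {u, par u} \<in> D"
  shows "(\<Sum>u\<in>B. wt u (par u)) \<le> (\<Sum>u\<in>B. wt m u)"
proof (rule sum_mono)
  fix u assume "u \<in> B"
  then have "par u \<in> V" using assms[of u] simple_graph_pair[OF sg] by auto
  then show "wt u (par u) \<le> wt m u" using m_max by (subst wt_commute) (auto intro!: wt_mono)
qed

text \<open>
  If \<open>m\<close> were adjacent to two path vertices at distance two, it could replace the vertex between them,
  which would give a diametral path through \<open>m\<close>.
\<close>
lemma two_contacts:
  assumes geo: "geodesic D P" and len: "length P = d + 1" and PV: "set P \<subseteq> V" and mP: "m \<notin> set P"
    and none: "\<And>Q. geodesic D Q \<Longrightarrow> length Q = d + 1 \<Longrightarrow> set Q \<subseteq> V \<Longrightarrow> m \<notin> set Q"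
    and ij: "i < j" "j < length P" "{m, P ! i} \<in> D" "{m, P ! j} \<in> D"
  shows "j = Suc i"
proof (rule ccontr)
  assume "j \<noteq> Suc i"
  obtain h :: "'a \<Rightarrow> int" where h: "\<And>u w. {u, w} \<in> D \<Longrightarrow> \<bar>h u - h w\<bar> \<le> 1" "\<And>j. j < length P \<Longrightarrow> h (P ! j) = int j"
    using geo unfolding geodesic_def by blast
  have a: "\<bar>h m - int i\<bar> \<le> 1" "\<bar>h m - int j\<bar> \<le> 1" using h(1)[OF ij(3)] h(1)[OF ij(4)] h(2) ij by auto
  then have j: "j = Suc (Suc i)" and hm: "h m = int (Suc i)" using ij(1) \<open>j \<noteq> Suc i\<close> by linarith+
  define Q where "Q = P[Suc i := m]"
  have "{Q ! k, Q ! Suc k} \<in> D" if "Suc k < length Q" for k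
  proof -
    have "{P ! k, P ! Suc k} \<in> D" using geo that by (auto simp: geodesic_def path_edges_nth Q_def)
    then show ?thesis using ij j that by (auto simp: Q_def nth_list_update insert_commute)
  qed
  then have "path_edges Q \<subseteq> D" by (auto simp: path_edges_nth)
  moreover have "h (Q ! k) = int k" if "k < length Q" for k
    using that h(2) hm by (cases "k = Suc i") (auto simp: Q_def)
  ultimately have "geodesic D Q" unfolding geodesic_def using h(1) by blast
  moreover have "set Q \<subseteq> V" using PV m set_update_subset_insert[of P "Suc i" m] by (auto simp: Q_def)
  moreover have "m \<in> set Q" unfolding Q_def using ij j by (intro set_update_memI) auto
  ultimately show False using none[of Q] len by (simp add: Q_def)
qed

text \<open>
  Suppose the heaviest vertex \<open>m\<close> lies on no diametral path, and let \<open>p1 \<ge> p2 \<ge> p3\<close> be the heaviest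
  vertices of a diametral path \<open>P\<close>. Then the caterpillar in which \<open>m\<close> takes the place of \<open>p1\<close> on the
  zigzag path, and \<open>p1\<close> becomes a pendant vertex, is at least as heavy as the spanning tree. With
  two additional edges it yields a competitor at least as heavy as \<open>D\<close>, in which \<open>m\<close> is
  adjacent to \<open>p1\<close>, \<open>p2\<close>, \<open>p3\<close> and to all vertices off the path. In \<open>D\<close>, however, \<open>m\<close> has at most two
  neighbours on the path, so the row sums at \<open>m\<close> differ.
\<close>
lemma centre_on_geodesic:
  obtains P where "geodesic D P" "length P = d + 1" "set P \<subseteq> V" "m \<in> set P"
proof (rule ccontr)
  assume "\<not> thesis"
  then have none: "\<And>Q. geodesic D Q \<Longrightarrow> length Q = d + 1 \<Longrightarrow> set Q \<subseteq> V \<Longrightarrow> m \<notin> set Q"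
    using that by blast
  obtain P where geo: "geodesic D P" and len: "length P = d + 1" and PV: "set P \<subseteq> V"
    using geodesic_exists[OF bic] .
  have mP: "m \<notin> set P" using none geo len PV .
  have dP: "distinct P" using geo by (rule geodesic_distinct)
  note contacts = two_contacts[OF geo len PV mP none]
  define B where "B = V - set P - {m}"
  have fB: "finite B" using fV by (simp add: B_def)
  obtain i par U e1 e2 where "spanning_split V D P m i par U e1 e2"
    using spanning_split_exists[OF bic geo len PV m] .
  note split = spanning_splitD[OF this]
  have i: "i < length P" by (rule split(2))
  have U: "U = insert (P ! i) B" "P ! i \<notin> B" using split(1) i mP by (auto simp: B_def)
  note D = split(4)[unfolded U(1)] and ne = split(5) and dj = split(6,7)[unfolded U(1)] and inj = split(8)[unfolded U(1)]
    and parm = split(9)[unfolded U(1)] and close = split(10) and eP = split(11) and em = split(12)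
  have par: "{u, par u} \<in> D" if "u \<in> insert (P ! i) B" for u using D that by blast
  have "weight D = path_weight P + (\<Sum>u\<in>insert (P ! i) B. wt u (par u)) + edge_weight e1 + edge_weight e2"
    using weight_spanning[OF D ne dj inj par dP] fB by simp
  also have "\<dots> = path_weight P + wt (P ! i) (par (P ! i)) + (\<Sum>u\<in>B. wt u (par u)) + edge_weight e1 + edge_weight e2"
    using U(2) fB by simp
  also have "(\<Sum>u\<in>B. wt u (par u)) \<le> (\<Sum>u\<in>B. wt m u)"
    using par by (intro parent_weights_le) auto
  finally have wD: "weight D \<le> path_weight P + wt (P ! i) (par (P ! i)) + (\<Sum>u\<in>B. wt m u) + edge_weight e1 + edge_weight e2"
    by simp
  obtain ps where ps: "distinct ps" "set ps = set P" and srt: "sorted_wrt (\<lambda>u v. x v \<le> x u) ps"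
    using sorted_enumeration[of "set P" x] by auto
  have "length ps = d + 1" using ps dP len by (metis distinct_card)
  then obtain p1 p2 p3 qs where ps_eq: "ps = p1 # p2 # p3 # qs" using d2
    using length_ge_3[of ps] by auto
  have p_le: "x p2 \<le> x p1" "x p3 \<le> x p2" "x p3 \<le> x p1" "\<And>v. v \<in> set qs \<Longrightarrow> x v \<le> x p3" "\<And>v. v \<in> set P \<Longrightarrow> x v \<le> x p1"
    using srt ps(2)[symmetric] unfolding ps_eq by auto
  have pV: "p1 \<in> V" "p2 \<in> V" "p3 \<in> V" using PV ps(2) by (auto simp: ps_eq)
  define S where "S = insert p1 B"
  define L R where "L = evens (p2 # p3 # qs)" and "R = evens (p3 # qs)"
  have B_P: "B \<inter> set ps = {}" "m \<notin> set ps" "m \<notin> B" using mP ps(2) by (auto simp: B_def)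
  have VS: "V = set (m # p2 # p3 # qs) \<union> S" using m PV ps(2) by (auto simp: S_def B_def ps_eq)
  have di: "distinct (m # p2 # p3 # qs)" "finite S" "S \<inter> set (m # p2 # p3 # qs) = {}"
    using ps(1) B_P fB by (auto simp: S_def ps_eq)
  note cat = zigzag_caterpillar[OF di VS, folded L_def R_def]
  have lenLR: "length L + length R = d" using cat(4) \<open>length ps = d + 1\<close> ps_eq by simp
  have wcat: "weight (caterpillar m L R S) = zigzag m m (p2 # p3 # qs) + wt m p1 + (\<Sum>u\<in>B. wt m u)"
    using cat(6) B_P fB by (simp add: S_def ps_eq)
  have Pi: "x (P ! i) \<le> x p1" using i p_le by simp
  \<comment> \<open>If one of the two further edges ends in \<open>m\<close>, the other end is next to \<open>P ! i\<close> on the path. Then \<open>m\<close> is inserted between these two vertices, and the path edge between them becomes the further edge.\<close>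
  have contact_tree: "\<exists>f1 f2. f1 \<noteq> f2 \<and> f1 \<subseteq> V - {m} \<and> f2 \<subseteq> V - {m} \<and> card f1 = 2 \<and> card f2 = 2 \<and>
     weight D \<le> weight (caterpillar m L R S) + edge_weight f1 + edge_weight f2"
  proof (cases "m \<in> e1 \<or> m \<in> e2")
    case False
    have "path_weight P \<le> zigzag p1 p1 (p2 # p3 # qs)"
      using path_weight_le_zigzag[of P p1 "p2 # p3 # qs"] mset_distinct_eq[OF dP ps(1)] ps(2) srt by (simp add: ps_eq)
    also have "\<dots> \<le> zigzag m m (p2 # p3 # qs)" using m_max[OF pV(1)] by (intro zigzag_mono)
    finally have 1: "path_weight P \<le> zigzag m m (p2 # p3 # qs)" .
    have "par (P ! i) \<in> V" using par[of "P ! i"] simple_graph_pair[OF sg] by auto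
    then have "wt (P ! i) (par (P ! i)) \<le> wt m p1" using m_max Pi by (subst wt_commute) (auto intro!: wt_mono)
    then have "weight D \<le> weight (caterpillar m L R S) + edge_weight e1 + edge_weight e2" using wD 1 wcat by linarith
    moreover have "e1 \<in> D" "e2 \<in> D" using D by auto
    ultimately show ?thesis using False ne sg unfolding simple_graph_def by blast
  next
    case True
    then obtain e f where ef: "{e, f} = {e1, e2}" "m \<in> e" by auto
    have wef: "edge_weight e1 + edge_weight e2 = edge_weight e + edge_weight f" "e \<noteq> f" using ef(1) ne by (auto simp: doubleton_eq_iff)
    have efD: "e \<in> D" "f \<in> D" using ef(1) D by auto
    obtain j where j: "j < length P" "j \<noteq> i" "e = {m, P ! j}" using em[of e] ef by blast
    have mi: "{m, P ! i} \<in> D" using close[OF j(1)] efD j mP by simp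
    then have pari: "par (P ! i) = m" using parm by simp
    have adj: "k = Suc l \<or> l = Suc k" if "k < length P" "l < length P" "k \<noteq> l" "{m, P ! k} \<in> D" "{m, P ! l} \<in> D" for k l
      using contacts[of k l] contacts[of l k] that by linarith
    have mf: "m \<notin> f"
    proof
      assume "m \<in> f"
      then obtain k where k: "k < length P" "k \<noteq> i" "f = {m, P ! k}" using em[of f] ef by blast
      have "k \<noteq> j" using k j wef by auto
      then show False using adj[of k j] adj[of k i] adj[of j i] k j i mi efD by auto
    qed
    define k where "k = min i j"
    have k: "Suc k < length P" "{P ! k, P ! Suc k} = {P ! i, P ! j}" "wt (P ! i) m + wt (P ! j) m = wt (P ! k) m + wt m (P ! Suc k)"
      using adj[of i j] i j mi efD unfolding k_def by (auto simp: min_def insert_commute wt_commute)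
    obtain A a b C where P: "P = A @ a # b # C" "a = P ! k" "b = P ! Suc k"
      using id_take_nth_drop[of k P] Cons_nth_drop_Suc[of "Suc k" P] k(1) by (metis Suc_lessD)
    have pP: "path_weight P = path_weight (A @ [a]) + wt a b + path_weight (b # C)"
      using path_weight_append[of A a "b # C"] P(1) by simp
    have pQ: "path_weight (A @ a # m # b # C) = path_weight (A @ [a]) + wt a m + wt m b + path_weight (b # C)"
      using path_weight_append[of A a "m # b # C"] by simp
    have "mset (A @ a # m # b # C) = mset (m # p1 # p2 # p3 # qs)"
    proof -
      have "mset (A @ a # m # b # C) = add_mset m (mset P)" unfolding P(1) by simp
      then show ?thesis using mset_distinct_eq[OF dP ps(1) ps(2)[symmetric]] by (simp add: ps_eq)
    qed
    then have "path_weight (A @ a # m # b # C) \<le> zigzag m m (p1 # p2 # p3 # qs)"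
      using srt m_max PV ps(2) by (intro path_weight_le_zigzag) (auto simp: ps_eq)
    also have "\<dots> = wt m p1 + wt m p2 + wt p1 p3 + zigzag p2 p3 qs" by simp
    also have "wt p1 p3 \<le> wt m p3" using m_max pV by (intro wt_mono1) auto
    finally have "path_weight (A @ a # m # b # C) \<le> zigzag m m (p2 # p3 # qs) + wt m p1" by simp
    moreover have "edge_weight e = wt (P ! j) m"
    proof -
      have "m \<noteq> P ! j" using j(1) mP by auto
      then show ?thesis using edge_weight_pair[of m "P ! j"] j(3) wt_commute by simp
    qed
    moreover have aneb: "a \<noteq> b" using dP unfolding P(1) by simp
    then have "edge_weight {a, b} = wt a b" by (rule edge_weight_pair)
    ultimately have w': "weight D \<le> weight (caterpillar m L R S) + edge_weight {a, b} + edge_weight f"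
      using wD wcat pari pP pQ wef k(3) P(2,3) by simp
    have abP: "{a, b} \<subseteq> set P" using P(2,3) k(1) by simp
    have "f \<in> {e1, e2}" using ef(1) by blast
    then have "\<not> f \<subseteq> set P" by (rule eP)
    then have "{a, b} \<noteq> f" using abP by blast
    moreover have "{a, b} \<subseteq> V - {m}" using abP PV mP by blast
    moreover have "f \<subseteq> V" "card f = 2" using efD(2) sg unfolding simple_graph_def by simp_all
    then have "f \<subseteq> V - {m}" using mf by blast
    moreover have "card {a, b} = 2" using aneb by simp
    ultimately show ?thesis using w' \<open>card f = 2\<close>
      by (intro exI[of _ "{a, b}"] exI[of _ f] conjI)
  qed
  then obtain f1 f2 where f: "f1 \<noteq> f2" "f1 \<subseteq> V - {m}" "f2 \<subseteq> V - {m}" "card f1 = 2" "card f2 = 2"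
    and wDf: "weight D \<le> weight (caterpillar m L R S) + edge_weight f1 + edge_weight f2" by blast
  have big: "\<exists>c\<in>S. \<forall>v\<in>V - {m}. x v \<le> x c"
  proof -
    have "f1 \<noteq> {}" using f(4) by auto
    then have "finite (V - {m})" "V - {m} \<noteq> {}" using fV f(2) by auto
    then obtain c where c: "c \<in> V - {m}" "\<And>v. v \<in> V - {m} \<Longrightarrow> x v \<le> x c"
      by (rule finite_argmax[of "V - {m}" x]) blast
    show ?thesis
    proof (cases "c \<in> set P")
      case True
      then show ?thesis using c p_le(5)[OF True] by (intro bexI[of _ p1]) (auto simp: S_def intro: order_trans)
    next
      case False
      then show ?thesis using c by (intro bexI[of _ c]) (auto simp: S_def B_def)
    qed
  qed
  have rest: "x v \<le> x (hd L) \<and> x v \<le> x (hd R)" if "v \<in> set (tl L) \<union> set (tl R)" for v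
    using that cat(2,3,5) p_le by fastforce
  obtain L' R' S' X where cp': "cat_parts V m L' R' S'" and X: "theta_edges L' R' S' X"
    and len': "length L' + length R' = length L + length R"
    and N: "S' \<union> {hd L', hd R'} = S \<union> {hd L, hd R}"
    and w: "weight (caterpillar m L R S) + edge_weight f1 + edge_weight f2 \<le> weight (caterpillar m L' R' S' \<union> X)"
    using theta_improvement[OF cat(1) rest f(1)] f big by (metis (no_types, lifting) insertE singletonD)
  let ?H = "caterpillar m L' R' S' \<union> X"
  have bH: "bicyclic_diam V ?H d" using bicyclic_diam_caterpillar[OF cp' X] len' lenLR by simp
  then have "row_sum ?H m = row_sum D m" using max[OF bH] tight[OF bH _ m] w wDf by linarith
  moreover have "row_sum ?H m = (\<Sum>w\<in>B. row_term m w) + (row_term m p1 + row_term m p2 + row_term m p3)"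
  proof -
    have "S \<union> {hd L, hd R} = B \<union> {p1, p2, p3}" using cat(2,3) by (auto simp: S_def)
    moreover have "(\<Sum>w\<in>B \<union> {p1, p2, p3}. row_term m w) = (\<Sum>w\<in>B. row_term m w) + (\<Sum>w\<in>{p1, p2, p3}. row_term m w)"
      using B_P fB by (intro sum.union_disjoint) (auto simp: ps_eq)
    moreover have "(\<Sum>w\<in>{p1, p2, p3}. row_term m w) = row_term m p1 + row_term m p2 + row_term m p3" using ps(1) by (simp add: ps_eq)
    ultimately show ?thesis using row_sum_centre[OF cp' X] N by simp
  qed
  moreover have "row_sum D m < (\<Sum>w\<in>B. row_term m w) + (row_term m p1 + row_term m p2 + row_term m p3)"
  proof -
    let ?A = "{w \<in> set P. {m, w} \<in> D}"
    have 1: "(\<Sum>w\<in>{w\<in>V - set P. {m, w} \<in> D}. row_term m w) \<le> (\<Sum>w\<in>B. row_term m w)"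
      using fB simple_graph_pair[OF sg] m row_term_pos[OF m] by (intro sum_mono2) (auto simp: B_def intro: less_imp_le)
    have "\<exists>l r. ?A \<subseteq> {l, r}"
    proof (cases "?A = {}")
      case True
      then show ?thesis by auto
    next
      case False
      define k where "k = (LEAST k. k < length P \<and> {m, P ! k} \<in> D)"
      have ex: "\<exists>k. k < length P \<and> {m, P ! k} \<in> D" using False by (auto simp: in_set_conv_nth)
      have k: "k < length P" "{m, P ! k} \<in> D" using LeastI_ex[OF ex] by (auto simp: k_def)
      have "?A \<subseteq> {P ! k, P ! Suc k}"
      proof
        fix w assume "w \<in> ?A"
        then obtain j where j: "j < length P" "w = P ! j" "{m, P ! j} \<in> D" by (auto simp: in_set_conv_nth)
        then have "k \<le> j" using Least_le[of "\<lambda>k. k < length P \<and> {m, P ! k} \<in> D" j] by (simp add: k_def)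
        then show "w \<in> {P ! k, P ! Suc k}" using contacts[of k j] j k by (cases "k = j") auto
      qed
      then show ?thesis by blast
    qed
    then obtain l r where "?A \<subseteq> {l, r}" by blast
    moreover have ps': "set (p1 # p2 # p3 # qs) = set P" using ps(2) unfolding ps_eq .
    ultimately have "(\<Sum>w\<in>?A. row_term m w) \<le> row_term m p1 + row_term m p2"
      using srt PV m unfolding ps_eq by (intro row_term_top_two(1)[of p1 p2 "p3 # qs" ?A l r m]) auto
    moreover have "0 < row_term m p3" using row_term_pos m pV by simp
    ultimately show ?thesis using 1 row_sum_D[OF PV, of m] by linarith
  qed
  ultimately show False by simp
qed

text \<open>
  Now \<open>m\<close> lies on a diametral path. A first competitor, built from the zigzag ordering, is at least
  as heavy as \<open>D\<close>; comparing row sums at \<open>m\<close> shows that in \<open>D\<close> all vertices off the path are attached to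
  \<open>m\<close> and that the path neighbours of \<open>m\<close> are the heaviest possible. So \<open>D\<close> is a caterpillar and
  two further edges, and a second application of \<open>theta_improvement\<close>, now to this caterpillar,
  identifies these two edges by \<open>two_star_eq\<close>.
\<close>
lemma extremal_is_theta:
  obtains L R S X where "cat_parts V m L R S" "theta_edges L R S X" "D = caterpillar m L R S \<union> X"
    "length L + length R = d"
proof -
  obtain P where geo: "geodesic D P" and len: "length P = d + 1" and PV: "set P \<subseteq> V" and mP: "m \<in> set P"
    by (rule centre_on_geodesic)
  have dP: "distinct P" using geo by (rule geodesic_distinct)
  define B where "B = V - set P"
  have fB: "finite B" and mB: "m \<notin> B" using fV mP by (simp_all add: B_def)
  obtain i par U e1 e2 where "spanning_split V D P m i par U e1 e2"
    using spanning_split_exists[OF bic geo len PV m] .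
  note split = spanning_splitD[OF this]
  have i: "i < length P" "P ! i = m" using split(2) split(3)[OF mP] .
  have U: "U = B" using split(1) i mB by (auto simp: B_def)
  note D = split(4)[unfolded U] and ne = split(5) and dj = split(6,7)[unfolded U] and inj = split(8)[unfolded U]
    and parm = split(9)[unfolded U] and eP = split(11) and em = split(12)
  have par: "{u, par u} \<in> D" if "u \<in> B" for u using D that by blast
  have wD: "weight D = path_weight P + (\<Sum>u\<in>B. wt u (par u)) + edge_weight e1 + edge_weight e2"
    using weight_spanning[OF D ne dj inj par dP fB] .
  have "(\<Sum>u\<in>B. wt u (par u)) \<le> (\<Sum>u\<in>B. wt m u)"
    using par by (rule parent_weights_le)
  then have wD': "weight D \<le> path_weight P + (\<Sum>u\<in>B. wt m u) + edge_weight e1 + edge_weight e2" using wD by simp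
  have eD: "e1 \<in> D" "e2 \<in> D" using D by auto
  have e_ok: "e \<subseteq> V - {m} \<and> card e = 2 \<and> e \<inter> B \<noteq> {}" if "e \<in> {e1, e2}" for e
  proof -
    have "e \<subseteq> V" "card e = 2" using that eD sg by (auto simp: simple_graph_def)
    moreover have "m \<notin> e" using em[OF that] mP by auto
    moreover have "e \<inter> B \<noteq> {}" using eP[OF that] \<open>e \<subseteq> V\<close> by (auto simp: B_def)
    ultimately show ?thesis by blast
  qed
  obtain ps where ps: "distinct ps" "set ps = set P - {m}" and srt: "sorted_wrt (\<lambda>u v. x v \<le> x u) ps"
    using sorted_enumeration[of "set P - {m}" x] by auto
  have "length ps = d" using ps dP len mP distinct_card[OF ps(1)] distinct_card[OF dP] by simp
  then obtain p q qs where ps_eq: "ps = p # q # qs" using d2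
    by (cases ps rule: path_edges.cases) auto
  have pV: "p \<in> V" "q \<in> V" using PV ps(2) by (auto simp: ps_eq)
  define L R where "L = evens (p # q # qs)" and "R = evens (q # qs)"
  have di: "distinct (m # p # q # qs)" "B \<inter> set (m # p # q # qs) = {}" "V = set (m # p # q # qs) \<union> B"
    using ps PV mP by (auto simp: ps_eq B_def)
  note cat = zigzag_caterpillar[OF di(1) fB di(2,3), folded L_def R_def]
  have lenLR: "length L + length R = d" using cat(4) \<open>length ps = d\<close> ps_eq by simp
  have rest: "x v \<le> x (hd L) \<and> x v \<le> x (hd R)" if "v \<in> set (tl L) \<union> set (tl R)" for v
  proof -
    have "v \<in> set qs" using that cat(5) by auto
    then show ?thesis using cat(2,3) srt by (simp add: ps_eq)
  qed
  have "path_weight P \<le> zigzag m m (p # q # qs)"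
  proof (rule path_weight_le_zigzag)
    show "mset P = mset (m # p # q # qs)" using ps mP di(1) by (intro mset_distinct_eq[OF dP]) (auto simp: ps_eq)
    show "sorted_wrt (\<lambda>u v. x v \<le> x u) (m # p # q # qs)" using srt m_max PV ps(2) by (auto simp: ps_eq)
  qed
  then have w1: "weight D \<le> weight (caterpillar m L R B) + edge_weight e1 + edge_weight e2" using wD' cat(6) by simp
  obtain L1 R1 S1 X1 where cp1: "cat_parts V m L1 R1 S1" and X1: "theta_edges L1 R1 S1 X1"
    and len1: "length L1 + length R1 = length L + length R"
    and N1: "S1 \<union> {hd L1, hd R1} = B \<union> {hd L, hd R}"
    and w2: "weight (caterpillar m L R B) + edge_weight e1 + edge_weight e2 \<le> weight (caterpillar m L1 R1 S1 \<union> X1)"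
    using theta_improvement[OF cat(1) rest ne] e_ok by (metis (no_types, lifting))
  let ?H = "caterpillar m L1 R1 S1 \<union> X1"
  have bH: "bicyclic_diam V ?H d" using bicyclic_diam_caterpillar[OF cp1 X1] len1 lenLR by simp
  then have rows: "row_sum ?H m = row_sum D m" using max[OF bH] tight[OF bH _ m] w1 w2 by linarith
  have rowH: "row_sum ?H m = (\<Sum>w\<in>B. row_term m w) + (row_term m p + row_term m q)"
  proof -
    have "(\<Sum>w\<in>B \<union> {p, q}. row_term m w) = (\<Sum>w\<in>B. row_term m w) + (\<Sum>w\<in>{p, q}. row_term m w)"
      using di fB by (intro sum.union_disjoint) auto
    moreover have "(\<Sum>w\<in>{p, q}. row_term m w) = row_term m p + row_term m q" using di by simp
    ultimately show ?thesis using row_sum_centre[OF cp1 X1] N1 cat(2,3) by simp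
  qed
  \<comment> \<open>Equality of the row sums at \<open>m\<close> holds only if \<open>m\<close> is adjacent to all of \<open>B\<close> and has two path neighbours of maximal total value.\<close>
  let ?B = "{w\<in>V - set P. {m, w} \<in> D}" and ?A = "{w \<in> set P. {m, w} \<in> D}"
  let ?l = "P ! (i - 1)" and ?r = "P ! Suc i"
  have A_ps: "?A \<subseteq> set (p # q # qs)" using ps(2) simple_graph_pair[OF sg] by (auto simp: ps_eq)
  have A_lr: "?A \<subseteq> (if 0 < i then {?l} else {}) \<union> (if Suc i < length P then {?r} else {})"
  proof
    fix w assume "w \<in> ?A"
    then obtain j where j: "j < length P" "w = P ! j" "{P ! i, P ! j} \<in> D" using i by (auto simp: in_set_conv_nth)
    have "\<bar>int i - int j\<bar> \<le> 1" using geodesic_chord[OF geo i(1) j(1,3)] .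
    moreover have "i \<noteq> j" using j(3) simple_graph_pair[OF sg] by blast
    ultimately have "j = Suc i \<or> (0 < i \<and> j = i - 1)" by linarith
    then show "w \<in> (if 0 < i then {?l} else {}) \<union> (if Suc i < length P then {?r} else {})" using j by auto
  qed
  have sB: "(\<Sum>w\<in>?B. row_term m w) \<le> (\<Sum>w\<in>B. row_term m w)" "?B \<noteq> B \<Longrightarrow> (\<Sum>w\<in>?B. row_term m w) < (\<Sum>w\<in>B. row_term m w)"
  proof -
    have sub: "?B \<subseteq> B" by (auto simp: B_def)
    have rtB: "0 < row_term m w" if "w \<in> B" for w using that row_term_pos[OF m] by (auto simp: B_def)
    show "(\<Sum>w\<in>?B. row_term m w) \<le> (\<Sum>w\<in>B. row_term m w)"
      using sub fB rtB by (intro sum_mono2) (auto intro: less_imp_le)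
    assume "?B \<noteq> B"
    then obtain b where "b \<in> B - ?B" using sub by blast
    then show "(\<Sum>w\<in>?B. row_term m w) < (\<Sum>w\<in>B. row_term m w)"
      using sub fB rtB by (intro sum_strict_mono2[of B ?B b]) (auto intro: less_imp_le)
  qed
  have srt': "sorted_wrt (\<lambda>u v. x v \<le> x u) (p # q # qs)" and subV: "set (p # q # qs) \<subseteq> V"
    using srt ps(2) PV by (auto simp: ps_eq)
  have "?A \<subseteq> {?l, ?r}" using A_lr by (auto split: if_splits)
  note tt = row_term_top_two[OF srt' A_ps this subV m]
  have total: "(\<Sum>w\<in>?B. row_term m w) + (\<Sum>w\<in>?A. row_term m w) = (\<Sum>w\<in>B. row_term m w) + (row_term m p + row_term m q)"
    by (rule trans[OF sym[OF row_sum_D[OF PV]] trans[OF sym[OF rows] rowH]])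
  have BB: "?B = B" by (rule ccontr) (use sB(2) tt(1) total in linarith)
  have sumA: "(\<Sum>w\<in>?A. row_term m w) = row_term m p + row_term m q" using total unfolding BB by linarith
  have lr': "?l \<noteq> ?r \<and> ?A = {?l, ?r}" by (rule ccontr) (use sumA tt(2) in linarith)
  then have lr: "?l \<noteq> ?r" "?A = {?l, ?r}" by blast+
  have lrA: "{?l, ?r} \<subseteq> (if 0 < i then {?l} else {}) \<union> (if Suc i < length P then {?r} else {})"
    using A_lr unfolding lr(2) .
  have i0: "0 < i" "Suc i < length P" by (rule ccontr, use lrA lr(1) in \<open>simp split: if_splits\<close>)+
  have "row_term m ?l + row_term m ?r = row_term m p + row_term m q" using sumA lr(1) unfolding lr(2) by simp
  then have xlr: "x ?l + x ?r = x p + x q" by (rule row_term_top_two_eq)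
  define L0 R0 where "L0 = rev (take i P)" and "R0 = drop (Suc i) P"
  have P_eq: "rev L0 @ m # R0 = P" unfolding L0_def R0_def using id_take_nth_drop[OF i(1)] i by simp
  have hd0: "hd L0 = ?l" "hd R0 = ?r" "L0 \<noteq> []" "R0 \<noteq> []"
  proof -
    have "take i P \<noteq> []" "length (take i P) = i" using i0 i(1) by auto
    then show "hd L0 = ?l" "L0 \<noteq> []" using i0 unfolding L0_def by (auto simp: hd_rev last_conv_nth)
    show "hd R0 = ?r" "R0 \<noteq> []" using i0 unfolding R0_def by (auto simp: hd_drop_conv_nth)
  qed
  have cp0: "cat_parts V m L0 R0 B"
    unfolding cat_parts_def using hd0 fB dP PV unfolding B_def P_eq[symmetric] by auto
  have len0: "length L0 + length R0 = d" using len P_eq by (metis Suc_eq_plus1 add_Suc_right diff_Suc_1 length_Cons length_append length_rev)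
  have rest0: "x v \<le> x (hd L0) \<and> x v \<le> x (hd R0)" if v: "v \<in> set (tl L0) \<union> set (tl R0)" for v
  proof -
    have d0: "distinct (rev L0 @ m # R0)" using dP P_eq by simp
    have "v \<in> set P - {m, ?l, ?r}"
      using v hd0 d0 unfolding P_eq[symmetric] by (cases L0; cases R0) auto
    then have "v \<in> set (p # q # qs)" "v \<noteq> ?l" "v \<noteq> ?r" using ps(2) by (auto simp: ps_eq)
    moreover have "?l \<in> set (p # q # qs)" "?r \<in> set (p # q # qs)" using A_ps lr(2) by auto
    ultimately have "x v + x ?r \<le> x p + x q" "x v + x ?l \<le> x p + x q"
      using top_two[OF srt'] by blast+
    then show ?thesis using xlr hd0 by simp
  qed
  have D0: "D = caterpillar m L0 R0 B \<union> {e1, e2}"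
  proof -
    have "par u = m" if "u \<in> B" for u using parm[OF that] BB that by auto
    then have "(\<lambda>u. {u, par u}) ` B = (\<lambda>y. {m, y}) ` B" by (auto simp: insert_commute)
    then show ?thesis using D unfolding caterpillar_def P_eq by simp
  qed
  have dj0: "caterpillar m L0 R0 B \<inter> {e1, e2} = {}"
  proof -
    have "par u = m" if "u \<in> B" for u using parm[OF that] BB that by auto
    then have "(\<lambda>u. {u, par u}) ` B = (\<lambda>y. {m, y}) ` B" by (auto simp: insert_commute)
    then show ?thesis using dj(1) unfolding caterpillar_def P_eq by auto
  qed
  have fcat: "finite (caterpillar m L0 R0 B)" using finite_simple_graph[OF simple_caterpillar[OF cp0]] .
  have wD0: "weight D = weight (caterpillar m L0 R0 B) + edge_weight e1 + edge_weight e2"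
    unfolding D0 using dj0 fcat ne by (subst weight_Un) (auto simp: weight_two)
  obtain L2 R2 S2 X2 where cp2: "cat_parts V m L2 R2 S2" and X2: "theta_edges L2 R2 S2 X2"
    and len2: "length L2 + length R2 = length L0 + length R0"
    and w3: "weight (caterpillar m L0 R0 B) + edge_weight e1 + edge_weight e2 \<le> weight (caterpillar m L2 R2 S2 \<union> X2)"
    and w4: "weight (caterpillar m L0 R0 B) + edge_weight e1 + edge_weight e2 < weight (caterpillar m L2 R2 S2 \<union> X2) \<or>
       caterpillar m L2 R2 S2 = caterpillar m L0 R0 B"
    using theta_improvement[OF cp0 rest0 ne] e_ok by (metis (no_types, lifting))
  let ?K = "caterpillar m L2 R2 S2 \<union> X2"
  have bK: "bicyclic_diam V ?K d" using bicyclic_diam_caterpillar[OF cp2 X2] len2 len0 by simp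
  have eqcat: "caterpillar m L2 R2 S2 = caterpillar m L0 R0 B" using max[OF bK] w4 wD0 by linarith
  have rowsK: "row_sum ?K v = row_sum D v" if "v \<in> V" for v
    using tight[OF bK _ that] max[OF bK] w3 wD0 by linarith
  have rowsX: "row_sum X2 v = row_sum {e1, e2} v" if "v \<in> V" for v
  proof -
    have "row_sum ?K v = row_sum (caterpillar m L0 R0 B) v + row_sum X2 v"
      using theta_edges_props[OF cp2 X2] fcat eqcat by (subst row_sum_Un) auto
    moreover have "row_sum D v = row_sum (caterpillar m L0 R0 B) v + row_sum {e1, e2} v"
      unfolding D0 using dj0 fcat by (subst row_sum_Un) auto
    ultimately show ?thesis using rowsK[OF that] by simp
  qed
  obtain c a b where star: "X2 = {{c, a}, {c, b}}" "c \<noteq> a" "c \<noteq> b" "a \<noteq> b" "{a, b, c} \<subseteq> V - {m}"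
    using theta_edges_star[OF cp2 X2] .
  have abcV: "{a, b, c} \<subseteq> V" using star(5) by blast
  have "simple_graph V {e1, e2}" using sg eD by (auto simp: simple_graph_def)
  then have X2e: "X2 = {e1, e2}" by (rule two_star_eq[OF star(1-4) abcV refl ne _ rowsX])
  have "D = ?K" unfolding eqcat X2e by (rule D0)
  moreover have "length L2 + length R2 = d" using len2 len0 by simp
  ultimately show ?thesis by (rule that[OF cp2 X2])
qed

end

end

section \<open>Balancing the two arms\<close>

lemma path_edges_join:
  "xs \<noteq> [] \<Longrightarrow> ys \<noteq> [] \<Longrightarrow> path_edges (xs @ ys) = insert {last xs, hd ys} (path_edges xs \<union> path_edges ys)"
  by (induction xs rule: path_edges.induct) (auto simp: path_edges_Cons)

context vertex_weight
begin

lemma path_weight_join: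
  "xs \<noteq> [] \<Longrightarrow> ys \<noteq> [] \<Longrightarrow> path_weight (xs @ ys) = path_weight xs + wt (last xs) (hd ys) + path_weight ys"
  by (induction xs rule: path_edges.induct) (auto simp: path_weight_Cons)

end

context extremal
begin

definition extremal_shape :: "'a \<Rightarrow> 'a list \<Rightarrow> 'a list \<Rightarrow> 'a set \<Rightarrow> 'a set set \<Rightarrow> bool" where
  "extremal_shape m L R S X \<longleftrightarrow> cat_parts V m L R S \<and> theta_edges L R S X \<and> D = caterpillar m L R S \<union> X \<and>
     length L + length R = d"

lemma extremal_shape_sym: "extremal_shape m L R S X \<Longrightarrow> extremal_shape m R L S X"
  unfolding extremal_shape_def using cat_parts_sym theta_edges_sym caterpillar_sym by fastforce

lemma weight_theta:
  assumes "cat_parts V m L R S" "theta_edges L R S X"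
  shows "weight (caterpillar m L R S \<union> X) = path_weight (m # L) + path_weight (m # R) + (\<Sum>y\<in>S. wt m y) + weight X"
  using theta_edges_props[OF assms] finite_simple_graph[OF simple_caterpillar[OF assms(1)]]
  by (subst weight_Un) (auto simp: weight_caterpillar[OF assms(1)])

lemma competitor:
  assumes "cat_parts V m' L' R' S'" "theta_edges L' R' S' X'" "length L' + length R' = d"
  shows "weight (caterpillar m' L' R' S' \<union> X') \<le> weight D"
    and "weight (caterpillar m' L' R' S' \<union> X') = weight D \<Longrightarrow> u \<in> V \<Longrightarrow> row_sum (caterpillar m' L' R' S' \<union> X') u = row_sum D u"
  using max tight bicyclic_diam_caterpillar[OF assms(1,2)] assms(3) by auto

text \<open>
  Cut both arms and exchange the tails. The heads do not change, so the result is again a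
  competitor. If the heavier tail did not already hang on the heavier vertex, the exchange would
  increase the weight, or keep it and change the row sum at a cut vertex. An empty tail counts as
  the lighter one.
\<close>
lemma tail_exchange:
  assumes sh: "extremal_shape m L R S X" and L: "L = L1 @ L2" "L1 \<noteq> []" and R: "R = R1 @ R2" "R1 \<noteq> []" "R2 \<noteq> []"
    and tails: "L2 = [] \<or> x (hd L2) < x (hd R2)"
  shows "x (last L1) < x (last R1)"
proof (rule ccontr)
  assume "\<not> x (last L1) < x (last R1)"
  then have le: "x (last R1) \<le> x (last L1)" by simp
  define a b e where "a = last L1" and "b = last R1" and "e = hd R2"
  have cp: "cat_parts V m L R S" and X: "theta_edges L R S X" and D: "D = caterpillar m L R S \<union> X" and len: "length L + length R = d"
    using sh by (auto simp: extremal_shape_def)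
  let ?L = "L1 @ R2" and ?R = "R1 @ L2"
  have cp': "cat_parts V m ?L ?R S" using cp L R unfolding cat_parts_def by auto
  have hds: "hd ?L = hd L" "hd ?R = hd R" using L R by auto
  have X': "theta_edges ?L ?R S X" using X hds unfolding theta_edges_def theta5_edges_def theta3_edges_def by simp
  have len': "length ?L + length ?R = d" using len L R by simp
  note comp = competitor[OF cp' X' len']
  let ?H = "caterpillar m ?L ?R S \<union> X"
  have dist: "distinct (m # L1 @ L2 @ R1 @ R2)" using cp L R by (auto simp: cat_parts_def)
  have mem: "a \<in> set L1" "b \<in> set R1" "e \<in> set R2" "a \<in> V" "b \<in> V" "e \<in> V"
    using L R cp unfolding a_def b_def e_def by (auto simp: cat_parts_def)
  have ab: "a \<noteq> b" "a \<noteq> e" "b \<noteq> e" using mem dist by auto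
  define C where "C = path_edges (m # L1) \<union> path_edges (m # R1) \<union> path_edges L2 \<union> path_edges R2 \<union> (\<lambda>y. {m, y}) ` S \<union> X"
  have wDH: "weight D = path_weight (m # L) + path_weight (m # R) + (\<Sum>y\<in>S. wt m y) + weight X"
    "weight ?H = path_weight (m # ?L) + path_weight (m # ?R) + (\<Sum>y\<in>S. wt m y) + weight X"
    using weight_theta[OF cp X] weight_theta[OF cp' X'] D by simp_all
  have pR: "path_weight (m # R) = path_weight (m # R1) + wt b e + path_weight R2" "path_weight (m # ?L) = path_weight (m # L1) + wt a e + path_weight R2"
    using path_weight_join[of "m # R1" R2] path_weight_join[of "m # L1" R2] L R by (auto simp: a_def b_def e_def)
  have eR: "path_edges (m # R) = insert {b, e} (path_edges (m # R1) \<union> path_edges R2)"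
      "path_edges (m # ?L) = insert {a, e} (path_edges (m # L1) \<union> path_edges R2)"
    using path_edges_join[of "m # R1" R2] path_edges_join[of "m # L1" R2] L R by (auto simp: a_def b_def e_def)
  show False
  proof (cases "L2 = []")
    case True
    have "wt b e \<le> wt a e" using le unfolding a_def b_def by (rule wt_mono1)
    then have "weight D \<le> weight ?H" using wDH pR True L by simp
    then have row_sum: "row_sum ?H b = row_sum D b" using comp mem(5) by force
    have DC: "D = insert {b, e} C" and HC: "?H = insert {a, e} C"
      unfolding D caterpillar_def path_edges_split eR C_def using True L by auto
    have "{b, e} \<notin> ?H"
    proof -
      have "{b, e} \<noteq> {a, e}" using ab by (auto simp: doubleton_eq_iff)
      moreover have "{b, e} \<notin> C"
      proof -
        have "{b, e} \<in> caterpillar m L R S" unfolding caterpillar_def path_edges_split eR by simp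
        then have "{b, e} \<notin> X" using theta_edges_props(2)[OF cp X] by blast
        moreover have "{b, e} \<notin> path_edges (m # L1) \<union> path_edges (m # R1) \<union> path_edges L2 \<union> path_edges R2"
          using mem dist path_edges_subset[of "{b, e}"] by fastforce
        moreover have "{b, e} \<notin> (\<lambda>y. {m, y}) ` S" using mem dist cp L R by (auto simp: doubleton_eq_iff cat_parts_def)
        ultimately show ?thesis by (simp add: C_def)
      qed
      ultimately show ?thesis unfolding HC by simp
    qed
    moreover have "{w. {b, w} \<in> ?H} \<subseteq> {w. {b, w} \<in> D}" unfolding DC HC using ab by (auto simp: doubleton_eq_iff)
    moreover have "{b, e} \<in> D" unfolding DC by simp
    ultimately have "row_sum ?H b < row_sum D b" by (intro row_sum_less[OF sg]) blast
    then show False using row_sum by simp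
  next
    case False
    define c where "c = hd L2"
    have c: "x c < x e" using tails False by (simp add: c_def e_def)
    have memc: "c \<in> set L2" "c \<in> V" using False L cp by (auto simp: c_def cat_parts_def)
    have abc: "a \<noteq> c" "b \<noteq> c" "c \<noteq> e" using mem memc dist by auto
    have pL: "path_weight (m # L) = path_weight (m # L1) + wt a c + path_weight L2" "path_weight (m # ?R) = path_weight (m # R1) + wt b c + path_weight L2"
      using path_weight_join[of "m # L1" L2] path_weight_join[of "m # R1" L2] L R False by (auto simp: a_def b_def c_def)
    have eL: "path_edges (m # L) = insert {a, c} (path_edges (m # L1) \<union> path_edges L2)"
        "path_edges (m # ?R) = insert {b, c} (path_edges (m # R1) \<union> path_edges L2)"
      using path_edges_join[of "m # L1" L2] path_edges_join[of "m # R1" L2] L R False by (auto simp: a_def b_def c_def)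
    have "0 \<le> (x a - x b) * (x e - x c)" using le c unfolding a_def b_def by simp
    then have "0 \<le> wt a e + wt b c - (wt a c + wt b e)" using \<alpha>1 by (simp add: wt_exchange)
    then have "weight D \<le> weight ?H" using wDH pR pL by simp
    then have row_sum: "row_sum ?H a = row_sum D a" using comp mem(4) by force
    have DC: "D = C \<union> {{a, c}, {b, e}}" and HC: "?H = C \<union> {{a, e}, {b, c}}"
      unfolding D caterpillar_def path_edges_split eR eL C_def by auto
    have CD: "C \<inter> {{a, c}, {b, e}} = {}" "C \<inter> {{a, e}, {b, c}} = {}"
    proof -
      have X_out: "{a, c} \<notin> X" "{b, e} \<notin> X" "{a, e} \<notin> X" "{b, c} \<notin> X"
      proof -
        have "{{a, c}, {b, e}} \<subseteq> caterpillar m L R S" "{{a, e}, {b, c}} \<subseteq> caterpillar m ?L ?R S"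
          unfolding caterpillar_def path_edges_split eR eL by simp_all
        then show "{a, c} \<notin> X" "{b, e} \<notin> X" "{a, e} \<notin> X" "{b, c} \<notin> X"
          using theta_edges_props(2)[OF cp X] theta_edges_props(2)[OF cp' X'] by blast+
      qed
      have "{u, v} \<notin> path_edges (m # L1) \<union> path_edges (m # R1) \<union> path_edges L2 \<union> path_edges R2 \<union> (\<lambda>y. {m, y}) ` S"
        if "u \<in> {a, b}" "v \<in> {c, e}" for u v
      proof -
        have uv: "u \<in> set L1 \<union> set R1" "v \<in> set L2 \<union> set R2" using that mem memc by auto
        then have "u \<notin> set L2" "u \<notin> set R2" "v \<notin> set (m # L1)" "v \<notin> set (m # R1)" "u \<noteq> m" "v \<noteq> m"
          using dist by auto
        then show ?thesis
          using path_edges_subset[of "{u, v}" "m # L1"] path_edges_subset[of "{u, v}" "m # R1"]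
            path_edges_subset[of "{u, v}" L2] path_edges_subset[of "{u, v}" R2]
          by (auto simp: doubleton_eq_iff)
      qed
      then show "C \<inter> {{a, c}, {b, e}} = {}" "C \<inter> {{a, e}, {b, c}} = {}" using X_out unfolding C_def by auto
    qed
    have fC: "finite C" using fD DC by simp
    have "row_sum D a = row_sum C a + row_sum {{a, c}, {b, e}} a" "row_sum ?H a = row_sum C a + row_sum {{a, e}, {b, c}} a"
      unfolding DC HC using CD fC by (simp_all add: row_sum_Un del: insert_is_Un Un_insert_right)
    moreover have "{w. {a, w} \<in> {{a, c}, {b, e}}} = {c}" "{w. {a, w} \<in> {{a, e}, {b, c}}} = {e}"
      using ab abc by (auto simp: doubleton_eq_iff)
    then have "row_sum {{a, c}, {b, e}} a = row_term a c" "row_sum {{a, e}, {b, c}} a = row_term a e" by (simp_all add: row_sum_def)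
    ultimately have "row_term a c = row_term a e" using row_sum by simp
    then show False using c \<alpha>1 by (simp add: row_term_def)
  qed
qed

text \<open>
  Working inwards from the end of the shorter arm, each of its vertices is lighter than the vertex
  at the same position, shifted by \<open>k\<close>, of the longer arm.
\<close>
lemma arms_compare:
  assumes sh: "extremal_shape m L R S X" and k: "length L + k < length R" and i: "i < length L"
  shows "x (L ! i) < x (R ! (i + k))"
proof -
  have "i \<le> length L - 1" using i by simp
  then show ?thesis
  proof (induction i rule: inc_induct)
    case base
    have ne: "L \<noteq> []" using i by auto
    have n: "length L - 1 + k < length R" "take (Suc (length L - 1 + k)) R \<noteq> []" "drop (Suc (length L - 1 + k)) R \<noteq> []"
      using k ne i by auto
    have "x (last L) < x (last (take (Suc (length L - 1 + k)) R))"
      by (rule tail_exchange[OF sh, of L "[]" _ "drop (Suc (length L - 1 + k)) R"]) (use n ne in auto)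
    then show ?case using n(1) ne by (simp add: last_conv_nth take_Suc_conv_app_nth)
  next
    case (step i)
    then have i: "Suc i < length L" by simp
    have n: "take (Suc i) L \<noteq> []" "take (Suc (i + k)) R \<noteq> []" "drop (Suc (i + k)) R \<noteq> []"
      using i k by auto
    have "x (last (take (Suc i) L)) < x (last (take (Suc (i + k)) R))"
      by (rule tail_exchange[OF sh, of _ "drop (Suc i) L" _ "drop (Suc (i + k)) R"])
        (use n i k step.IH in \<open>auto simp: hd_drop_conv_nth\<close>)
    then show ?case using i k by (simp add: take_Suc_conv_app_nth)
  qed
qed

context
  fixes m assumes m: "m \<in> V" and m_max: "\<And>u. u \<in> V \<Longrightarrow> x u \<le> x m"
begin

text \<open>
  If the arm \<open>R\<close> were longer by at least two, its second vertex would be heavier than \<open>hd L\<close>. Then hanging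
  the arm \<open>L\<close> on \<open>hd R\<close>, and joining the second vertex of \<open>R\<close> to \<open>m\<close> and \<open>w\<^sub>4\<close> in place of \<open>hd L\<close>,
  would be a strict gain.
\<close>
lemma theta5_balanced:
  assumes sh: "extremal_shape m L R S X" and X5: "theta5_edges L R S X"
  shows "length R \<le> length L + 1"
proof (rule ccontr)
  assume "\<not> length R \<le> length L + 1"
  then have k: "length L + 1 < length R" by simp
  have cp: "cat_parts V m L R S" and X: "theta_edges L R S X" and D: "D = caterpillar m L R S \<union> X" and len: "length L + length R = d"
    using sh by (auto simp: extremal_shape_def)
  obtain l L1 where L: "L = l # L1" using cp by (cases L) (auto simp: cat_parts_def)
  obtain r1 r2 R1 where R: "R = r1 # r2 # R1" using k by (cases R rule: path_edges.cases) auto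
  have lr: "x l < x r2" using arms_compare[OF sh, of 1 0] k L R by simp
  obtain c where c: "c \<in> S" "X = {{c, l}, {c, r1}}" using X5 unfolding theta5_edges_def L R by auto
  let ?L = "r1 # L" and ?R = "r2 # R1"
  define X' where "X' = {{c, r1}, {c, r2}}"
  have cp': "cat_parts V m ?L ?R S" using cp unfolding R cat_parts_def by auto
  have X': "theta_edges ?L ?R S X'" unfolding theta_edges_def theta5_edges_def X'_def using c(1) by auto
  have ne: "c \<noteq> l" "c \<noteq> r1" "c \<noteq> r2" "l \<noteq> r1" "r1 \<noteq> r2" and V: "r1 \<in> V" "c \<in> V"
    using cp c(1) unfolding L R cat_parts_def by auto
  have wX: "weight X = wt c l + wt c r1" "weight X' = wt c r1 + wt c r2"
    unfolding c(2) X'_def using ne by (subst weight_two; auto simp: doubleton_eq_iff edge_weight_pair)+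
  have "0 \<le> (x m - x r1) * (x r2 - x l)" using m_max[OF V(1)] lr by simp
  then have 1: "0 \<le> wt m r2 + wt r1 l - (wt m l + wt r1 r2)" using \<alpha>1 by (simp add: wt_exchange)
  have 2: "wt c l < wt c r2" using wt_strict[OF lr pos[OF V(2)]] by (simp add: wt_commute)
  have "weight D < weight (caterpillar m ?L ?R S \<union> X')"
    using 1 2 wX weight_theta[OF cp X] weight_theta[OF cp' X'] unfolding D L R by simp
  then show False using competitor(1)[OF cp' X'] len R by simp
qed

text \<open>
  If \<open>R\<close> were longer than \<open>L\<close>, then \<open>hd R\<close> would be heavier than \<open>hd L\<close> and would be the better centre
  of the star. If \<open>L\<close> were longer by at least two, its second vertex would be heavier than \<open>hd R\<close>;
  hanging \<open>R\<close> on \<open>hd L\<close> and the rest of \<open>L\<close> on \<open>m\<close> would then lose no weight but change the row sum at \<open>m\<close>.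
\<close>
lemma theta3_balanced:
  assumes sh: "extremal_shape m L R S X" and X3: "theta3_edges L S X"
  shows "length R \<le> length L" "length L \<le> length R + 1"
proof -
  have cp: "cat_parts V m L R S" and X: "theta_edges L R S X" and D: "D = caterpillar m L R S \<union> X" and len: "length L + length R = d"
    using sh by (auto simp: extremal_shape_def)
  obtain l L1 where L: "L = l # L1" using cp by (cases L) (auto simp: cat_parts_def)
  obtain r R1 where R: "R = r # R1" using cp by (cases R) (auto simp: cat_parts_def)
  obtain y y' where y: "y \<in> S" "y' \<in> S" "y \<noteq> y'" "X = {{l, y}, {l, y'}}" using X3 unfolding theta3_edges_def L list.sel by blast
  have ne: "l \<noteq> y" "l \<noteq> y'" "r \<noteq> y" "r \<noteq> y'" and V: "l \<in> V" "r \<in> V" "y \<in> V" "y' \<in> V"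
    using cp y unfolding L R cat_parts_def by auto
  show "length R \<le> length L"
  proof (rule ccontr)
    assume "\<not> length R \<le> length L"
    then have "x l < x r" using arms_compare[OF sh, of 0 0] L R by simp
    define X' where "X' = {{r, y}, {r, y'}}"
    have X': "theta_edges L R S X'" unfolding theta_edges_def theta3_edges_def X'_def R using y by auto
    have "weight X = wt l y + wt l y'" "weight X' = wt r y + wt r y'"
      unfolding y(4) X'_def using ne y(3) by (subst weight_two; auto simp: doubleton_eq_iff edge_weight_pair)+
    moreover have "wt l y < wt r y" "wt l y' < wt r y'" using wt_strict \<open>x l < x r\<close> pos V by auto
    ultimately have "weight D < weight (caterpillar m L R S \<union> X')"
      unfolding D weight_theta[OF cp X] weight_theta[OF cp X'] by simp
    then show False using competitor(1)[OF cp X' len] by simp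
  qed
  show "length L \<le> length R + 1"
  proof (rule ccontr)
    assume "\<not> length L \<le> length R + 1"
    then have k: "length R + 1 < length L" by simp
    then obtain l2 L2 where L1: "L1 = l2 # L2" unfolding L by (cases L1) auto
    have lr: "x r < x l2" using arms_compare[OF extremal_shape_sym[OF sh], of 1 0] k L R L1 by simp
    let ?L = "l # R"
    have cp': "cat_parts V m ?L L1 S" using cp unfolding L L1 cat_parts_def by auto
    have X': "theta_edges ?L L1 S X" unfolding theta_edges_def theta3_edges_def using y by auto
    have len': "length ?L + length L1 = d" using len L by simp
    have "0 \<le> (x m - x l) * (x l2 - x r)" using m_max[OF V(1)] lr by simp
    then have "0 \<le> wt m l2 + wt l r - (wt m r + wt l l2)" using \<alpha>1 by (simp add: wt_exchange)
    then have "weight D \<le> weight (caterpillar m ?L L1 S \<union> X)"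
      using weight_theta[OF cp X] weight_theta[OF cp' X'] unfolding D L R L1 by simp
    then have "row_sum (caterpillar m ?L L1 S \<union> X) m = row_sum D m" using competitor[OF cp' X' len'] m by force
    then have "row_term m l2 = row_term m r"
      using row_sum_centre_split[OF cp' X'] row_sum_centre_split[OF cp X] unfolding D L R L1 by simp
    then show False using lr \<alpha>1 by (simp add: row_term_def)
  qed
qed

end

lemma extremal_classification:
  obtains m L R S X where "cat_parts V m L R S" "D = caterpillar m L R S \<union> X" "length L + length R = d"
    "length R \<le> length L" "length L \<le> length R + 1" "theta5_edges L R S X \<or> theta3_edges L S X"
proof -
  have "V \<noteq> {}" using bic by (auto simp: bicyclic_diam_def)
  then obtain m where m: "m \<in> V" "\<And>u. u \<in> V \<Longrightarrow> x u \<le> x m"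
    using finite_argmax[OF fV, of x] by blast
  obtain L R S X where "cat_parts V m L R S" "theta_edges L R S X" "D = caterpillar m L R S \<union> X"
    "length L + length R = d" using extremal_is_theta[OF m] .
  then have sh: "extremal_shape m L R S X" unfolding extremal_shape_def by blast
  then have sh': "extremal_shape m R L S X" by (rule extremal_shape_sym)
  have bal5: "length R \<le> length L + 1" if "extremal_shape m L R S X" "theta5_edges L R S X" for L R
    using theta5_balanced[OF m that] .
  have bal3: "length R \<le> length L \<and> length L \<le> length R + 1" if "extremal_shape m L R S X" "theta3_edges L S X" for L R
    using theta3_balanced[OF m that] by simp
  from \<open>theta_edges L R S X\<close> consider "theta5_edges L R S X" | "theta3_edges L S X" | "theta3_edges R S X"
    unfolding theta_edges_def by blast
  then show ?thesis
  proof cases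
    case 1
    then have b: "length R \<le> length L + 1" "length L \<le> length R + 1" using bal5[OF sh] bal5[OF sh' theta5_sym] by blast+
    show ?thesis
    proof (cases "length R \<le> length L")
      case True
      then show ?thesis using that[of m L R S X] sh b(2) True 1 unfolding extremal_shape_def by blast
    next
      case False
      then show ?thesis using that[of m R L S X] sh' b(1) False theta5_sym[OF 1] unfolding extremal_shape_def by (metis nat_le_linear)
    qed
  next
    case 2
    then show ?thesis using that[of m L R S X] sh bal3[OF sh 2] unfolding extremal_shape_def by blast
  next
    case 3
    then show ?thesis using that[of m R L S X] sh' bal3[OF sh' 3] unfolding extremal_shape_def by blast
  qed
qed

end

section \<open>The Rayleigh quotient\<close>

definition qform :: "'a set \<Rightarrow> ('a \<Rightarrow> 'a \<Rightarrow> real) \<Rightarrow> ('a \<Rightarrow> real) \<Rightarrow> real" where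
  "qform V c f = (\<Sum>u\<in>V. \<Sum>v\<in>V. c u v * f u * f v)"

lemma qform_attains_max:
  assumes fin: "finite V" and ne: "V \<noteq> {}"
  obtains f where "(\<Sum>u\<in>V. (f u)^2) = 1" "\<And>g. qform V c g \<le> qform V c f * (\<Sum>u\<in>V. (g u)^2)"
proof -
  \<comment> \<open>The unit sphere is compact in the product topology once the coordinates outside \<open>V\<close> are set to zero.\<close>
  define B where "B = PiE UNIV (\<lambda>u. if u \<in> V then {-1..1::real} else {0})"
  define K where "K = B \<inter> {f. (\<Sum>u\<in>V. (f u)^2) = 1}"
  have "compactin (product_topology (\<lambda>_. euclidean) UNIV) B"
    unfolding B_def compactin_PiE by auto
  then have cB: "compact B" by (simp add: euclidean_product_topology)
  have cont: "continuous_on UNIV (\<lambda>f::'a \<Rightarrow> real. f u)" for u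
    by (rule continuous_on_product_coordinates)
  have "closed {f::'a \<Rightarrow> real. (\<Sum>u\<in>V. (f u)^2) = 1}"
    by (intro closed_Collect_eq continuous_intros cont)
  then have cK: "compact K" unfolding K_def using cB by (rule compact_Int_closed[rotated])
  obtain a where a: "a \<in> V" using ne by auto
  have "(\<Sum>u\<in>V. ((\<lambda>u. if u = a then 1 else 0) u)^2) = (1::real)"
    using fin a by (simp add: if_distrib[of "\<lambda>z. z^2"] cong: if_cong)
  then have "(\<lambda>u. if u = a then 1 else 0) \<in> K" using a by (auto simp: K_def B_def)
  then have "K \<noteq> {}" by auto
  moreover have "continuous_on K (qform V c)"
    unfolding qform_def by (intro continuous_intros continuous_on_subset[OF cont]) auto
  ultimately obtain f where f: "f \<in> K" "\<And>g. g \<in> K \<Longrightarrow> qform V c g \<le> qform V c f"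
    using continuous_attains_sup[OF cK] by metis
  have "qform V c g \<le> qform V c f * (\<Sum>u\<in>V. (g u)^2)" for g
  proof (cases "(\<Sum>u\<in>V. (g u)^2) = 0")
    case True
    then have "\<forall>u\<in>V. g u = 0" using fin by (simp add: sum_nonneg_eq_0_iff)
    then show ?thesis using True by (simp add: qform_def)
  next
    case False
    define s where "s = (\<Sum>u\<in>V. (g u)^2)"
    have s: "0 < s" using False sum_nonneg[of V "\<lambda>u. (g u)^2"] unfolding s_def by auto
    define g' where "g' u = (if u \<in> V then g u / sqrt s else 0)" for u
    have "(\<Sum>u\<in>V. (g' u)^2) = (\<Sum>u\<in>V. (g u)^2 / s)"
      using s by (intro sum.cong) (auto simp: g'_def power_divide)
    also have "\<dots> = 1" using s by (simp add: sum_divide_distrib[symmetric] s_def[symmetric])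
    finally have n1: "(\<Sum>u\<in>V. (g' u)^2) = 1" .
    have bd: "- 1 \<le> g' u \<and> g' u \<le> 1" if "u \<in> V" for u
    proof -
      have "(g' u)^2 \<le> (\<Sum>u\<in>V. (g' u)^2)" using fin that by (intro member_le_sum) auto
      then have "\<bar>g' u\<bar> \<le> 1" using n1 by (simp add: abs_square_le_1)
      then show ?thesis by linarith
    qed
    have "g' u = 0" if "u \<notin> V" for u using that by (simp add: g'_def)
    then have "g' \<in> K" using n1 bd by (auto simp: K_def B_def)
    then have le: "qform V c g' \<le> qform V c f" by (rule f(2))
    have "qform V c g' = (\<Sum>u\<in>V. \<Sum>v\<in>V. c u v * g u * g v / s)"
      unfolding qform_def using s by (intro sum.cong) (auto simp: g'_def real_sqrt_mult_self)
    also have "\<dots> = qform V c g / s" by (simp add: qform_def sum_divide_distrib)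
    finally show ?thesis using le s by (simp add: s_def[symmetric] divide_le_eq)
  qed
  then show ?thesis using that[of f] f(1) by (simp add: K_def)
qed

text \<open>
  Perturbing a maximiser of the Rayleigh quotient in the direction of one coordinate gives a
  quadratic polynomial in the parameter \<open>t\<close> that is nowhere positive and vanishes at \<open>0\<close>; its linear
  coefficient is therefore zero.
\<close>
lemma qform_maximizer_eigen:
  assumes fin: "finite V" and sym: "\<And>u v. c u v = c v u"
    and le: "\<And>g. qform V c g \<le> \<mu> * (\<Sum>u\<in>V. (g u)^2)" and eq: "qform V c f = \<mu> * (\<Sum>u\<in>V. (f u)^2)"
    and u: "u \<in> V"
  shows "(\<Sum>v\<in>V. c u v * f v) = \<mu> * f u"
proof -
  define r where "r = (\<Sum>v\<in>V. c u v * f v) - \<mu> * f u"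
  define b where "b = c u u - \<mu>"
  have ineq: "2 * t * r + t^2 * b \<le> 0" for t
  proof -
    define \<delta> where "\<delta> w = (if w = u then t else 0)" for w
    define g where "g w = f w + \<delta> w" for w
    have d: "(\<Sum>v\<in>V. h v * \<delta> v) = h u * t" for h
    proof -
      have "(\<Sum>v\<in>V. h v * \<delta> v) = (\<Sum>v\<in>V. if v = u then h u * t else 0)"
        by (intro sum.cong) (auto simp: \<delta>_def)
      then show ?thesis using fin u by simp
    qed
    have row_sum: "(\<Sum>v\<in>V. c w v * g w * g v) = (\<Sum>v\<in>V. c w v * f w * f v) + c w u * f w * t
        + (\<Sum>v\<in>V. c w v * f v) * \<delta> w + c w u * t * \<delta> w" for w
    proof -
      have "(\<Sum>v\<in>V. c w v * g w * g v) = (\<Sum>v\<in>V. c w v * f w * f v + (c w v * f w) * \<delta> v + (c w v * f v) * \<delta> w + (c w v * \<delta> w) * \<delta> v)"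
        by (intro sum.cong) (auto simp: g_def algebra_simps)
      also have "\<dots> = (\<Sum>v\<in>V. c w v * f w * f v) + (\<Sum>v\<in>V. (c w v * f w) * \<delta> v) + (\<Sum>v\<in>V. (c w v * f v) * \<delta> w) + (\<Sum>v\<in>V. (c w v * \<delta> w) * \<delta> v)"
        by (simp add: sum.distrib)
      also have "\<dots> = (\<Sum>v\<in>V. c w v * f w * f v) + c w u * f w * t + (\<Sum>v\<in>V. c w v * f v) * \<delta> w + c w u * \<delta> w * t"
        unfolding d by (simp add: sum_distrib_right)
      finally show ?thesis by (simp add: algebra_simps)
    qed
    have "qform V c g = qform V c f + (\<Sum>w\<in>V. c w u * f w * t)
        + (\<Sum>w\<in>V. (\<Sum>v\<in>V. c w v * f v) * \<delta> w) + (\<Sum>w\<in>V. (c w u * t) * \<delta> w)"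
      unfolding qform_def row_sum by (simp add: sum.distrib)
    also have "\<dots> = qform V c f + (\<Sum>w\<in>V. c u w * f w) * t + (\<Sum>v\<in>V. c u v * f v) * t + c u u * t * t"
      unfolding d using sym by (simp add: sum_distrib_right)
    finally have q: "qform V c g = qform V c f + 2 * t * (\<Sum>v\<in>V. c u v * f v) + t^2 * c u u"
      by (simp add: algebra_simps power2_eq_square)
    have "(\<Sum>w\<in>V. (g w)^2) = (\<Sum>w\<in>V. (f w)^2 + (2 * f w) * \<delta> w + \<delta> w * \<delta> w)"
      by (intro sum.cong) (auto simp: g_def power2_eq_square algebra_simps)
    also have "\<dots> = (\<Sum>w\<in>V. (f w)^2) + (\<Sum>w\<in>V. (2 * f w) * \<delta> w) + (\<Sum>w\<in>V. \<delta> w * \<delta> w)"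
      by (simp add: sum.distrib)
    also have "\<dots> = (\<Sum>w\<in>V. (f w)^2) + 2 * f u * t + t * t" unfolding d by (simp add: \<delta>_def)
    finally have n: "(\<Sum>w\<in>V. (g w)^2) = (\<Sum>w\<in>V. (f w)^2) + 2 * f u * t + t^2"
      by (simp add: power2_eq_square)
    show ?thesis using le[of g] eq unfolding q n r_def b_def by (simp add: algebra_simps)
  qed
  have "r = 0"
  proof (rule ccontr)
    assume r: "r \<noteq> 0"
    \<comment> \<open>A step length for which the linear term outweighs the quadratic one.\<close>
    define k where "k = \<bar>b\<bar> + 1"
    have k: "0 < k" "- k < b" by (simp_all add: k_def)
    have "2 * (r / k) * r + (r / k)^2 * b = r^2 / k^2 * (2 * k + b)"
      using k by (simp add: field_simps power2_eq_square)
    moreover have "0 < r^2 / k^2 * (2 * k + b)" using r k by (intro mult_pos_pos divide_pos_pos) auto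
    ultimately show False using ineq[of "r / k"] by simp
  qed
  then show ?thesis by (simp add: r_def)
qed

lemma qform_abs_le:
  assumes "finite V" and "\<And>u v. 0 \<le> c u v"
  shows "qform V c f \<le> qform V c (\<lambda>u. \<bar>f u\<bar>)"
  unfolding qform_def
proof (intro sum_mono)
  fix u v
  have "f u * f v \<le> \<bar>f u\<bar> * \<bar>f v\<bar>" by (metis abs_ge_self abs_mult)
  then have "c u v * (f u * f v) \<le> c u v * (\<bar>f u\<bar> * \<bar>f v\<bar>)" using assms(2) by (rule mult_left_mono)
  then show "c u v * f u * f v \<le> c u v * \<bar>f u\<bar> * \<bar>f v\<bar>" by (simp add: mult.assoc)
qed

section \<open>The spectral radius of a graph given by its edges\<close>

definition edge_graph :: "'a set \<Rightarrow> 'a set set \<Rightarrow> 'a pair_pre_digraph" where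
  "edge_graph V D = \<lparr> pverts = V, parcs = {(u, v). {u, v} \<in> D} \<rparr>"

definition alpha_entry :: "real \<Rightarrow> 'a set set \<Rightarrow> 'a \<Rightarrow> 'a \<Rightarrow> real" where
  "alpha_entry \<alpha> D u v = \<alpha> * (if u = v then real (card {w. {u, w} \<in> D}) else 0) + (1 - \<alpha>) * (if {u, v} \<in> D then 1 else 0)"

lemma alpha_entry_sym: "alpha_entry \<alpha> D u v = alpha_entry \<alpha> D v u"
  by (auto simp: alpha_entry_def insert_commute)

lemma alpha_entry_nonneg: "0 \<le> \<alpha> \<Longrightarrow> \<alpha> < 1 \<Longrightarrow> 0 \<le> alpha_entry \<alpha> D u v"
  by (auto simp: alpha_entry_def)

lemma out_degree_edge_graph: "out_degree (with_proj (edge_graph V D)) u = card {w. {u, w} \<in> D}"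
proof -
  have "out_arcs (with_proj (edge_graph V D)) u = Pair u ` {w. {u, w} \<in> D}"
    by (auto simp: out_arcs_def edge_graph_def)
  then show ?thesis by (simp add: out_degree_def card_image inj_on_def)
qed

lemma alpha_mat_edge_graph:
  assumes "distinct vs"
  shows "map_mat complex_of_real (alpha_mat \<alpha> vs (edge_graph V D)) =
    mat (length vs) (length vs) (\<lambda>(i, j). complex_of_real (alpha_entry \<alpha> D (vs ! i) (vs ! j)))"
  using assms by (intro eq_matI)
    (auto simp: alpha_mat_def adjacency_mat_def degree_mat_def alpha_entry_def out_degree_edge_graph
       nth_eq_iff_index_eq, auto simp: edge_graph_def)

lemma eigenvalue_alpha_mat:
  fixes vs :: "'a list" and V :: "'a set" and D :: "'a set set" and \<alpha> :: real
  assumes d: "distinct vs"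
  defines "M \<equiv> map_mat complex_of_real (alpha_mat \<alpha> vs (edge_graph V D))"
  shows "eigenvalue M k \<longleftrightarrow> (\<exists>f. (\<exists>u\<in>set vs. f u \<noteq> 0) \<and>
     (\<forall>u\<in>set vs. (\<Sum>v\<in>set vs. complex_of_real (alpha_entry \<alpha> D u v) * f v) = k * f u))"
    (is "_ \<longleftrightarrow> (\<exists>f. ?ne f \<and> ?eig f)")
proof -
  let ?n = "length vs"
  have M: "M = mat ?n ?n (\<lambda>(i, j). complex_of_real (alpha_entry \<alpha> D (vs ! i) (vs ! j)))"
    unfolding M_def using d by (rule alpha_mat_edge_graph)
  have bij: "bij_betw ((!) vs) {0..<?n} (set vs)"
    using d by (simp add: bij_betw_nth atLeast0LessThan)
  have mult: "(M *\<^sub>v vec ?n (\<lambda>i. f (vs ! i))) = vec ?n (\<lambda>i. \<Sum>v\<in>set vs. complex_of_real (alpha_entry \<alpha> D (vs ! i) v) * f v)" for f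
    unfolding M by (rule eq_vecI) (auto simp: scalar_prod_def sum.reindex_bij_betw[OF bij, symmetric])
  have ev: "eigenvector M (vec ?n (\<lambda>i. f (vs ! i))) k \<longleftrightarrow> ?ne f \<and> ?eig f" for f
  proof -
    have "vec ?n (\<lambda>i. f (vs ! i)) \<noteq> 0\<^sub>v ?n \<longleftrightarrow> ?ne f"
      by (auto simp: vec_eq_iff in_set_conv_nth) (metis nth_mem)
    moreover have "M *\<^sub>v vec ?n (\<lambda>i. f (vs ! i)) = k \<cdot>\<^sub>v vec ?n (\<lambda>i. f (vs ! i)) \<longleftrightarrow> ?eig f"
      unfolding mult by (auto simp: vec_eq_iff all_set_conv_all_nth)
    moreover have "dim_row M = ?n" by (simp add: M)
    ultimately show ?thesis by (simp add: eigenvector_def)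
  qed
  show ?thesis
  proof
    assume "eigenvalue M k"
    then obtain y where y: "eigenvector M y k" by (auto simp: eigenvalue_def)
    have yc: "dim_vec y = ?n" using y by (auto simp: eigenvector_def M)
    define f where "f v = y $ (the_inv_into {0..<?n} ((!) vs) v)" for v
    have "y = vec ?n (\<lambda>i. f (vs ! i))"
      using yc bij by (intro eq_vecI) (auto simp: f_def bij_betw_def the_inv_into_f_f)
    then show "\<exists>f. ?ne f \<and> ?eig f" using y ev by metis
  next
    assume "\<exists>f. ?ne f \<and> ?eig f"
    then show "eigenvalue M k" using ev unfolding eigenvalue_def by blast
  qed
qed

text \<open>
  The maximum \<open>\<mu>\<close> of the Rayleigh quotient is an eigenvalue, and it bounds the modulus of every complex
  eigenvalue, because the moduli of the entries of a complex eigenvector can be inserted into the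
  quadratic form. As the entries of the matrix are nonnegative, the maximum is attained at a
  nonnegative vector.
\<close>
lemma alpha_spectral_radius_rayleigh:
  fixes V :: "'a set" and D :: "'a set set" and \<alpha> :: real
  assumes fin: "finite V" "V \<noteq> {}" and \<alpha>: "0 \<le> \<alpha>" "\<alpha> < 1"
  defines "\<rho> \<equiv> alpha_spectral_radius \<alpha> (edge_graph V D)"
  shows "qform V (alpha_entry \<alpha> D) g \<le> \<rho> * (\<Sum>u\<in>V. (g u)^2)"
    and "\<exists>f. (\<forall>u. 0 \<le> f u) \<and> (\<Sum>u\<in>V. (f u)^2) = 1 \<and> qform V (alpha_entry \<alpha> D) f = \<rho>"
proof -
  let ?c = "alpha_entry \<alpha> D"
  note nn = alpha_entry_nonneg[OF \<alpha>, of D]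
  obtain f0 where f0: "(\<Sum>u\<in>V. (f0 u)^2) = 1" "\<And>g. qform V ?c g \<le> qform V ?c f0 * (\<Sum>u\<in>V. (g u)^2)"
    using qform_attains_max[OF fin, of ?c] by metis
  define f where "f u = \<bar>f0 u\<bar>" for u
  define \<mu> where "\<mu> = qform V ?c f"
  have f1: "(\<Sum>u\<in>V. (f u)^2) = 1" using f0(1) by (simp add: f_def)
  have "qform V ?c f = qform V ?c f0"
    using f0(2)[of f] f1 qform_abs_le[of V ?c f0, OF fin(1) nn] unfolding f_def by simp
  then have max: "qform V ?c g \<le> \<mu> * (\<Sum>u\<in>V. (g u)^2)" for g using f0(2) by (simp add: \<mu>_def)
  have eig: "(\<Sum>v\<in>V. ?c u v * f v) = \<mu> * f u" if "u \<in> V" for u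
    by (rule qform_maximizer_eigen[OF fin(1) alpha_entry_sym max _ that]) (simp add: f1 \<mu>_def)
  have \<mu>0: "0 \<le> \<mu>" unfolding \<mu>_def qform_def using nn by (intro sum_nonneg mult_nonneg_nonneg) (auto simp: f_def)
  obtain vs where vs: "set vs = V" "distinct vs" using finite_distinct_list[OF fin(1)] by auto
  define M where "M = map_mat complex_of_real (alpha_mat \<alpha> vs (edge_graph V D))"
  have \<rho>: "\<rho> = spectral_radius M"
    unfolding \<rho>_def M_def using vs by (intro alpha_spectral_radius_enum) (auto simp: edge_graph_def)
  have M: "M \<in> carrier_mat (length vs) (length vs)" "0 < length vs"
    using vs fin by (auto simp: M_def alpha_mat_edge_graph)
  have "complex_of_real \<mu> \<in> spectrum M"
  proof -
    have "(\<Sum>v\<in>V. complex_of_real (?c u v) * complex_of_real (f v)) = complex_of_real \<mu> * complex_of_real (f u)" if "u \<in> V" for u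
      using arg_cong[OF eig[OF that], of complex_of_real] by simp
    moreover have "\<exists>u\<in>V. complex_of_real (f u) \<noteq> 0"
    proof (rule ccontr)
      assume "\<not> ?thesis"
      then have "(\<Sum>u\<in>V. (f u)^2) = 0" by simp
      then show False using f1 by simp
    qed
    ultimately have "eigenvalue M (complex_of_real \<mu>)"
      unfolding M_def eigenvalue_alpha_mat[OF vs(2)] vs(1) by (intro exI[of _ "\<lambda>u. complex_of_real (f u)"]) auto
    then show ?thesis by (simp add: spectrum_def)
  qed
  then have ge: "\<mu> \<le> \<rho>" using spectral_radius_mem_max(2)[OF M, of \<mu>] \<mu>0 unfolding \<rho> by force
  have le: "norm k \<le> \<mu>" if "k \<in> spectrum M" for k
  proof -
    have "eigenvalue M k" using that by (simp add: spectrum_def)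
    then obtain z where z: "\<exists>u\<in>V. z u \<noteq> 0" "\<And>u. u \<in> V \<Longrightarrow> (\<Sum>v\<in>V. complex_of_real (?c u v) * z v) = k * z u"
      unfolding M_def eigenvalue_alpha_mat[OF vs(2)] vs(1) by blast
    define g where "g u = norm (z u)" for u
    have "norm k * g u \<le> (\<Sum>v\<in>V. ?c u v * g v)" if "u \<in> V" for u
    proof -
      have "norm k * g u = norm (\<Sum>v\<in>V. complex_of_real (?c u v) * z v)" unfolding z(2)[OF that] by (simp add: g_def norm_mult)
      also have "\<dots> \<le> (\<Sum>v\<in>V. norm (complex_of_real (?c u v) * z v))" by (rule norm_sum)
      also have "\<dots> = (\<Sum>v\<in>V. ?c u v * g v)" using nn by (intro sum.cong) (auto simp: norm_mult g_def)
      finally show ?thesis .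
    qed
    then have "(\<Sum>u\<in>V. g u * (norm k * g u)) \<le> (\<Sum>u\<in>V. g u * (\<Sum>v\<in>V. ?c u v * g v))"
      by (intro sum_mono mult_left_mono) (auto simp: g_def)
    also have "\<dots> = qform V ?c g" unfolding qform_def sum_distrib_left by (intro sum.cong) (auto simp: algebra_simps)
    also have "\<dots> \<le> \<mu> * (\<Sum>u\<in>V. (g u)^2)" by (rule max)
    also have "(\<Sum>u\<in>V. g u * (norm k * g u)) = norm k * (\<Sum>u\<in>V. (g u)^2)"
      unfolding sum_distrib_left by (intro sum.cong) (auto simp: power2_eq_square)
    finally have "norm k * (\<Sum>u\<in>V. (g u)^2) \<le> \<mu> * (\<Sum>u\<in>V. (g u)^2)" .
    moreover have "0 < (\<Sum>u\<in>V. (g u)^2)"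
    proof -
      obtain u where u: "u \<in> V" "z u \<noteq> 0" using z(1) by auto
      then show ?thesis using fin(1) by (intro sum_pos2[of V u]) (auto simp: g_def)
    qed
    ultimately show ?thesis by simp
  qed
  have "\<rho> \<le> \<mu>" using spectral_radius_mem_max(1)[OF M] le unfolding \<rho> by auto
  then have \<rho>\<mu>: "\<rho> = \<mu>" using ge by simp
  show "qform V ?c g \<le> \<rho> * (\<Sum>u\<in>V. (g u)^2)" unfolding \<rho>\<mu> by (rule max)
  show "\<exists>f. (\<forall>u. 0 \<le> f u) \<and> (\<Sum>u\<in>V. (f u)^2) = 1 \<and> qform V ?c f = \<rho>"
    using f1 unfolding \<rho>\<mu> \<mu>_def by (intro exI[of _ f]) (auto simp: f_def)
qed

lemma (in vertex_weight) row_sum_alpha_entry: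
  assumes "simple_graph V D" "u \<in> V"
  shows "(\<Sum>v\<in>V. alpha_entry \<alpha> D u v * x v) = row_sum D u"
proof -
  have fin: "finite V" using assms by (simp add: simple_graph_def)
  have sub: "{w. {u, w} \<in> D} \<subseteq> V" using simple_graph_pair[OF assms(1)] by blast
  have "(\<Sum>v\<in>V. alpha_entry \<alpha> D u v * x v) =
      (\<Sum>v\<in>V. (if v = u then \<alpha> * real (card {w. {u, w} \<in> D}) * x u else 0) + (if v \<in> {w. {u, w} \<in> D} then (1 - \<alpha>) * x v else 0))"
    by (intro sum.cong) (auto simp: alpha_entry_def algebra_simps)
  also have "\<dots> = \<alpha> * real (card {w. {u, w} \<in> D}) * x u + (\<Sum>v\<in>{w. {u, w} \<in> D}. (1 - \<alpha>) * x v)"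
    using fin assms(2) sub by (simp add: sum.distrib sum.inter_restrict[symmetric] Int_absorb1 del: mem_Collect_eq)
  finally show ?thesis by (simp add: row_sum_def row_term_def sum.distrib)
qed

text \<open>
  Adding the edge \<open>ab\<close> changes the row sums only at \<open>a\<close> and \<open>b\<close>.
\<close>
lemma (in vertex_weight) weight_eq_qform:
  assumes "simple_graph V D"
  shows "weight D = qform V (alpha_entry \<alpha> D) x"
proof -
  have fV: "finite V" using assms by (simp add: simple_graph_def)
  have "weight D = (\<Sum>u\<in>V. x u * row_sum D u)"
    using finite_simple_graph[OF assms] assms
  proof (induction D rule: finite_induct)
    case empty
    then show ?case by (simp add: weight_def row_sum_def)
  next
    case (insert e D)
    then have sD: "simple_graph V D" by (simp add: simple_graph_def)
    obtain a b where ab: "e = {a, b}" "a \<noteq> b" "a \<in> V" "b \<in> V" using simple_graph_edge[OF insert.prems, of e] by auto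
    have r: "row_sum (insert e D) u = row_sum D u + (if u = a then row_term a b else 0) + (if u = b then row_term b a else 0)" for u
    proof -
      have fin: "finite {w. {u, w} \<in> D}" using insert.hyps(1) by (rule finite_neighbours)
      consider "u = a" | "u = b" | "u \<noteq> a" "u \<noteq> b" by blast
      then show ?thesis
      proof cases
        case 1
        then have "{w. {u, w} \<in> insert e D} = insert b {w. {u, w} \<in> D}" "b \<notin> {w. {u, w} \<in> D}"
          using ab insert.hyps(2) by (auto simp: doubleton_eq_iff)
        then show ?thesis using 1 ab fin by (simp add: row_sum_def)
      next
        case 2
        then have "{w. {u, w} \<in> insert e D} = insert a {w. {u, w} \<in> D}" "a \<notin> {w. {u, w} \<in> D}"
          using ab insert.hyps(2) by (auto simp: doubleton_eq_iff insert_commute)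
        then show ?thesis using 2 ab fin by (simp add: row_sum_def)
      next
        case 3
        then have "{w. {u, w} \<in> insert e D} = {w. {u, w} \<in> D}" using ab by (auto simp: doubleton_eq_iff)
        then show ?thesis using 3 by (simp add: row_sum_def)
      qed
    qed
    have "(\<Sum>u\<in>V. x u * row_sum (insert e D) u) = (\<Sum>u\<in>V. x u * row_sum D u + (if u = a then x a * row_term a b else 0) + (if u = b then x b * row_term b a else 0))"
      by (intro sum.cong) (auto simp: r algebra_simps)
    also have "\<dots> = (\<Sum>u\<in>V. x u * row_sum D u) + x a * row_term a b + x b * row_term b a"
      using fV ab by (simp add: sum.distrib)
    finally have "(\<Sum>u\<in>V. x u * row_sum (insert e D) u) = (\<Sum>u\<in>V. x u * row_sum D u) + (x a * row_term a b + x b * row_term b a)"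
      by simp
    moreover have "x a * row_term a b + x b * row_term b a = edge_weight e"
      unfolding ab(1) edge_weight_pair[OF ab(2)] row_term_def wt_def by (simp add: algebra_simps power2_eq_square)
    ultimately show ?case using insert.IH[OF sD] insert.hyps by (simp add: weight_def)
  qed
  also have "\<dots> = qform V (alpha_entry \<alpha> D) x"
    unfolding qform_def using row_sum_alpha_entry[OF assms] by (intro sum.cong) (auto simp: sum_distrib_left[symmetric] algebra_simps)
  finally show ?thesis .
qed

section \<open>Edge sets and digraphs\<close>

lemma edge_graph_simps [simp]:
  "pverts (edge_graph V D) = V" "(u, v) \<in> parcs (edge_graph V D) \<longleftrightarrow> {u, v} \<in> D"
  by (simp_all add: edge_graph_def)

lemma pair_graph_edge_graph:
  assumes "simple_graph V D"
  shows "pair_graph (edge_graph V D)"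
proof -
  have *: "u \<noteq> v" "u \<in> V" "v \<in> V" if "{u, v} \<in> D" for u v
    using simple_graph_pair[OF assms that] by auto
  have "finite V" using assms by (simp add: simple_graph_def)
  moreover have "finite {(u, v). {u, v} \<in> D}"
    by (rule finite_subset[of _ "V \<times> V"]) (use * \<open>finite V\<close> in auto)
  ultimately show ?thesis
    using * by unfold_locales (auto simp: edge_graph_def symmetric_def sym_def insert_commute)
qed

lemma uedges_edge_graph: "simple_graph V D \<Longrightarrow> uedges (edge_graph V D) = D"
  unfolding uedges_def edge_graph_def
  by (auto simp: image_iff) (metis simple_graph_edge)

lemma near_iff_awalk:
  assumes sg: "simple_graph V D" and u: "u \<in> V"
  shows "near D k u v \<longleftrightarrow> (\<exists>p. pre_digraph.awalk (with_proj (edge_graph V D)) u p v \<and> length p \<le> k)"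
proof -
  interpret pair_graph "edge_graph V D" using sg by (rule pair_graph_edge_graph)
  show ?thesis using u
  proof (induction k arbitrary: u)
    case 0
    then show ?case by (auto simp: awalk_Nil_iff)
  next
    case (Suc k)
    show ?case
    proof
      assume "near D (Suc k) u v"
      then consider "near D k u v" | w where "{u, w} \<in> D" "near D k w v" unfolding near.simps by blast
      then show "\<exists>p. awalk u p v \<and> length p \<le> Suc k"
      proof cases
        case 1
        then obtain p where "awalk u p v" "length p \<le> k" using Suc.IH[OF Suc.prems] by blast
        then show ?thesis by (intro exI[of _ p]) simp
      next
        case 2
        then have "w \<in> V" using simple_graph_pair[OF sg] by blast
        then obtain p where "awalk w p v" "length p \<le> k" using Suc.IH 2 by blast
        then show ?thesis using 2 by (intro exI[of _ "(u, w) # p"]) (auto simp: awalk_Cons_iff)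
      qed
    next
      assume "\<exists>p. awalk u p v \<and> length p \<le> Suc k"
      then obtain p where p: "awalk u p v" "length p \<le> Suc k" by blast
      show "near D (Suc k) u v"
      proof (cases p)
        case Nil
        then show ?thesis using p near_refl by (auto simp: awalk_Nil_iff)
      next
        case (Cons e q)
        then obtain w where w: "e = (u, w)" "{u, w} \<in> D" "awalk w q v"
          using p by (cases e) (auto simp: awalk_Cons_iff)
        moreover from this have "w \<in> V" using simple_graph_pair[OF sg] by blast
        ultimately have "near D k w v" using Suc.IH p Cons by auto
        then show ?thesis using w by (auto simp: near.simps)
      qed
    qed
  qed
qed

lemma gdist_edge_graph:
  assumes "simple_graph V D"
  shows "gdist (edge_graph V D) u v =
    (INF p\<in>{p. pre_digraph.awalk (with_proj (edge_graph V D)) u p v}. ereal (real (length p)))"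
proof -
  interpret pair_graph "edge_graph V D" using assms by (rule pair_graph_edge_graph)
  have "awalk_cost (\<lambda>_. 1) p = real (length p)" for p :: "('a \<times> 'a) list"
    by (induction p) auto
  then show ?thesis unfolding gdist_def \<mu>_def by simp
qed

lemma gdist_le_iff:
  assumes sg: "simple_graph V D" and u: "u \<in> V"
  shows "gdist (edge_graph V D) u v \<le> ereal (real k) \<longleftrightarrow> near D k u v"
proof -
  note g = gdist_edge_graph[OF sg]
  show ?thesis
  proof
    assume "gdist (edge_graph V D) u v \<le> ereal (real k)"
    also have "\<dots> < ereal (real (Suc k))" by simp
    finally obtain p where "pre_digraph.awalk (with_proj (edge_graph V D)) u p v" "length p < Suc k"
      unfolding g INF_less_iff by auto
    then show "near D k u v" unfolding near_iff_awalk[OF sg u] by auto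
  next
    assume "near D k u v"
    then obtain p where "pre_digraph.awalk (with_proj (edge_graph V D)) u p v" "length p \<le> k" unfolding near_iff_awalk[OF sg u] by auto
    then show "gdist (edge_graph V D) u v \<le> ereal (real k)"
      unfolding g by (intro INF_lower2[of p]) auto
  qed
qed

lemma gdist_ge_iff:
  assumes sg: "simple_graph V D" and u: "u \<in> V"
  shows "ereal (real d) \<le> gdist (edge_graph V D) u v \<longleftrightarrow> (\<forall>k<d. \<not> near D k u v)"
proof -
  note g = gdist_edge_graph[OF sg]
  show ?thesis unfolding g le_INF_iff near_iff_awalk[OF sg u] by (auto simp: not_le) (meson le_refl not_less order.strict_trans1)
qed

lemma diameter_iff:
  assumes sg: "simple_graph V D" and ne: "V \<noteq> {}"
  shows "diameter (edge_graph V D) = ereal (real d) \<longleftrightarrow>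
    (\<forall>u\<in>V. \<forall>v\<in>V. near D d u v) \<and> (\<exists>u\<in>V. \<exists>v\<in>V. \<forall>k<d. \<not> near D k u v)"
proof -
  let ?g = "gdist (edge_graph V D)"
  have diam: "diameter (edge_graph V D) = (SUP u\<in>V. SUP v\<in>V. ?g u v)"
    by (simp add: diameter_def)
  have le: "diameter (edge_graph V D) \<le> ereal (real k) \<longleftrightarrow> (\<forall>u\<in>V. \<forall>v\<in>V. near D k u v)" for k
    unfolding diam SUP_le_iff using gdist_le_iff[OF sg] by auto
  show ?thesis
  proof
    assume eq: "diameter (edge_graph V D) = ereal (real d)"
    have "\<exists>u\<in>V. \<exists>v\<in>V. \<forall>k<d. \<not> near D k u v"
    proof (cases d)
      case 0
      then show ?thesis using ne by auto
    next
      case (Suc e)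
      then have "\<not> diameter (edge_graph V D) \<le> ereal (real e)" using eq by simp
      then obtain u v where "u \<in> V" "v \<in> V" "\<not> near D e u v" unfolding le by auto
      moreover from this have "\<not> near D k u v" if "k < d" for k
        using near_mono[of D k u v e] that Suc by auto
      ultimately show ?thesis by blast
    qed
    then show "(\<forall>u\<in>V. \<forall>v\<in>V. near D d u v) \<and> (\<exists>u\<in>V. \<exists>v\<in>V. \<forall>k<d. \<not> near D k u v)"
      using le[of d] eq by simp
  next
    assume r: "(\<forall>u\<in>V. \<forall>v\<in>V. near D d u v) \<and> (\<exists>u\<in>V. \<exists>v\<in>V. \<forall>k<d. \<not> near D k u v)"
    then obtain u v where uv: "u \<in> V" "v \<in> V" "\<forall>k<d. \<not> near D k u v" by blast
    have "ereal (real d) \<le> ?g u v" using gdist_ge_iff[OF sg uv(1)] uv(3) by blast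
    also have "\<dots> \<le> diameter (edge_graph V D)" unfolding diam using uv by (meson SUP_upper2 order_refl)
    finally show "diameter (edge_graph V D) = ereal (real d)" using le[of d] r by (intro antisym) auto
  qed
qed

lemma bicyclic_graphs_edge_graph:
  assumes "bicyclic_diam V D d" "card V = n"
  shows "edge_graph V D \<in> bicyclic_graphs n d"
proof -
  have sg: "simple_graph V D" and c: "card D = card V + 1" and all: "\<forall>u\<in>V. \<forall>v\<in>V. near D d u v"
    and ne: "V \<noteq> {}"
    using assms by (auto simp: bicyclic_diam_def)
  interpret pair_graph "edge_graph V D" using sg by (rule pair_graph_edge_graph)
  have "strongly_connected (mk_symmetric (edge_graph V D))"
    unfolding strongly_connected_def
  proof (intro conjI ballI)
    show "verts (with_proj (mk_symmetric (edge_graph V D))) \<noteq> {}" using ne by simp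
    fix u v assume "u \<in> verts (with_proj (mk_symmetric (edge_graph V D)))" "v \<in> verts (with_proj (mk_symmetric (edge_graph V D)))"
    then have uv: "u \<in> V" "v \<in> V" by auto
    then obtain p where "awalk u p v" using all near_iff_awalk[OF sg uv(1), of d v] by blast
    then show "u \<rightarrow>\<^sup>*\<^bsub>with_proj (mk_symmetric (edge_graph V D))\<^esub> v"
      by (intro reachable_mk_symmetricI reachable_awalkI)
  qed
  then have "bicyclic (edge_graph V D)"
    unfolding bicyclic_def Digraph_Component.connected_def using pair_graph_edge_graph[OF sg] c
    by (simp add: uedges_edge_graph[OF sg])
  moreover have "diameter (edge_graph V D) = ereal (real d)"
    using diameter_iff[OF sg ne] assms(1) by (simp add: bicyclic_diam_def)
  ultimately show ?thesis using assms(2) by (simp add: bicyclic_graphs_def)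
qed

lemma edge_graph_uedges:
  assumes "pair_graph G"
  shows "simple_graph (pverts G) (uedges G)" "edge_graph (pverts G) (uedges G) = G"
proof -
  interpret pair_graph G by fact
  have symm: "(u, v) \<in> parcs G \<longleftrightarrow> (v, u) \<in> parcs G" for u v
    using pair_sym_arcs unfolding symmetric_def sym_def by auto
  have "card e = 2 \<and> e \<subseteq> pverts G" if e: "e \<in> uedges G" for e
  proof -
    obtain u v where uv: "(u, v) \<in> parcs G" "e = {u, v}" using e by (auto simp: uedges_def)
    then show ?thesis using pair_no_loops[OF uv(1)] in_arcsD1[OF uv(1)] in_arcsD2[OF uv(1)] by auto
  qed
  then show "simple_graph (pverts G) (uedges G)" using pair_finite_verts by (auto simp: simple_graph_def)
  have "{u, v} \<in> uedges G \<longleftrightarrow> (u, v) \<in> parcs G" for u v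
    using symm by (auto simp: uedges_def image_iff doubleton_eq_iff)
  then show "edge_graph (pverts G) (uedges G) = G"
    unfolding edge_graph_def by (intro pair_pre_digraph.equality) auto
qed

lemma bicyclic_graphs_diam:
  assumes "G \<in> bicyclic_graphs n d"
  shows "bicyclic_diam (pverts G) (uedges G) d"
proof -
  have pg: "pair_graph G" and c: "card (uedges G) = card (pverts G) + 1" and diam: "diameter G = ereal (real d)"
    using assms by (auto simp: bicyclic_graphs_def bicyclic_def)
  note eg = edge_graph_uedges[OF pg]
  have "uedges G \<noteq> {}" using c by auto
  then have "pverts G \<noteq> {}" using simple_graph_edge[OF eg(1)] by blast
  then show ?thesis using diameter_iff[OF eg(1), of d] diam c eg by (simp add: bicyclic_diam_def)
qed

text \<open>
  A graph of diameter at most one is complete, and no complete graph has exactly one edge more than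
  vertices.
\<close>
lemma bicyclic_diam_ge_2:
  assumes "bicyclic_diam V D d"
  shows "2 \<le> d"
proof (rule ccontr)
  assume "\<not> 2 \<le> d"
  then have d1: "d \<le> Suc 0" by simp
  have sg: "simple_graph V D" and c: "card D = card V + 1" and fV: "finite V"
    using assms by (auto simp: bicyclic_diam_def simple_graph_def)
  have "near D (Suc 0) u v" if "u \<in> V" "v \<in> V" for u v
    using assms that d1 near_mono unfolding bicyclic_diam_def by metis
  then have "D = {e. e \<subseteq> V \<and> card e = 2}"
    using sg unfolding simple_graph_def by (auto simp: near.simps card_2_iff)
  then have "card V choose 2 = card V + 1" using n_subsets[OF fV, of 2] c by simp
  then have eq: "card V * (card V - 1) div 2 = card V + 1" by (simp add: choose_two)
  consider "card V < 4" | k where "card V = k + 4" by (metis add.commute le_Suc_ex not_less)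
  then show False
  proof cases
    case 1
    then have "card V \<in> {0, 1, 2, 3}" by auto
    then show False using eq by auto
  next
    case 2
    have "2 * (k + 6) \<le> (k + 4) * (k + 3)" by (simp add: algebra_simps)
    then have "2 * (k + 6) div 2 \<le> (k + 4) * (k + 3) div 2" by (rule div_le_mono)
    then show False using eq 2 by (simp add: add.commute)
  qed
qed

section \<open>A Perron vector of an extremal graph\<close>

text \<open>
  A nonnegative maximiser of the Rayleigh quotient of \<open>G\<close> is an eigenvector. If it vanished at a
  vertex, the row sum there would force it to vanish at all neighbours, hence everywhere. The
  weight of a competitor \<open>H\<close> is at most its spectral radius, which is at most that of \<open>G\<close>; if the
  weight of \<open>H\<close> equals that of \<open>G\<close>, the vector is also an eigenvector of \<open>H\<close> with the same eigenvalue.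
\<close>
lemma perron_extremal:
  fixes G :: "'a pair_pre_digraph"
  assumes \<alpha>: "0 \<le> \<alpha>" "\<alpha> < 1" and G: "G \<in> bicyclic_graphs n d"
    and max: "\<forall>H \<in> (bicyclic_graphs n d :: 'a pair_pre_digraph set). alpha_spectral_radius \<alpha> H \<le> alpha_spectral_radius \<alpha> G"
  obtains x where "extremal \<alpha> x (pverts G) (uedges G) d"
proof -
  define V D where "V = pverts G" and "D = uedges G"
  define \<rho> where "\<rho> = alpha_spectral_radius \<alpha> G"
  have bic: "bicyclic_diam V D d" using bicyclic_graphs_diam[OF G] by (simp add: V_def D_def)
  have "pair_graph G" "card V = n" using G by (auto simp: bicyclic_graphs_def bicyclic_def V_def)
  then have GD: "edge_graph V D = G" using edge_graph_uedges(2) by (simp add: V_def D_def)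
  have sg: "simple_graph V D" and fV: "finite V" and neV: "V \<noteq> {}"
    using bic by (auto simp: bicyclic_diam_def simple_graph_def)
  obtain f where f0: "\<And>u. 0 \<le> f u" and f1: "(\<Sum>u\<in>V. (f u)^2) = 1" and fq: "qform V (alpha_entry \<alpha> D) f = \<rho>"
    using alpha_spectral_radius_rayleigh(2)[OF fV neV \<alpha>, of D] unfolding GD \<rho>_def by blast
  interpret vertex_weight \<alpha> f using \<alpha> f0 by unfold_locales auto
  have eig: "row_sum H u = \<rho> * f u" if sH: "simple_graph V H" and r: "alpha_spectral_radius \<alpha> (edge_graph V H) = \<rho>" and w: "weight H = \<rho>" and u: "u \<in> V" for H u
  proof -
    have "(\<Sum>v\<in>V. alpha_entry \<alpha> H u v * f v) = \<rho> * f u"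
    proof (rule qform_maximizer_eigen[OF fV alpha_entry_sym _ _ u])
      show "qform V (alpha_entry \<alpha> H) g \<le> \<rho> * (\<Sum>u\<in>V. (g u)^2)" for g
        using alpha_spectral_radius_rayleigh(1)[OF fV neV \<alpha>, of H g] r by simp
      show "qform V (alpha_entry \<alpha> H) f = \<rho> * (\<Sum>u\<in>V. (f u)^2)"
        using w f1 weight_eq_qform[OF sH] by simp
    qed
    then show ?thesis using row_sum_alpha_entry[OF sH u] by simp
  qed
  have wD: "weight D = \<rho>" using weight_eq_qform[OF sg] fq by simp
  have rowD: "row_sum D u = \<rho> * f u" if "u \<in> V" for u
    using eig[OF sg _ wD that] GD by (simp add: \<rho>_def)
  have zero_step: "f w = 0" if "{u, w} \<in> D" "f u = 0" for u w
  proof -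
    have "u \<in> V" using simple_graph_pair[OF sg that(1)] by simp
    then have "row_sum D u = 0" using rowD that(2) by simp
    moreover have "row_term u v \<ge> 0" for v using \<alpha> f0 by (simp add: row_term_def)
    moreover have "finite {w. {u, w} \<in> D}" using finite_simple_graph[OF sg] by (rule finite_neighbours)
    ultimately have "row_term u w = 0" using that(1) unfolding row_sum_def by (simp add: sum_nonneg_eq_0_iff)
    then show ?thesis using that(2) \<alpha> by (simp add: row_term_def)
  qed
  have zero_all: "near D k u v \<Longrightarrow> f u = 0 \<Longrightarrow> f v = 0" for k u v
    by (induction k arbitrary: u) (auto simp: near.simps dest: zero_step)
  have pos: "0 < f u" if "u \<in> V" for u
  proof (rule ccontr)
    assume "\<not> 0 < f u"
    then have "f u = 0" using f0[of u] by simp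
    then have "f v = 0" if "v \<in> V" for v
      using zero_all[of d u v] bic that \<open>u \<in> V\<close> unfolding bicyclic_diam_def by blast
    then show False using f1 by simp
  qed
  have le: "weight H \<le> alpha_spectral_radius \<alpha> (edge_graph V H)" "alpha_spectral_radius \<alpha> (edge_graph V H) \<le> \<rho>"
    if H: "bicyclic_diam V H d" for H
  proof -
    have sH: "simple_graph V H" using H by (simp add: bicyclic_diam_def)
    show "weight H \<le> alpha_spectral_radius \<alpha> (edge_graph V H)"
      using alpha_spectral_radius_rayleigh(1)[OF fV neV \<alpha>, of H f] f1 weight_eq_qform[OF sH] by simp
    show "alpha_spectral_radius \<alpha> (edge_graph V H) \<le> \<rho>"
      using max bicyclic_graphs_edge_graph[OF H \<open>card V = n\<close>] unfolding \<rho>_def by blast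
  qed
  have "extremal \<alpha> f V D d"
  proof unfold_locales
    show "u \<in> V \<Longrightarrow> 0 < f u" for u by (rule pos)
    show "bicyclic_diam V D d" by (rule bic)
    show "2 \<le> d" using bic by (rule bicyclic_diam_ge_2)
    show "bicyclic_diam V H d \<Longrightarrow> weight H \<le> weight D" for H using le[of H] wD by linarith
    show "row_sum H u = row_sum D u" if H: "bicyclic_diam V H d" and w: "weight H = weight D" and u: "u \<in> V" for H u
    proof -
      have "alpha_spectral_radius \<alpha> (edge_graph V H) = \<rho>" using le[OF H] w wD by linarith
      then show ?thesis using eig[of H u] H w wD rowD u by (simp add: bicyclic_diam_def)
    qed
  qed
  then show ?thesis using that by (simp add: V_def D_def)
qed

section \<open>The graphs of the theorem as edge sets\<close>

lemma graph_iso_edge_graph: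
  fixes \<phi> :: "nat \<Rightarrow> 'a"
  assumes bij: "bij_betw \<phi> {0..<n} V" and sg: "simple_graph V D" and sE: "simple_graph {0..<n} E"
    and D: "D = (\<lambda>e. \<phi> ` e) ` E"
  shows "graph_iso (edge_graph V D) (edge_graph {0..<n} E)"
proof -
  interpret G: pair_graph "edge_graph V D" using sg by (rule pair_graph_edge_graph)
  define \<psi> where "\<psi> = the_inv_into {0..<n} \<phi>"
  have inj: "inj_on \<phi> {0..<n}" and im: "\<phi> ` {0..<n} = V" using bij by (auto simp: bij_betw_def)
  have \<psi>\<phi>: "\<psi> (\<phi> i) = i" if "i < n" for i using that inj by (simp add: \<psi>_def the_inv_into_f_f)
  have injV: "inj_on \<psi> V" "\<psi> ` V = {0..<n}"
    using bij_betw_the_inv_into[OF bij] by (auto simp: \<psi>_def bij_betw_def)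
  have edge: "{\<phi> i, \<phi> j} \<in> D \<longleftrightarrow> {i, j} \<in> E" if "i < n" "j < n" for i j
  proof
    assume "{\<phi> i, \<phi> j} \<in> D"
    then obtain e where e: "e \<in> E" "\<phi> ` e = {\<phi> i, \<phi> j}" unfolding D by auto
    have "e \<subseteq> {0..<n}" using sE e(1) by (auto simp: simple_graph_def)
    moreover have "\<phi> ` e = \<phi> ` {i, j}" using e(2) by simp
    ultimately have "e = {i, j}" using inj_on_image_eq_iff[OF inj, of e "{i, j}"] that by auto
    then show "{i, j} \<in> E" using e by simp
  next
    assume "{i, j} \<in> E"
    then show "{\<phi> i, \<phi> j} \<in> D" unfolding D by (metis image_empty image_eqI image_insert)
  qed
  define h where "h = \<lparr> iso_verts = \<psi>, iso_arcs = map_prod \<psi> \<psi>, iso_head = snd, iso_tail = fst \<rparr>"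
  have sub: "parcs (edge_graph V D) \<subseteq> V \<times> V" using simple_graph_pair[OF sg] by auto
  have "pre_digraph.digraph_isomorphism (with_proj (edge_graph V D)) h"
    unfolding pre_digraph.digraph_isomorphism_def h_def
    using G.wf_digraph_axioms injV(1) inj_on_subset[OF map_prod_inj_on[OF injV(1) injV(1)] sub] by auto
  moreover have "with_proj (edge_graph {0..<n} E) = app_iso h (with_proj (edge_graph V D))"
  proof -
    have "map_prod \<psi> \<psi> ` parcs (edge_graph V D) = parcs (edge_graph {0..<n} E)"
    proof (intro equalityI subsetI)
      fix p assume "p \<in> map_prod \<psi> \<psi> ` parcs (edge_graph V D)"
      then obtain u v where uv: "{u, v} \<in> D" "p = (\<psi> u, \<psi> v)" by (auto simp: edge_graph_def)
      then have "u \<in> V" "v \<in> V" using simple_graph_pair[OF sg] by auto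
      then obtain i j where "u = \<phi> i" "v = \<phi> j" "i < n" "j < n" using im by auto
      then show "p \<in> parcs (edge_graph {0..<n} E)" using uv edge \<psi>\<phi> by simp
    next
      fix p assume "p \<in> parcs (edge_graph {0..<n} E)"
      then obtain i j where ij: "p = (i, j)" "{i, j} \<in> E" by (cases p) auto
      then have "i < n" "j < n" using simple_graph_pair[OF sE] by auto
      then show "p \<in> map_prod \<psi> \<psi> ` parcs (edge_graph V D)"
        using ij edge \<psi>\<phi> by (intro image_eqI[of _ _ "(\<phi> i, \<phi> j)"]) auto
    qed
    then show ?thesis by (simp add: app_iso_def with_proj_def h_def injV(2))
  qed
  ultimately show ?thesis unfolding graph_iso_def digraph_iso_def by blast
qed

lemma fresh_edge_graph: "0 < N \<Longrightarrow> fresh (edge_graph {0..<N} E) = N"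
proof -
  assume "0 < N"
  then have "Max {0..<N} = N - 1" by (intro Max_eqI) auto
  then show ?thesis using \<open>0 < N\<close> by (simp add: fresh_def)
qed

lemma attach_pendant_edge_graph:
  assumes "0 < N"
  shows "attach_pendant v (edge_graph {0..<N} E) = edge_graph {0..<Suc N} (insert {v, N} E)"
  unfolding attach_pendant_def fresh_edge_graph[OF assms]
  by (auto simp: edge_graph_def doubleton_eq_iff)

lemma attach_pendants_edge_graph:
  assumes "0 < N"
  shows "attach_pendants v s (edge_graph {0..<N} E) = edge_graph {0..<N + s} (E \<union> (\<lambda>y. {v, y}) ` {N..<N + s})"
  using assms
proof (induction s arbitrary: N E)
  case (Suc s)
  have "{N..<N + Suc s} = insert N {Suc N..<Suc N + s}" by auto
  then show ?case using Suc by (simp add: attach_pendant_edge_graph)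
qed auto

lemma attach_path_edge_graph:
  assumes "0 < N"
  shows "attach_path v l (edge_graph {0..<N} E) = edge_graph {0..<N + l} (E \<union> path_edges (v # [N..<N + l]))"
  using assms
proof (induction l arbitrary: v N E)
  case (Suc l)
  have "[N..<N + Suc l] = N # [Suc N..<Suc N + l]" by (simp add: upt_conv_Cons)
  then show ?case using Suc by (simp add: attach_pendant_edge_graph fresh_edge_graph)
qed auto

lemma Theta_edge_graph: "Theta = edge_graph {0..<4} {{0, 1}, {1, 2}, {2, 3}, {3, 0}, {1, 3}}"
proof -
  have "{0..<4::nat} = {0, 1, 2, 3}" by auto
  moreover have "{(u, v). {u, v} \<in> {{0, 1}, {1, 2}, {2, 3}, {3, 0}, {1, 3 :: nat}}} =
     {(0, 1), (1, 0), (1, 2), (2, 1), (2, 3), (3, 2), (3, 0), (0, 3), (1, 3), (3, 1)}"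
    by (auto simp: doubleton_eq_iff)
  ultimately show ?thesis by (simp only: Theta_def edge_graph_def)
qed

text \<open>
  The numbering produced by the repeated attachments: \<open>0, \<dots>, 3\<close> form the core, then come the \<open>s\<close>
  pendant vertices at \<open>1\<close>, the path attached at \<open>v\<close> and the path attached at \<open>w\<close>.
\<close>
definition theta_nat :: "nat \<Rightarrow> nat \<Rightarrow> nat \<Rightarrow> nat \<Rightarrow> nat \<Rightarrow> nat set set" where
  "theta_nat s v a w b = {{0, 1}, {1, 2}, {2, 3}, {3, 0}, {1, 3}} \<union> (\<lambda>y. {1, y}) ` {4..<4 + s} \<union>
     path_edges (v # [4 + s..<4 + s + a]) \<union> path_edges (w # [4 + s + a..<4 + s + a + b])"

lemma Theta3_edges: "Theta3 s a b = edge_graph {0..<4 + s + a + b} (theta_nat s 1 a 3 b)"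
  unfolding Theta3_def theta_nat_def Theta_edge_graph
  by (simp add: attach_pendants_edge_graph attach_path_edge_graph add.assoc)

lemma Theta5_edges: "Theta5 s a b = edge_graph {0..<4 + s + a + b} (theta_nat s 0 a 2 b)"
  unfolding Theta5_def theta_nat_def Theta_edge_graph
  by (simp add: attach_pendants_edge_graph attach_path_edge_graph add.assoc)

lemma path_edges_map: "path_edges (map f xs) = (\<lambda>e. f ` e) ` path_edges xs"
  by (induction xs rule: path_edges.induct) auto

lemma simple_theta_nat:
  assumes "v < 4" "w < 4"
  shows "simple_graph {0..<4 + s + a + b} (theta_nat s v a w b)"
proof -
  have 1: "e \<subseteq> {0..<4 + s + a + b} \<and> card e = 2" if "e \<in> path_edges (v # [4 + s..<4 + s + a])" for e
    using path_edges_card[OF _ that] path_edges_subset[OF that] assms by auto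
  have 2: "e \<subseteq> {0..<4 + s + a + b} \<and> card e = 2" if "e \<in> path_edges (w # [4 + s + a..<4 + s + a + b])" for e
    using path_edges_card[OF _ that] path_edges_subset[OF that] assms by auto
  show ?thesis unfolding simple_graph_def theta_nat_def using 1 2 by auto
qed

lemma map_nth_upt:
  assumes "us = xs @ ys @ zs" "k = length xs" "l = k + length ys"
  shows "map ((!) us) [k..<l] = ys"
  using assms by (intro nth_equalityI) (auto simp: nth_append)

lemma theta_nat_image:
  assumes vl: "vl = [w0, w1, w2, w3] @ ss @ as @ bs" and "v < 4" "w < 4"
  shows "(\<lambda>e. (!) vl ` e) ` theta_nat (length ss) v (length as) w (length bs) =
    {{w0, w1}, {w1, w2}, {w2, w3}, {w3, w0}, {w1, w3}} \<union> (\<lambda>y. {w1, y}) ` set ss \<union>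
    path_edges (vl ! v # as) \<union> path_edges (vl ! w # bs)"
proof -
  have a: "map ((!) vl) [4 + length ss..<4 + length ss + length as] = as"
    by (rule map_nth_upt[of vl "[w0, w1, w2, w3] @ ss" as bs]) (simp_all add: vl)
  have b: "map ((!) vl) [4 + length ss + length as..<4 + length ss + length as + length bs] = bs"
    by (rule map_nth_upt[of vl "[w0, w1, w2, w3] @ ss @ as" bs "[]"]) (simp_all add: vl)
  have s: "map ((!) vl) [4..<4 + length ss] = ss"
    by (rule map_nth_upt[of vl "[w0, w1, w2, w3]" ss "as @ bs"]) (simp_all add: vl)
  have "(\<lambda>e. (!) vl ` e) ` (\<lambda>y. {1, y}) ` {4..<4 + length ss} = (\<lambda>y. {vl ! 1, y}) ` set (map ((!) vl) [4..<4 + length ss])"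
    by (simp add: image_image)
  then have s': "(\<lambda>e. (!) vl ` e) ` (\<lambda>y. {1, y}) ` {4..<4 + length ss} = (\<lambda>y. {w1, y}) ` set ss"
    unfolding s by (simp add: vl)
  have c: "vl ! 0 = w0" "vl ! 1 = w1" "vl ! Suc 0 = w1" "vl ! 2 = w2" "vl ! 3 = w3" by (simp_all add: vl)
  have p: "(\<lambda>e. (!) vl ` e) ` path_edges (v # [4 + length ss..<4 + length ss + length as]) = path_edges (vl ! v # as)"
    "(\<lambda>e. (!) vl ` e) ` path_edges (w # [4 + length ss + length as..<4 + length ss + length as + length bs]) = path_edges (vl ! w # bs)"
    using path_edges_map[of "(!) vl" "v # [4 + length ss..<4 + length ss + length as]"]
      path_edges_map[of "(!) vl" "w # [4 + length ss + length as..<4 + length ss + length as + length bs]"] a b by simp_all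
  show ?thesis unfolding theta_nat_def image_Un p s' by (simp add: c)
qed

lemma graph_iso_theta_nat:
  assumes vl: "vl = [w0, w1, w2, w3] @ ss @ as @ bs" and vw: "v < 4" "w < 4"
    and d: "distinct vl" and V: "set vl = V" and sg: "simple_graph V D"
    and D: "D = {{w0, w1}, {w1, w2}, {w2, w3}, {w3, w0}, {w1, w3}} \<union> (\<lambda>y. {w1, y}) ` set ss \<union>
      path_edges (vl ! v # as) \<union> path_edges (vl ! w # bs)"
  shows "graph_iso (edge_graph V D)
    (edge_graph {0..<4 + length ss + length as + length bs} (theta_nat (length ss) v (length as) w (length bs)))"
proof (rule graph_iso_edge_graph)
  have "length vl = 4 + length ss + length as + length bs" by (simp add: vl)
  then show "bij_betw ((!) vl) {0..<4 + length ss + length as + length bs} V"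
    using d V by (metis atLeast0LessThan bij_betw_nth)
  show "D = (\<lambda>e. (!) vl ` e) ` theta_nat (length ss) v (length as) w (length bs)"
    unfolding theta_nat_image[OF vl vw] by (rule D)
qed (use sg simple_theta_nat[OF vw] in auto)

text \<open>
  The vertices of the diametral path next to \<open>m\<close> belong to the core, so an arm of length \<open>k\<close> leaves an
  attached path with \<open>k - 1\<close> vertices.
\<close>
lemma theta5_iso:
  assumes cp: "cat_parts V m L R S" and X: "theta5_edges L R S X"
  obtains s where "graph_iso (edge_graph V (caterpillar m L R S \<union> X)) (Theta5 s (length L - 1) (length R - 1))"
    "s + (length L - 1) + (length R - 1) + 4 = card V"
proof -
  have XX: "theta_edges L R S X" using X by (simp add: theta_edges_def)
  have sg: "simple_graph V (caterpillar m L R S \<union> X)"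
    using bicyclic_diam_caterpillar[OF cp XX] by (simp add: bicyclic_diam_def)
  obtain l L1 where L: "L = l # L1" using cp by (cases L) (auto simp: cat_parts_def)
  obtain r R1 where R: "R = r # R1" using cp by (cases R) (auto simp: cat_parts_def)
  obtain c where c: "c \<in> S" "X = {{c, l}, {c, r}}" using X unfolding theta5_edges_def L R list.sel by blast
  have "finite (S - {c})" using cp by (simp add: cat_parts_def)
  from finite_distinct_list[OF this] obtain ss where ss: "set ss = S - {c}" "distinct ss" by (elim exE conjE)
  define vl where "vl = [l, m, r, c] @ ss @ L1 @ R1"
  have d: "distinct vl" using cp c(1) ss unfolding vl_def cat_parts_def L R by auto
  have sV: "set vl = V" using cp c(1) ss(1) unfolding vl_def cat_parts_def L R by auto
  have S: "S = insert c (set ss)" using ss c by auto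
  have D: "caterpillar m L R S \<union> X = {{l, m}, {m, r}, {r, c}, {c, l}, {m, c}} \<union> (\<lambda>y. {m, y}) ` set ss \<union>
      path_edges (vl ! 0 # L1) \<union> path_edges (vl ! 2 # R1)"
    unfolding caterpillar_def path_edges_split c(2) S L R by (auto simp: vl_def insert_commute)
  have "graph_iso (edge_graph V (caterpillar m L R S \<union> X)) (Theta5 (length ss) (length L1) (length R1))"
    unfolding Theta5_edges by (rule graph_iso_theta_nat[OF vl_def _ _ d sV sg D]) auto
  moreover have "length vl = card V" using d sV distinct_card by metis
  ultimately show ?thesis using that[of "length ss"] by (simp add: L R vl_def)
qed

text \<open>
  Here \<open>m\<close> and \<open>hd L\<close> are the vertices of degree three of the core. So all of \<open>R\<close> is attached to \<open>m\<close>,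
  while \<open>hd L\<close> itself belongs to the core.
\<close>
lemma theta3_iso:
  assumes cp: "cat_parts V m L R S" and X: "theta3_edges L S X"
  obtains s where "graph_iso (edge_graph V (caterpillar m L R S \<union> X)) (Theta3 s (length R) (length L - 1))"
    "s + length R + (length L - 1) + 4 = card V"
proof -
  have XX: "theta_edges L R S X" using X by (simp add: theta_edges_def)
  have sg: "simple_graph V (caterpillar m L R S \<union> X)"
    using bicyclic_diam_caterpillar[OF cp XX] by (simp add: bicyclic_diam_def)
  obtain l L1 where L: "L = l # L1" using cp by (cases L) (auto simp: cat_parts_def)
  obtain y z where yz: "y \<in> S" "z \<in> S" "y \<noteq> z" "X = {{l, y}, {l, z}}" using X unfolding theta3_edges_def L list.sel by blast
  have "finite (S - {y, z})" using cp by (simp add: cat_parts_def)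
  from finite_distinct_list[OF this] obtain ss where ss: "set ss = S - {y, z}" "distinct ss" by (elim exE conjE)
  define vl where "vl = [y, m, z, l] @ ss @ R @ L1"
  have S: "S = insert y (insert z (set ss))" using ss(1) yz(1,2) by blast
  have yz': "y \<notin> set ss" "z \<notin> set ss" using ss(1) by auto
  have parts: "distinct (m # L @ R)" "S \<inter> set (m # L @ R) = {}" "V = set (m # L @ R) \<union> S"
    using cp by (simp_all add: cat_parts_def)
  have d: "distinct vl" using parts(1,2) yz(3) yz' ss(2) unfolding vl_def L S by simp blast
  have sV: "set vl = V" unfolding vl_def parts(3) L S by auto
  have D: "caterpillar m L R S \<union> X = {{y, m}, {m, z}, {z, l}, {l, y}, {m, l}} \<union> (\<lambda>y. {m, y}) ` set ss \<union>
      path_edges (vl ! 1 # R) \<union> path_edges (vl ! 3 # L1)"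
    unfolding caterpillar_def path_edges_split yz(4) S L by (auto simp: vl_def insert_commute)
  have "graph_iso (edge_graph V (caterpillar m L R S \<union> X)) (Theta3 (length ss) (length R) (length L1))"
    unfolding Theta3_edges by (rule graph_iso_theta_nat[OF vl_def _ _ d sV sg D]) auto
  moreover have "length vl = card V" using d sV distinct_card by metis
  ultimately show ?thesis using that[of "length ss"] by (simp add: L vl_def)
qed

lemma B3_starI:
  "s + a + b + 4 = n \<Longrightarrow> d = a + b + 1 \<Longrightarrow> b \<le> a \<Longrightarrow> a - b \<le> 1 \<Longrightarrow> Theta3 s a b \<in> B3_star n d"
  unfolding B3_star_def by blast

lemma B5_starI:
  "s + a + b + 4 = n \<Longrightarrow> d = a + b + 2 \<Longrightarrow> b \<le> a \<Longrightarrow> a - b \<le> 1 \<Longrightarrow> Theta5 s a b \<in> B5_star n d"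
  unfolding B5_star_def by blast

theorem theorem5p1:
  fixes \<alpha> :: real and n d :: nat and G :: "'a pair_pre_digraph"
  assumes "0 \<le> \<alpha>" and "\<alpha> < 1"
    and "(bicyclic_graphs n d :: 'a pair_pre_digraph set) \<noteq> {}"
    and "G \<in> bicyclic_graphs n d"
    and "\<forall>H \<in> (bicyclic_graphs n d :: 'a pair_pre_digraph set). alpha_spectral_radius \<alpha> H \<le> alpha_spectral_radius \<alpha> G"
  shows "(\<exists>H \<in> B3_star n d. graph_iso G H) \<or> (\<exists>H \<in> B5_star n d. graph_iso G H)"
proof -
  obtain x where "extremal \<alpha> x (pverts G) (uedges G) d"
    using perron_extremal[OF assms(1,2,4,5)] .
  then obtain m L R S X where cp: "cat_parts (pverts G) m L R S" and D: "uedges G = caterpillar m L R S \<union> X"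
    and len: "length L + length R = d" "length R \<le> length L" "length L \<le> length R + 1"
    and X: "theta5_edges L R S X \<or> theta3_edges L S X"
    by (rule extremal.extremal_classification)
  have "pair_graph G" and n: "card (pverts G) = n" using assms(4) by (auto simp: bicyclic_graphs_def bicyclic_def)
  then have G: "edge_graph (pverts G) (caterpillar m L R S \<union> X) = G"
    using edge_graph_uedges(2) D by metis
  have ne: "1 \<le> length L" "1 \<le> length R" using cp by (auto simp: cat_parts_def Suc_le_eq)
  from X show ?thesis
  proof
    assume X5: "theta5_edges L R S X"
    obtain s where "graph_iso (edge_graph (pverts G) (caterpillar m L R S \<union> X)) (Theta5 s (length L - 1) (length R - 1))"
      "s + (length L - 1) + (length R - 1) + 4 = card (pverts G)"
      using theta5_iso[OF cp X5] .
    note s = this[unfolded G n]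
    have "Theta5 s (length L - 1) (length R - 1) \<in> B5_star n d"
      using s(2) len ne by (intro B5_starI; linarith)
    then show ?thesis using s(1) by blast
  next
    assume X3: "theta3_edges L S X"
    obtain s where "graph_iso (edge_graph (pverts G) (caterpillar m L R S \<union> X)) (Theta3 s (length R) (length L - 1))"
      "s + length R + (length L - 1) + 4 = card (pverts G)"
      using theta3_iso[OF cp X3] .
    note s = this[unfolded G n]
    have "Theta3 s (length R) (length L - 1) \<in> B3_star n d"
      using s(2) len ne by (intro B3_starI; linarith)
    then show ?thesis using s(1) by blast
  qed
qed

end
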